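(* Let $0<\theta<1$, let $\chi$ be the cusp map, let $\varphi(z)=\exp\big(-(1-z)^{-\theta}\big)$ for $z\in\overline{\mathbb D}\setminus\{1\}$ with $\varphi(1)=0$, and let $c\in(0,1)$ be such that $|\chi(z)|+2c\,|\varphi(\chi(z))|<1$ for all $z\in\mathbb D$ (such $c$ exist). Let $g\in A(\mathbb D)$ be non-constant with $\|g\|_\infty\le 1$, and let $$\Phi(z_1,z_2)=\big(\chi(z_1),\ \chi(z_1)+c\,\varphi(\chi(z_1))\,g(z_2)\big).$$ Then: 1) $\Phi(\mathbb D^2)\subseteq\mathbb D^2$, and the composition operator $C_\Phi\colon H^2(\mathbb D^2)\to H^2(\mathbb D^2)$, $C_\Phi f=f\circ\Phi$, is (bounded and) compact; 2) $\Phi$ is non-degenerate, and its two components belong to the bidisk algebra $A(\mathbb D^2)$; 3) $\Phi(\mathbb T^2)\cap\mathbb T^2=\Phi(\mathbb T^2)\cap\partial_e\mathbb D^2\neq\emptyset$, where $\partial_e\mathbb D^2=\mathbb T^2$ is the distinguished boundary of $\mathbb D^2$; 4) there exist constants $C,\tau>0$ such that $a_{n^2}(C_\Phi)\le C\exp(-\tau n)$ for all $n\ge1$; this implies $\beta_2^+(C_\Phi)<1$.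
   Context: $\mathbb D$ is the open unit disk, $\mathbb T$ the unit circle. $A(\mathbb D)$ (resp. $A(\mathbb D^2)$) is the space of functions holomorphic in $\mathbb D$ (resp. $\mathbb D^2$) and continuous on $\overline{\mathbb D}$ (resp. $\overline{\mathbb D^2}$). $H^2(\mathbb D^2)$ is the Hilbert space of functions $f(z)=\sum_{\alpha\in\mathbb N^2}a_\alpha z^\alpha$ on $\mathbb D^2$ with $\|f\|_2^2=\sum|a_\alpha|^2<\infty$. An analytic map $\Phi\colon\mathbb D^2\to\mathbb D^2$ is non-degenerate if its Jacobian determinant $J_\Phi$ is not identically $0$. Cusp map $\chi$: for $z\in\mathbb D$ put $\chi_0(z)=\dfrac{\left(\frac{z-i}{iz-1}\right)^{1/2}-i}{-i\left(\frac{z-i}{iz-1}\right)^{1/2}+1}$ (principal square root; $z\mapsto\frac{z-i}{iz-1}$ maps $\mathbb D$ onto the upper half-plane), which maps $\mathbb D$ conformally onto $\{z\in\mathbb D:\operatorname{Re}z>0\}$; then $\chi_1=\log\chi_0$ (principal branch), $\chi_2=-\frac2\pi\chi_1+1$, $\chi_3=1/\chi_2$, and $\chi=1-\chi_3$. The map $\chi\colon\mathbb D\to\mathbb D$ is analytic and extends continuously to $\overline{\mathbb D}$ (same notation for the extension), with $\chi(1)=1$. Powers $(1-z)^{-\theta}$ use the principal branch. For an operator $T$ between Hilbert spaces, the approximation numbers are $a_n(T)=\inf\{\|T-R\|:\operatorname{rank}R<n\}$, $n\ge1$, and $\beta_2^+(T)=\limsup_{n\to\infty}[a_{n^2}(T)]^{1/n}$.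 *)

theory Defs
  imports "HOL-Analysis.Analysis"
begin

section \<open>Operators on complex Hilbert spaces\<close>

text \<open>
  The library has no complex vector spaces. A complex Hilbert space is rendered as a complete
  real inner product space with a compatible complex scalar multiplication whose norm is
  homogeneous for complex scalars. The real inner product is then the real part of a
  (unique) complex inner product inducing the same norm.
\<close>

class complex_hilbert_space = real_inner + complete_space +
  fixes scaleC :: "complex \<Rightarrow> 'a \<Rightarrow> 'a"  (infixr \<open>*\<^sub>C\<close> 75)
  assumes scaleC_add_right: "c *\<^sub>C (x + y) = c *\<^sub>C x + c *\<^sub>C y"
    and scaleC_add_left: "(c + d) *\<^sub>C x = c *\<^sub>C x + d *\<^sub>C x"
    and scaleC_scaleC: "c *\<^sub>C (d *\<^sub>C x) = (c * d) *\<^sub>C x"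
    and scaleC_one: "1 *\<^sub>C x = x"
    and scaleR_scaleC: "r *\<^sub>R x = complex_of_real r *\<^sub>C x"
    and norm_scaleC: "norm (c *\<^sub>C x) = cmod c * norm x"

global_interpretation complex_vector:
  vector_space "scaleC :: complex \<Rightarrow> 'a \<Rightarrow> 'a::complex_hilbert_space"
  by unfold_locales (rule scaleC_add_right scaleC_add_left scaleC_scaleC scaleC_one)+

definition bounded_clinear :: "('a::complex_hilbert_space \<Rightarrow> 'b::complex_hilbert_space) \<Rightarrow> bool"
  where "bounded_clinear T \<longleftrightarrow> bounded_linear T \<and> (\<forall>c x. T (c *\<^sub>C x) = c *\<^sub>C T x)"

definition compact_operator :: "('a::complex_hilbert_space \<Rightarrow> 'b::complex_hilbert_space) \<Rightarrow> bool"
  where "compact_operator T \<longleftrightarrow> bounded_clinear T \<and> compact (closure (T ` cball 0 1))"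

text \<open>
  The rank is bounded through a finite spanning set because the library's dimension function
  assigns the value 0 to infinite-dimensional spaces.
\<close>

definition rank_less :: "('a::complex_hilbert_space \<Rightarrow> 'b::complex_hilbert_space) \<Rightarrow> nat \<Rightarrow> bool"
  where "rank_less R n \<longleftrightarrow> (\<exists>B. finite B \<and> card B < n \<and> range R \<subseteq> complex_vector.span B)"

definition approx_number :: "('a::complex_hilbert_space \<Rightarrow> 'b::complex_hilbert_space) \<Rightarrow> nat \<Rightarrow> real"
  where "approx_number T n =
    Inf {onorm (\<lambda>x. T x - R x) | R. bounded_clinear R \<and> rank_less R n}"

definition beta2_plus :: "('a::complex_hilbert_space \<Rightarrow> 'b::complex_hilbert_space) \<Rightarrow> ereal"
  where "beta2_plus T = limsup (\<lambda>n. ereal (root n (approx_number T (n\<^sup>2))))"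


section \<open>Disk and bidisk\<close>

definition disk_algebra :: "(complex \<Rightarrow> complex) set"
  where "disk_algebra = {f. f holomorphic_on ball 0 1 \<and> continuous_on (cball 0 1) f}"

definition bidisk :: "(complex \<times> complex) set"
  where "bidisk = ball 0 1 \<times> ball 0 1"

definition closed_bidisk :: "(complex \<times> complex) set"
  where "closed_bidisk = cball 0 1 \<times> cball 0 1"

definition torus2 :: "(complex \<times> complex) set"
  where "torus2 = sphere 0 1 \<times> sphere 0 1"

definition distinguished_boundary :: "(complex \<times> complex) set"
  where "distinguished_boundary = torus2"

text \<open>Holomorphy in two variables: existence of a complex-linear Frechet derivative.\<close>

definition holomorphic2_on :: "(complex \<times> complex \<Rightarrow> complex) \<Rightarrow> (complex \<times> complex) set \<Rightarrow> bool"
  (infixl \<open>holomorphic2'_on\<close> 50)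
  where "f holomorphic2_on U \<longleftrightarrow>
    (\<forall>z\<in>U. \<exists>a b. (f has_derivative (\<lambda>h. a * fst h + b * snd h)) (at z within U))"

definition bidisk_algebra :: "(complex \<times> complex \<Rightarrow> complex) set"
  where "bidisk_algebra = {f. f holomorphic2_on bidisk \<and> continuous_on closed_bidisk f}"

definition jacobian2 :: "(complex \<times> complex \<Rightarrow> complex \<times> complex) \<Rightarrow> complex \<times> complex \<Rightarrow> complex"
  where "jacobian2 \<Phi> z =
    deriv (\<lambda>w. fst (\<Phi> (w, snd z))) (fst z) * deriv (\<lambda>w. snd (\<Phi> (fst z, w))) (snd z)
  - deriv (\<lambda>w. fst (\<Phi> (fst z, w))) (snd z) * deriv (\<lambda>w. snd (\<Phi> (w, snd z))) (fst z)"

definition nondegenerate :: "(complex \<times> complex \<Rightarrow> complex \<times> complex) \<Rightarrow> bool"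
  where "nondegenerate \<Phi> \<longleftrightarrow>
    (fst \<circ> \<Phi>) holomorphic2_on bidisk \<and> (snd \<circ> \<Phi>) holomorphic2_on bidisk \<and>
    \<Phi> ` bidisk \<subseteq> bidisk \<and> (\<exists>z\<in>bidisk. jacobian2 \<Phi> z \<noteq> 0)"


section \<open>The Hardy space of the bidisk\<close>

definition square_summable :: "(nat \<times> nat \<Rightarrow> complex) \<Rightarrow> bool"
  where "square_summable a \<longleftrightarrow> (\<lambda>\<alpha>. (cmod (a \<alpha>))\<^sup>2) summable_on UNIV"

definition monomial2 :: "nat \<times> nat \<Rightarrow> complex \<times> complex \<Rightarrow> complex"
  where "monomial2 \<alpha> z = fst z ^ fst \<alpha> * snd z ^ snd \<alpha>"

text \<open>
  Functions on the bidisk are represented by total functions vanishing outside of it, so that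
  equality of representatives is equality on the bidisk. For square summable coefficients the
  series converges absolutely at every point of the bidisk (shown below).
\<close>

definition bidisk_series :: "(nat \<times> nat \<Rightarrow> complex) \<Rightarrow> complex \<times> complex \<Rightarrow> complex"
  where "bidisk_series a z = (if z \<in> bidisk then \<Sum>\<^sub>\<infinity>\<alpha>. a \<alpha> * monomial2 \<alpha> z else 0)"

lemma square_summable_0: "square_summable (\<lambda>_. 0)"
  by (simp add: square_summable_def)

typedef hardy2 = "{bidisk_series a | a. square_summable a}"
  morphisms hardy2_fun Abs_hardy2
  using square_summable_0 by blast

definition hardy2_coeff :: "hardy2 \<Rightarrow> nat \<times> nat \<Rightarrow> complex"
  where "hardy2_coeff f = (THE a. square_summable a \<and> hardy2_fun f = bidisk_series a)"

lemma square_summable_mult: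
  assumes "square_summable a" "square_summable b"
  shows "(\<lambda>\<alpha>. a \<alpha> * b \<alpha>) summable_on UNIV"
  using abs_summable_product[of a UNIV b] assms
  by (auto simp: square_summable_def norm_mult power2_eq_square intro: abs_summable_summable)

lemma square_summable_cnj: "square_summable a \<Longrightarrow> square_summable (\<lambda>\<alpha>. cnj (a \<alpha>))"
  by (simp add: square_summable_def)

lemma square_summable_add:
  assumes "square_summable a" "square_summable b"
  shows "square_summable (\<lambda>\<alpha>. a \<alpha> + b \<alpha>)"
proof -
  have "(\<lambda>\<alpha>. 2 * (cmod (a \<alpha>))\<^sup>2 + 2 * (cmod (b \<alpha>))\<^sup>2) summable_on UNIV"
    using assms unfolding square_summable_def
    by (intro summable_on_add summable_on_cmult_right)
  moreover have "(cmod (x + y))\<^sup>2 \<le> 2 * (cmod x)\<^sup>2 + 2 * (cmod y)\<^sup>2" for x y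
  proof -
    have "(cmod (x + y))\<^sup>2 \<le> (cmod x + cmod y)\<^sup>2"
      by (intro power_mono norm_triangle_ineq) auto
    also have "\<dots> \<le> 2 * (cmod x)\<^sup>2 + 2 * (cmod y)\<^sup>2"
      using sum_squares_bound[of "cmod x" "cmod y"] by (simp add: power2_sum)
    finally show ?thesis .
  qed
  ultimately show ?thesis
    unfolding square_summable_def by (rule summable_on_comparison_test) auto
qed

lemma square_summable_cmult: "square_summable a \<Longrightarrow> square_summable (\<lambda>\<alpha>. c * a \<alpha>)"
  unfolding square_summable_def by (simp add: norm_mult power_mult_distrib summable_on_cmult_right)

lemma square_summable_monomial2:
  assumes "z \<in> bidisk"
  shows "square_summable (\<lambda>\<alpha>. monomial2 \<alpha> z)"
proof -
  define r s where "r = (cmod (fst z))\<^sup>2" and "s = (cmod (snd z))\<^sup>2"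
  have r: "0 \<le> r" "r < 1" and s: "0 \<le> s" "s < 1"
    using assms by (auto simp: r_def s_def bidisk_def abs_square_less_1)
  have geo: "((\<lambda>n. c * q ^ n) has_sum c * (1 / (1 - q))) (UNIV :: nat set)"
    if "0 \<le> q" "q < 1" "0 \<le> c" for q c :: real
  proof (rule has_sum_cmult_right, rule norm_summable_imp_has_sum)
    show "summable (\<lambda>n. norm (q ^ n))" using that by (simp add: summable_geometric)
    show "(\<lambda>n. q ^ n) sums (1 / (1 - q))" using that by (simp add: geometric_sums)
  qed
  have "(\<lambda>\<alpha>. r ^ fst \<alpha> * s ^ snd \<alpha>) summable_on Sigma UNIV (\<lambda>_. UNIV)"
  proof (rule summable_on_SigmaI)
    show "((\<lambda>y. r ^ fst (x, y) * s ^ snd (x, y)) has_sum r ^ x * (1 / (1 - s))) UNIV" for x :: nat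
      using geo[of s "r ^ x"] r s by simp
    have "(\<lambda>x. r ^ x) summable_on UNIV"
      using geo[of r 1] r by (auto simp: summable_on_def)
    then show "(\<lambda>x. r ^ x * (1 / (1 - s))) summable_on UNIV"
      by (rule summable_on_cmult_left)
  qed (use r s in auto)
  moreover have "(cmod (monomial2 \<alpha> z))\<^sup>2 = r ^ fst \<alpha> * s ^ snd \<alpha>" for \<alpha>
    by (simp add: monomial2_def r_def s_def norm_mult norm_power power_mult_distrib
        flip: power_mult) (simp add: mult.commute)
  ultimately show ?thesis
    by (simp add: square_summable_def)
qed

lemma bidisk_series_summable:
  "square_summable a \<Longrightarrow> z \<in> bidisk \<Longrightarrow> (\<lambda>\<alpha>. a \<alpha> * monomial2 \<alpha> z) summable_on UNIV"
  by (intro square_summable_mult square_summable_monomial2)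

lemma bidisk_series_add:
  assumes "square_summable a" "square_summable b"
  shows "bidisk_series (\<lambda>\<alpha>. a \<alpha> + b \<alpha>) z = bidisk_series a z + bidisk_series b z"
  using bidisk_series_summable[OF assms(1)] bidisk_series_summable[OF assms(2)]
  by (simp add: bidisk_series_def distrib_right infsum_add)

lemma bidisk_series_cmult: "bidisk_series (\<lambda>\<alpha>. c * a \<alpha>) z = c * bidisk_series a z"
  by (simp add: bidisk_series_def mult.assoc infsum_cmult_right')

lemma powser_zero_imp_coeff_zero:
  fixes a :: "nat \<Rightarrow> complex"
  assumes "\<And>z. z \<in> ball 0 1 \<Longrightarrow> (\<lambda>n. a n * z ^ n) sums 0"
  shows "a n = 0"
proof -
  have "summable (\<lambda>n. a n * (1 / 2) ^ n)"
    using assms[of "1 / 2"] by (simp add: sums_iff)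
  then have "norm (1 / 2 :: complex) \<le> conv_radius a"
    by (rule conv_radius_geI)
  then have "0 < fps_conv_radius (Abs_fps a)"
    unfolding fps_conv_radius_def by (simp add: less_le_trans[OF _ \<open>_ \<le> conv_radius a\<close>])
  moreover have "eventually (\<lambda>z. eval_fps (Abs_fps a) z = eval_fps 0 z) (nhds 0)"
    unfolding eventually_nhds
    by (rule exI[of _ "ball 0 1"])
      (use assms in \<open>auto simp: eval_fps_def sums_iff\<close>)
  ultimately have "Abs_fps a = 0"
    by (intro eval_fps_eqD) auto
  then show ?thesis
    by (metis fps_nth_Abs_fps fps_zero_nth)
qed

lemma bidisk_series_zero_imp:
  assumes a: "square_summable a" and zero: "\<And>z. z \<in> bidisk \<Longrightarrow> bidisk_series a z = 0"
  shows "a = (\<lambda>_. 0)"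
proof -
  have sums: "(\<lambda>(j, k). a (j, k) * z ^ j * w ^ k) summable_on UNIV \<times> UNIV"
    if "z \<in> ball 0 1" "w \<in> ball 0 1" for z w
    using bidisk_series_summable[OF a, of "(z, w)"] that
    by (simp add: bidisk_def monomial2_def case_prod_unfold mult.assoc)
  have row: "(\<lambda>k. a (j, k) * w ^ k) summable_on UNIV" if "w \<in> ball 0 1" for j w
    using summable_on_SigmaD1[OF sums[of "1 / 2" w], of j] that
      summable_on_cmult_right'[of "(1 / 2 :: complex) ^ j" "\<lambda>k. a (j, k) * w ^ k" UNIV]
    by (simp add: mult_ac)
  have inner: "(\<Sum>\<^sub>\<infinity>k. a (j, k) * w ^ k) = 0" if w: "w \<in> ball 0 1" for j w
  proof (rule powser_zero_imp_coeff_zero[where a = "\<lambda>j. \<Sum>\<^sub>\<infinity>k. a (j, k) * w ^ k"])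
    fix z :: complex assume z: "z \<in> ball 0 1"
    have "((\<lambda>(j, k). a (j, k) * z ^ j * w ^ k) has_sum 0) (UNIV \<times> UNIV)"
      using has_sum_infsum[OF sums[OF z w]] zero[of "(z, w)"] z w
      by (simp add: bidisk_series_def bidisk_def monomial2_def case_prod_unfold mult.assoc)
    moreover have "((\<lambda>k. case (j, k) of (j, k) \<Rightarrow> a (j, k) * z ^ j * w ^ k)
        has_sum (\<Sum>\<^sub>\<infinity>k. a (j, k) * w ^ k) * z ^ j) UNIV" for j
      using has_sum_cmult_left[OF has_sum_infsum[OF row[OF w, of j]], of "z ^ j"]
      by (simp add: mult_ac)
    ultimately have "((\<lambda>j. (\<Sum>\<^sub>\<infinity>k. a (j, k) * w ^ k) * z ^ j) has_sum 0) UNIV"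
      by (rule has_sum_SigmaD)
    then show "(\<lambda>j. (\<Sum>\<^sub>\<infinity>k. a (j, k) * w ^ k) * z ^ j) sums 0"
      by (rule has_sum_imp_sums)
  qed
  have "a (j, k) = 0" for j k
  proof (rule powser_zero_imp_coeff_zero[where a = "\<lambda>k. a (j, k)"])
    fix w :: complex assume w: "w \<in> ball 0 1"
    show "(\<lambda>k. a (j, k) * w ^ k) sums 0"
      using has_sum_imp_sums[OF has_sum_infsum[OF row[OF w, of j]]] inner[OF w] by simp
  qed
  then show ?thesis by auto
qed

lemma bidisk_series_inject:
  assumes "square_summable a" "square_summable b" "bidisk_series a = bidisk_series b"
  shows "a = b"
proof -
  have b: "square_summable (\<lambda>\<alpha>. -1 * b \<alpha>)"
    using assms(2) by (rule square_summable_cmult)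
  have "bidisk_series (\<lambda>\<alpha>. a \<alpha> + -1 * b \<alpha>) z = 0" for z
    using assms(3) by (simp only: bidisk_series_add[OF assms(1) b] bidisk_series_cmult) simp
  then have "(\<lambda>\<alpha>. a \<alpha> + -1 * b \<alpha>) = (\<lambda>_. 0)"
    by (intro bidisk_series_zero_imp square_summable_add assms(1) b)
  then show ?thesis
    by (auto simp: fun_eq_iff)
qed

lemma hardy2_coeff_props:
  "square_summable (hardy2_coeff f) \<and> hardy2_fun f = bidisk_series (hardy2_coeff f)"
proof -
  obtain a where "square_summable a \<and> hardy2_fun f = bidisk_series a"
    using hardy2_fun[of f] by auto
  moreover from this have "b = a" if "square_summable b \<and> hardy2_fun f = bidisk_series b" for b
    using that bidisk_series_inject by metis
  ultimately show ?thesis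
    unfolding hardy2_coeff_def by (rule theI)
qed

lemmas square_summable_coeff = hardy2_coeff_props[THEN conjunct1]
  and hardy2_fun_eq = hardy2_coeff_props[THEN conjunct2]

lemma hardy2_fun_Abs: "square_summable a \<Longrightarrow> hardy2_fun (Abs_hardy2 (bidisk_series a)) = bidisk_series a"
  by (rule Abs_hardy2_inverse) auto

lemma hardy2_coeff_Abs: "square_summable a \<Longrightarrow> hardy2_coeff (Abs_hardy2 (bidisk_series a)) = a"
  by (metis bidisk_series_inject hardy2_fun_Abs hardy2_fun_eq square_summable_coeff)

lemma hardy2_eqI: "(\<And>\<alpha>. hardy2_coeff f \<alpha> = hardy2_coeff g \<alpha>) \<Longrightarrow> f = g"
  by (metis ext hardy2_fun_eq hardy2_fun_inject)

instantiation hardy2 :: real_inner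
begin

definition "0 = Abs_hardy2 (\<lambda>_. 0)"
definition "f + g = Abs_hardy2 (\<lambda>z. hardy2_fun f z + hardy2_fun g z)"
definition "- f = Abs_hardy2 (\<lambda>z. - hardy2_fun f z)"
definition "f - g = Abs_hardy2 (\<lambda>z. hardy2_fun f z - hardy2_fun g z)"
definition "r *\<^sub>R f = Abs_hardy2 (\<lambda>z. complex_of_real r * hardy2_fun f z)"
definition "norm f = sqrt (\<Sum>\<^sub>\<infinity>\<alpha>. (cmod (hardy2_coeff f \<alpha>))\<^sup>2)"
definition "inner f g = Re (\<Sum>\<^sub>\<infinity>\<alpha>. hardy2_coeff f \<alpha> * cnj (hardy2_coeff g \<alpha>))"
definition "dist f g = norm (f - g :: hardy2)"
definition "sgn f = scaleR (inverse (norm f)) (f :: hardy2)"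
definition "(uniformity :: (hardy2 \<times> hardy2) filter) =
  (INF e\<in>{0<..}. principal {(f, g). dist f g < e})"
definition "open (U :: hardy2 set) \<longleftrightarrow>
  (\<forall>f\<in>U. eventually (\<lambda>(f', g). f' = f \<longrightarrow> g \<in> U) uniformity)"

lemma coeff_zero: "hardy2_coeff 0 \<alpha> = 0"
proof -
  have "(\<lambda>_. 0) = bidisk_series (\<lambda>_. 0)"
    by (auto simp: bidisk_series_def)
  then show ?thesis
    by (simp add: zero_hardy2_def hardy2_coeff_Abs square_summable_0)
qed

lemma coeff_add: "hardy2_coeff (f + g) \<alpha> = hardy2_coeff f \<alpha> + hardy2_coeff g \<alpha>"
proof -
  have "(\<lambda>z. hardy2_fun f z + hardy2_fun g z)
      = bidisk_series (\<lambda>\<alpha>. hardy2_coeff f \<alpha> + hardy2_coeff g \<alpha>)"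
    by (simp add: fun_eq_iff hardy2_fun_eq bidisk_series_add square_summable_coeff)
  then show ?thesis
    by (simp add: plus_hardy2_def hardy2_coeff_Abs square_summable_add square_summable_coeff)
qed

lemma coeff_Abs_cmult: "hardy2_coeff (Abs_hardy2 (\<lambda>z. c * hardy2_fun f z)) \<alpha> = c * hardy2_coeff f \<alpha>"
proof -
  have "(\<lambda>z. c * hardy2_fun f z) = bidisk_series (\<lambda>\<alpha>. c * hardy2_coeff f \<alpha>)"
    by (simp add: fun_eq_iff hardy2_fun_eq bidisk_series_cmult)
  then show ?thesis
    by (simp add: hardy2_coeff_Abs square_summable_cmult square_summable_coeff)
qed

lemma coeff_scaleR: "hardy2_coeff (r *\<^sub>R f) \<alpha> = complex_of_real r * hardy2_coeff f \<alpha>"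
  by (simp add: scaleR_hardy2_def coeff_Abs_cmult)

lemma coeff_uminus: "hardy2_coeff (- f) \<alpha> = - hardy2_coeff f \<alpha>"
  using coeff_Abs_cmult[of "-1" f \<alpha>] by (simp add: uminus_hardy2_def)

lemma coeff_diff: "hardy2_coeff (f - g) \<alpha> = hardy2_coeff f \<alpha> - hardy2_coeff g \<alpha>"
proof -
  have "f - g = f + (- g)"
  proof -
    have "hardy2_fun (- g) z = - hardy2_fun g z" for z
      using bidisk_series_cmult[of "-1" "hardy2_coeff g" z]
      by (simp add: hardy2_fun_eq coeff_uminus[abs_def])
    then show ?thesis
      by (simp add: minus_hardy2_def plus_hardy2_def)
  qed
  then show ?thesis
    by (simp add: coeff_add coeff_uminus)
qed

lemma coeff_prod_summable:
  "(\<lambda>\<alpha>. hardy2_coeff f \<alpha> * cnj (hardy2_coeff g \<alpha>)) summable_on UNIV"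
  by (intro square_summable_mult square_summable_cnj square_summable_coeff)

lemma inner_self: "inner f f = (\<Sum>\<^sub>\<infinity>\<alpha>. (cmod (hardy2_coeff f \<alpha>))\<^sup>2)" for f :: hardy2
  unfolding inner_hardy2_def infsum_Re[OF coeff_prod_summable, symmetric]
  by (simp flip: complex_norm_square of_real_power)

instance
proof
  fix f g h :: hardy2 and r s :: real
  show "f + g + h = f + (g + h)" "f + g = g + f" "0 + f = f" "- f + f = 0" "f - g = f + - g"
    "r *\<^sub>R (f + g) = r *\<^sub>R f + r *\<^sub>R g" "(r + s) *\<^sub>R f = r *\<^sub>R f + s *\<^sub>R f"
    "r *\<^sub>R s *\<^sub>R f = (r * s) *\<^sub>R f" "1 *\<^sub>R f = f"
    by (rule hardy2_eqI;
        simp add: coeff_zero coeff_add coeff_uminus coeff_diff coeff_scaleR algebra_simps)+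
  show "inner f g = inner g f"
  proof -
    have "(\<Sum>\<^sub>\<infinity>\<alpha>. hardy2_coeff g \<alpha> * cnj (hardy2_coeff f \<alpha>))
        = cnj (\<Sum>\<^sub>\<infinity>\<alpha>. hardy2_coeff f \<alpha> * cnj (hardy2_coeff g \<alpha>))"
      by (simp flip: infsum_cnj add: mult.commute)
    then show ?thesis
      by (simp add: inner_hardy2_def)
  qed
  show "inner (f + g) h = inner f h + inner g h"
    by (simp add: inner_hardy2_def coeff_add distrib_right infsum_add coeff_prod_summable)
  show "inner (r *\<^sub>R f) g = r * inner f g"
    by (simp add: inner_hardy2_def coeff_scaleR mult.assoc infsum_cmult_right')
  show "0 \<le> inner f f"
    by (simp add: inner_self infsum_nonneg)
  show "inner f f = 0 \<longleftrightarrow> f = 0"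
  proof
    assume 0: "inner f f = 0"
    have "(cmod (hardy2_coeff f \<alpha>))\<^sup>2 = 0" for \<alpha>
      by (rule nonneg_infsum_le_0D[where A = UNIV])
        (use 0 square_summable_coeff[of f] in \<open>auto simp: inner_self square_summable_def\<close>)
    then show "f = 0"
      by (intro hardy2_eqI) (simp add: coeff_zero)
  qed (simp add: inner_self coeff_zero)
  show "norm f = sqrt (inner f f)"
    by (simp add: norm_hardy2_def inner_self)
qed (simp_all add: dist_hardy2_def sgn_hardy2_def uniformity_hardy2_def open_hardy2_def)

end

lemma norm_hardy2_square: "(norm f)\<^sup>2 = (\<Sum>\<^sub>\<infinity>\<alpha>. (cmod (hardy2_coeff f \<alpha>))\<^sup>2)"
  by (simp add: norm_hardy2_def infsum_nonneg)

lemma sum_coeff_le_norm: "finite F \<Longrightarrow> (\<Sum>\<alpha>\<in>F. (cmod (hardy2_coeff f \<alpha>))\<^sup>2) \<le> (norm f)\<^sup>2"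
  unfolding norm_hardy2_square using square_summable_coeff[of f]
  by (intro finite_sum_le_infsum) (auto simp: square_summable_def)

lemma coeff_le_norm: "cmod (hardy2_coeff f \<alpha>) \<le> norm f"
  using sum_coeff_le_norm[of "{\<alpha>}" f] by (simp add: power2_le_iff_abs_le)

instance hardy2 :: complete_space
proof
  fix X :: "nat \<Rightarrow> hardy2" assume X: "Cauchy X"
  define l where "l \<alpha> = lim (\<lambda>n. hardy2_coeff (X n) \<alpha>)" for \<alpha>
  have l: "(\<lambda>n. hardy2_coeff (X n) \<alpha>) \<longlonglongrightarrow> l \<alpha>" for \<alpha>
  proof -
    have "Cauchy (\<lambda>n. hardy2_coeff (X n) \<alpha>)"
      unfolding Cauchy_def
      using X coeff_le_norm[of "X _ - X _" \<alpha>]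
      by (smt (verit) Cauchy_def coeff_diff dist_norm)
    then show ?thesis
      unfolding l_def using Cauchy_convergent convergent_LIMSEQ_iff by blast
  qed
  have key: "\<exists>N. \<forall>n\<ge>N. \<forall>F. finite F \<longrightarrow> (\<Sum>\<alpha>\<in>F. (cmod (hardy2_coeff (X n) \<alpha> - l \<alpha>))\<^sup>2) \<le> e\<^sup>2"
    if "e > 0" for e
  proof -
    obtain N where N: "\<And>m n. m \<ge> N \<Longrightarrow> n \<ge> N \<Longrightarrow> dist (X m) (X n) < e"
      using X \<open>e > 0\<close> unfolding Cauchy_def by blast
    have "(\<Sum>\<alpha>\<in>F. (cmod (hardy2_coeff (X n) \<alpha> - l \<alpha>))\<^sup>2) \<le> e\<^sup>2" if "n \<ge> N" "finite F" for n F
    proof (rule tendsto_upperbound)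
      show "(\<lambda>m. \<Sum>\<alpha>\<in>F. (cmod (hardy2_coeff (X n) \<alpha> - hardy2_coeff (X m) \<alpha>))\<^sup>2)
          \<longlonglongrightarrow> (\<Sum>\<alpha>\<in>F. (cmod (hardy2_coeff (X n) \<alpha> - l \<alpha>))\<^sup>2)"
        by (intro tendsto_intros l)
      have "(\<Sum>\<alpha>\<in>F. (cmod (hardy2_coeff (X n) \<alpha> - hardy2_coeff (X m) \<alpha>))\<^sup>2) \<le> e\<^sup>2" if "m \<ge> N" for m
      proof -
        have "(\<Sum>\<alpha>\<in>F. (cmod (hardy2_coeff (X n - X m) \<alpha>))\<^sup>2) \<le> (norm (X n - X m))\<^sup>2"
          by (rule sum_coeff_le_norm) fact
        also have "\<dots> \<le> e\<^sup>2"
          using N[OF \<open>n \<ge> N\<close> \<open>m \<ge> N\<close>] by (intro power_mono) (auto simp: dist_norm)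
        finally show ?thesis
          by (simp add: coeff_diff)
      qed
      then show "\<forall>\<^sub>F m in sequentially.
          (\<Sum>\<alpha>\<in>F. (cmod (hardy2_coeff (X n) \<alpha> - hardy2_coeff (X m) \<alpha>))\<^sup>2) \<le> e\<^sup>2"
        unfolding eventually_sequentially by blast
    qed simp
    then show ?thesis by blast
  qed
  have summ: "square_summable (\<lambda>\<alpha>. hardy2_coeff (X n) \<alpha> - l \<alpha>)"
    if "\<forall>F. finite F \<longrightarrow> (\<Sum>\<alpha>\<in>F. (cmod (hardy2_coeff (X n) \<alpha> - l \<alpha>))\<^sup>2) \<le> e\<^sup>2" for n e
    unfolding square_summable_def
    by (rule nonneg_bdd_above_summable_on) (use that in \<open>auto intro!: bdd_aboveI\<close>)
  obtain N where "\<forall>F. finite F \<longrightarrow> (\<Sum>\<alpha>\<in>F. (cmod (hardy2_coeff (X N) \<alpha> - l \<alpha>))\<^sup>2) \<le> 1\<^sup>2"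
    using key[of 1] by auto
  from square_summable_add[OF square_summable_coeff[of "X N"] square_summable_cmult[OF summ[OF this], of "-1"]]
  have sl: "square_summable l"
    by (simp add: algebra_simps)
  define L where "L = Abs_hardy2 (bidisk_series l)"
  have L: "hardy2_coeff L = l"
    by (simp add: L_def hardy2_coeff_Abs sl)
  have "X \<longlonglongrightarrow> L"
  proof (rule LIMSEQ_I)
    fix e :: real assume "e > 0"
    obtain N where N: "\<And>n F. n \<ge> N \<Longrightarrow> finite F \<Longrightarrow>
        (\<Sum>\<alpha>\<in>F. (cmod (hardy2_coeff (X n) \<alpha> - l \<alpha>))\<^sup>2) \<le> (e / 2)\<^sup>2"
      using key[of "e / 2"] \<open>e > 0\<close> by auto
    have "norm (X n - L) < e" if "n \<ge> N" for n
    proof -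
      have "(norm (X n - L))\<^sup>2 \<le> (e / 2)\<^sup>2"
        unfolding norm_hardy2_square
        by (rule infsum_le_finite_sums)
          (use square_summable_coeff[of "X n - L"] N[OF that] in \<open>auto simp: square_summable_def coeff_diff L\<close>)
      then have "norm (X n - L) \<le> e / 2"
        using \<open>e > 0\<close> by (simp add: power2_le_iff_abs_le)
      with \<open>e > 0\<close> show ?thesis by simp
    qed
    then show "\<exists>N. \<forall>n\<ge>N. norm (X n - L) < e" by blast
  qed
  then show "convergent X"
    by (auto simp: convergent_def)
qed

instantiation hardy2 :: complex_hilbert_space
begin

definition "c *\<^sub>C f = Abs_hardy2 (\<lambda>z. c * hardy2_fun f z)"

lemma coeff_scaleC: "hardy2_coeff (c *\<^sub>C f) \<alpha> = c * hardy2_coeff f \<alpha>"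
  by (simp add: scaleC_hardy2_def coeff_Abs_cmult)

instance
proof
  fix f g :: hardy2 and c d :: complex and r :: real
  show "c *\<^sub>C (f + g) = c *\<^sub>C f + c *\<^sub>C g" "(c + d) *\<^sub>C f = c *\<^sub>C f + d *\<^sub>C f"
    "c *\<^sub>C d *\<^sub>C f = (c * d) *\<^sub>C f" "1 *\<^sub>C f = f" "r *\<^sub>R f = complex_of_real r *\<^sub>C f"
    by (rule hardy2_eqI; simp add: coeff_add coeff_scaleR coeff_scaleC algebra_simps)+
  show "norm (c *\<^sub>C f) = cmod c * norm f"
    by (simp add: norm_hardy2_def coeff_scaleC norm_mult power_mult_distrib infsum_cmult_right'
        real_sqrt_mult)
qed

end

text \<open>
  The value on \<open>f\<close> is meaningful only if \<open>f \<circ> \<Phi>\<close> lies in the Hardy space; it is then the unique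
  element of the Hardy space that coincides with \<open>f \<circ> \<Phi>\<close> on the bidisk.
\<close>

definition composition_operator :: "(complex \<times> complex \<Rightarrow> complex \<times> complex) \<Rightarrow> hardy2 \<Rightarrow> hardy2"
  where "composition_operator \<Phi> f =
    (THE h. \<forall>z\<in>bidisk. hardy2_fun h z = hardy2_fun f (\<Phi> z))"


section \<open>The cusp map\<close>

definition cusp_0 :: "complex \<Rightarrow> complex"
  where "cusp_0 z =
    (csqrt ((z - \<i>) / (\<i> * z - 1)) - \<i>) / (- \<i> * csqrt ((z - \<i>) / (\<i> * z - 1)) + 1)"

definition cusp_1 :: "complex \<Rightarrow> complex"
  where "cusp_1 z = Ln (cusp_0 z)"

definition cusp_2 :: "complex \<Rightarrow> complex"
  where "cusp_2 z = - (2 / of_real pi) * cusp_1 z + 1"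

definition cusp_3 :: "complex \<Rightarrow> complex"
  where "cusp_3 z = 1 / cusp_2 z"

text \<open>On the unit circle the map is the limit from inside the disk; there the defining formula
  need not make sense (at \<open>1\<close> the logarithm, at \<open>-\<i>\<close> the Moebius map is singular).\<close>

definition cusp_map :: "complex \<Rightarrow> complex"
  where "cusp_map z =
    (if z \<in> ball 0 1 then 1 - cusp_3 z else Lim (at z within ball 0 1) (\<lambda>w. 1 - cusp_3 w))"

definition phi :: "real \<Rightarrow> complex \<Rightarrow> complex"
  where "phi \<theta> z = (if z = 1 then 0 else exp (- ((1 - z) powr (- of_real \<theta>))))"

definition cusp_symbol ::
    "real \<Rightarrow> real \<Rightarrow> (complex \<Rightarrow> complex) \<Rightarrow> complex \<times> complex \<Rightarrow> complex \<times> complex"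
  where "cusp_symbol \<theta> c g = (\<lambda>(z\<^sub>1, z\<^sub>2).
    (cusp_map z\<^sub>1, cusp_map z\<^sub>1 + of_real c * phi \<theta> (cusp_map z\<^sub>1) * g z\<^sub>2))"

definition admissible_constant :: "real \<Rightarrow> real \<Rightarrow> bool"
  where "admissible_constant \<theta> c \<longleftrightarrow> 0 < c \<and> c < 1 \<and>
    (\<forall>z\<in>ball 0 1. cmod (cusp_map z) + 2 * c * cmod (phi \<theta> (cusp_map z)) < 1)"

end

theory Submission
  imports Defs "HOL-Complex_Analysis.Complex_Analysis" "HOL-Real_Asymp.Real_Asymp"
begin

text \<open>
  Write \<open>u = \<chi>(z\<^sub>1) = 1 - 1 / \<omega>\<close>, where \<open>\<omega> = \<chi>\<^sub>2(z\<^sub>1)\<close> lies in the half strip \<open>Re \<omega> > 1\<close>, \<open>|Im \<omega>| < 1\<close>, and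
  \<open>x = Re \<omega>\<close>, so that \<open>1 - |u| \<ge> 1 / (4 x)\<close> and \<open>|\<phi>(u)| \<le> exp (- \<kappa> x\<^sup>\<theta>)\<close>. Expanding in the second variable,
  \<open>f \<circ> \<Phi> = \<Sum>\<^sub>k d\<^sub>k(u) (c \<phi>(u))\<^sup>k g(z\<^sub>2)\<^sup>k\<close>, where \<open>d\<^sub>k(u)\<close> is the \<open>k\<close>-th Taylor coefficient of
  \<open>\<zeta> \<mapsto> f(u, u + \<zeta>)\<close> at 0. Point evaluations of \<open>f\<close> grow at most like a multiple of \<open>x\<close>, and \<open>exp ((\<pi>/4) \<omega>)\<close>
  takes values in a sector, so functions dominated by \<open>exp ((\<pi>/8) x)\<close> belong to the Hardy space. Hence
  \<open>C\<^sub>\<Phi>\<close> is bounded.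

  Approximation numbers are at most the norm of the operator on a subspace of finite codimension.
  Take those \<open>f\<close> for which \<open>d\<^sub>k\<close>, \<open>k < n\<close>, vanishes to order \<open>17 n\<close> at the points \<open>1 - 3\<^sup>-\<^sup>j\<close> with \<open>j < J\<^sub>k\<close>.
  The terms with \<open>k \<ge> n\<close> are geometrically small. For \<open>k < n\<close> the Schwarz lemma gives a factor
  \<open>4\<^sup>-\<^sup>n\<close> as long as \<open>x \<le> 3\<^sup>J\<close> with \<open>J = J\<^sub>k\<close>, and for larger \<open>x\<close> the decay of \<open>\<phi>(u)\<^sup>k\<close> suffices if \<open>3\<^sup>J\<close> is of
  order \<open>(n / k)\<^sup>1\<^sup>/\<^sup>\<theta>\<close>. As \<open>J\<^sub>k\<close> may be taken of order \<open>\<surd>(n / k)\<close> and \<open>\<Sum>\<^sub>k \<surd>(n / k) = O(n)\<close>, the number of conditions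
  is \<open>O(n\<^sup>2)\<close>.
\<close>

section \<open>Taylor coefficients on disks\<close>

text \<open>Elements of the Hardy space are known through coefficients only, so norms are bounded
  without boundary values, by harmonic majorants: if |h(z, w)|^2 is at most Re P(z) with P
  holomorphic on the disk, Bessel's inequality in w and then in z bounds the squared norm by Re
  P(0). The majorant may depend on z alone because all estimates are uniform in w. Conditions on the
  diagonal suffice because the second component of the symbol differs from u by at most half of 1 -
  |u|; this is the purpose of the factor 2 in \<open>admissible_constant\<close>. Since |Im omega| <
  1, the piece where Re omega lies between 3^j and 3^(j+1) has bounded hyperbolic size in the
  variable u, so one node per power of 3 is enough. A cutoff of order 1 + log (n / k) would do as
  well; the square root needs only exp y at least y^2 / 2 and gives an elementary sum. The term k =
  0 carries no power of phi. There one uses the gap between the growth x of point evaluations and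
  the growth exp((pi/8) x) that the majorant admits.\<close>

definition taylor_coeff :: "(complex \<Rightarrow> complex) \<Rightarrow> complex \<Rightarrow> nat \<Rightarrow> complex"
  where "taylor_coeff f z n = (deriv ^^ n) f z / fact n"

lemma taylor_coeff_sums:
  assumes "f holomorphic_on ball z r" "w \<in> ball z r"
  shows "(\<lambda>n. taylor_coeff f z n * (w - z) ^ n) sums f w"
  using holomorphic_power_series[OF assms] by (simp add: taylor_coeff_def)

lemma taylor_coeff_add:
  assumes "f holomorphic_on S" "g holomorphic_on S" "open S" "z \<in> S"
  shows "taylor_coeff (\<lambda>w. f w + g w) z n = taylor_coeff f z n + taylor_coeff g z n"
  using higher_deriv_add[OF assms] by (simp add: taylor_coeff_def add_divide_distrib)

lemma taylor_coeff_cmult: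
  assumes "f holomorphic_on S" "open S" "z \<in> S"
  shows "taylor_coeff (\<lambda>w. c * f w) z n = c * taylor_coeff f z n"
  using higher_deriv_cmult[OF assms(1,3,2)] by (simp add: taylor_coeff_def)

lemma taylor_coeff_cong:
  assumes "\<And>w. w \<in> S \<Longrightarrow> f w = g w" "open S" "z \<in> S"
  shows "taylor_coeff f z n = taylor_coeff g z n"
proof -
  have "\<forall>\<^sub>F w in nhds z. f w = g w"
    using assms unfolding eventually_nhds by blast
  then show ?thesis
    by (simp add: taylor_coeff_def higher_deriv_cong_ev)
qed

text \<open>Cauchy's inequality on the circles of radius \<open>q * r\<close>, followed by q tending
  to 1, since nothing is assumed about \<open>f\<close> on the boundary circle.\<close>

lemma norm_taylor_coeff_le:
  assumes hol: "f holomorphic_on ball z r" and r: "0 < r"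
    and le: "\<And>w. w \<in> ball z r \<Longrightarrow> cmod (f w) \<le> M"
  shows "cmod (taylor_coeff f z n) * r ^ n \<le> M"
proof -
  have "cmod (taylor_coeff f z n) * (q * r) ^ n \<le> M" if q: "0 < q" "q < 1" for q
  proof -
    have sub: "cball z (q * r) \<subseteq> ball z r"
      using q r by auto (smt (verit) mult_less_cancel_right2)
    have "cmod ((deriv ^^ n) f z) \<le> fact n * M / (q * r) ^ n"
    proof (rule Cauchy_inequality)
      show "f holomorphic_on ball z (q * r)"
        using hol sub by (meson ball_subset_cball holomorphic_on_subset order_trans)
      show "continuous_on (cball z (q * r)) f"
        using hol sub by (meson holomorphic_on_imp_continuous_on holomorphic_on_subset)
      show "cmod (f x) \<le> M" if "cmod (z - x) = q * r" for x
        using sub that by (intro le subsetD[OF sub]) (simp add: dist_norm)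
    qed (use q r in auto)
    then show ?thesis
      using q r by (simp add: taylor_coeff_def norm_divide field_simps)
  qed
  then have "\<forall>\<^sub>F q in at_left 1. cmod (taylor_coeff f z n) * (q * r) ^ n \<le> M"
    unfolding eventually_at_left_field by (intro exI[of _ 0]) auto
  moreover have "((\<lambda>q. cmod (taylor_coeff f z n) * (q * r) ^ n) \<longlongrightarrow>
      cmod (taylor_coeff f z n) * (1 * r) ^ n) (at_left (1::real))"
    by (intro tendsto_intros)
  ultimately show ?thesis
    using tendsto_upperbound[of "\<lambda>q. cmod (taylor_coeff f z n) * (q * r) ^ n" _ "at_left (1::real)" M] by simp
qed

lemma norm_suminf_geometric_tail:
  fixes a :: "nat \<Rightarrow> complex"
  assumes sums: "a sums s" and vanish: "\<And>n. n < N \<Longrightarrow> a n = 0"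
    and le: "\<And>n. N \<le> n \<Longrightarrow> cmod (a n) \<le> M * t ^ n" and t: "0 \<le> t" "t < 1"
  shows "cmod s \<le> M * t ^ N / (1 - t)"
proof -
  have "(\<lambda>n. a (n + N)) sums s"
    using sums_iff_shift[of a N s] vanish sums by simp
  moreover have geo: "(\<lambda>n. M * t ^ N * t ^ n) sums (M * t ^ N * (1 / (1 - t)))"
    using t by (intro sums_mult geometric_sums) auto
  moreover have "cmod (a (n + N)) \<le> M * t ^ N * t ^ n" for n
    using le[of "n + N"] by (simp add: power_add mult_ac)
  ultimately show ?thesis
    using norm_suminf_le[of "\<lambda>n. a (n + N)" "\<lambda>n. M * t ^ N * t ^ n"] by (simp add: sums_iff)
qed

text \<open>A form of the Schwarz lemma: Cauchy's estimate bounds the n-th Taylor term by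
  \<open>M * t ^ n\<close>, and the first \<open>N\<close> terms are absent. Summing the geometric
  series costs 1 / (1 - t), harmless for fixed \<open>t\<close>, and avoids dividing
  \<open>f\<close> by a power of w - z.\<close>

lemma holomorphic_vanishing_bound:
  assumes hol: "f holomorphic_on ball z r" and r: "0 < r"
    and le: "\<And>w. w \<in> ball z r \<Longrightarrow> cmod (f w) \<le> M"
    and vanish: "\<And>n. n < N \<Longrightarrow> taylor_coeff f z n = 0"
    and w: "cmod (w - z) \<le> t * r" and t: "0 \<le> t" "t < 1"
  shows "cmod (f w) \<le> M * t ^ N / (1 - t)"
proof (rule norm_suminf_geometric_tail[OF _ _ _ t])
  have "t * r < r" using t r by simp
  then have "w \<in> ball z r"
    using w by (simp add: dist_norm norm_minus_commute)
  then show "(\<lambda>n. taylor_coeff f z n * (w - z) ^ n) sums f w"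
    by (rule taylor_coeff_sums[OF hol])
  show "cmod (taylor_coeff f z n * (w - z) ^ n) \<le> M * t ^ n" for n
  proof -
    have "cmod (taylor_coeff f z n * (w - z) ^ n) \<le> cmod (taylor_coeff f z n) * (t * r) ^ n"
      unfolding norm_mult norm_power by (intro mult_left_mono power_mono w) auto
    also have "\<dots> \<le> M * t ^ n"
      using mult_right_mono[OF norm_taylor_coeff_le[OF hol r le, of n], of "t ^ n"] t
      by (simp add: power_mult_distrib mult_ac)
    finally show ?thesis .
  qed
qed (use vanish in auto)

text \<open>The \<open>k\<close>-th coefficient is the limit, as \<open>\<zeta>\<close> tends to 0, of the difference between \<open>F\<close> and
  its Taylor polynomial of degree less than \<open>k\<close>, divided by \<open>\<zeta> ^ k\<close>; this avoids integrals
  depending on a parameter.\<close>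

lemma holomorphic_taylor_coeff_param:
  assumes U: "open U" and R: "0 < R"
    and hol2: "\<And>u. u \<in> U \<Longrightarrow> F u holomorphic_on ball 0 R"
    and hol1: "\<And>v. v \<in> ball 0 R \<Longrightarrow> (\<lambda>u. F u v) holomorphic_on U"
    and le: "\<And>u v. u \<in> U \<Longrightarrow> v \<in> ball 0 R \<Longrightarrow> cmod (F u v) \<le> M"
  shows "(\<lambda>u. taylor_coeff (F u) 0 k) holomorphic_on U"
proof (induction k rule: less_induct)
  case (less k)
  \<comment> \<open>The summand 2 keeps the ratio t = |\<zeta> n| / R at most 1/2, so that the tail
    factor 1 / (1 - t) is at most 2.\<close>
  define \<zeta> where "\<zeta> n = complex_of_real (R / (real n + 2))" for n :: nat
  define G where "G n u = (F u (\<zeta> n) - (\<Sum>i<k. taylor_coeff (F u) 0 i * \<zeta> n ^ i)) / \<zeta> n ^ k" for n u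
  have \<zeta>: "\<zeta> n \<in> ball 0 R" "\<zeta> n \<noteq> 0" "cmod (\<zeta> n) = R / (real n + 2)" for n
  proof -
    show n: "cmod (\<zeta> n) = R / (real n + 2)"
      using R by (simp add: \<zeta>_def norm_divide del: of_real_divide of_real_add)
    have "R < R * (real n + 2)" using R by simp
    then show "\<zeta> n \<in> ball 0 R" using R by (simp add: n field_simps)
    show "\<zeta> n \<noteq> 0" using R n by force
  qed
  have Ghol: "G n holomorphic_on U" for n
    unfolding G_def by (intro holomorphic_intros less hol1 \<zeta>) (use \<zeta> in auto)
  have err: "cmod (G n u - taylor_coeff (F u) 0 k) \<le> 2 * M / R ^ k / (real n + 2)" if u: "u \<in> U" for n u
  proof -
    define t where "t = 1 / (real n + 2)"
    have t: "0 \<le> t" "t < 1" "1 / (1 - t) \<le> 2" "cmod (\<zeta> n) = t * R"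
      by (auto simp: t_def \<zeta> field_simps)
    let ?a = "\<lambda>i. taylor_coeff (F u) 0 i * \<zeta> n ^ i"
    have M: "0 \<le> M" using le[OF u, of 0] R order_trans[OF norm_ge_zero] by auto
    have sums: "?a sums F u (\<zeta> n)"
      using taylor_coeff_sums[OF hol2[OF u] \<zeta>(1)[of n]] by simp
    have "cmod (F u (\<zeta> n) - (\<Sum>i<Suc k. ?a i)) \<le> M * t ^ Suc k / (1 - t)"
    proof (rule norm_suminf_geometric_tail[OF _ _ _ t(1,2)])
      show "(\<lambda>i. if i < Suc k then 0 else ?a i) sums (F u (\<zeta> n) - (\<Sum>i<Suc k. ?a i))"
      proof -
        have "(\<lambda>i. if i \<in> {..<Suc k} then ?a i else 0) sums (\<Sum>i<Suc k. ?a i)"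
          by (rule sums_If_finite_set) simp
        from sums_diff[OF sums this] show ?thesis
          by (rule sums_cong[THEN iffD1, rotated]) (simp only: lessThan_iff if_distrib[of "\<lambda>x. _ - x"] diff_self diff_zero)
      qed
      show "cmod (if i < Suc k then 0 else ?a i) \<le> M * t ^ i" for i
        using norm_taylor_coeff_le[OF hol2[OF u] R le[OF u], of i] t M
          mult_right_mono[OF norm_taylor_coeff_le[OF hol2[OF u] R le[OF u], of i], of "t ^ i"]
        by (auto simp: norm_mult norm_power power_mult_distrib mult_ac)
    qed auto
    also have "\<dots> = (M * t ^ Suc k) * (1 / (1 - t))" by simp
    also have "\<dots> \<le> (M * t ^ Suc k) * 2"
      using t M by (intro mult_left_mono) auto
    finally have "cmod ((F u (\<zeta> n) - (\<Sum>i<Suc k. ?a i)) / \<zeta> n ^ k) \<le> M * t ^ Suc k * 2 / (t * R) ^ k"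
      unfolding norm_divide norm_power t(4) using t R by (intro divide_right_mono) auto
    moreover have "(F u (\<zeta> n) - (\<Sum>i<Suc k. ?a i)) / \<zeta> n ^ k = G n u - taylor_coeff (F u) 0 k"
      using \<zeta>(2)[of n] by (simp add: G_def field_simps)
    moreover have "M * t ^ Suc k * 2 / (t * R) ^ k = 2 * M / R ^ k / (real n + 2)"
    proof -
      have "0 < t" by (simp add: t_def)
      then have "M * t ^ Suc k * 2 / (t * R) ^ k = 2 * M / R ^ k * t"
        using R by (simp add: power_mult_distrib)
      then show ?thesis by (simp add: t_def)
    qed
    ultimately show ?thesis by simp
  qed
  show ?case
  proof (rule holomorphic_uniform_sequence[OF U Ghol])
    fix x assume "x \<in> U"
    then obtain d where d: "0 < d" "cball x d \<subseteq> U"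
      using U open_contains_cball by blast
    moreover have "uniform_limit (cball x d) G (\<lambda>u. taylor_coeff (F u) 0 k) sequentially"
    proof (rule uniform_limitI)
      fix e :: real assume e: "0 < e"
      have "(\<lambda>n. 2 * M / R ^ k / (real n + 2)) \<longlonglongrightarrow> 0"
        by (intro real_tendsto_divide_at_top[OF tendsto_const]
            filterlim_tendsto_add_at_top[OF tendsto_const filterlim_real_sequentially, of 2, simplified add.commute])
      then have "\<forall>\<^sub>F n in sequentially. 2 * M / R ^ k / (real n + 2) < e"
        using e by (rule order_tendstoD)
      then show "\<forall>\<^sub>F n in sequentially. \<forall>u\<in>cball x d. dist (G n u) (taylor_coeff (F u) 0 k) < e"
      proof (rule eventually_mono, intro ballI)
        fix n u assume "2 * M / R ^ k / (real n + 2) < e" "u \<in> cball x d"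
        then show "dist (G n u) (taylor_coeff (F u) 0 k) < e"
          using err[of u n] d by (auto simp: dist_norm)
      qed
    qed
    ultimately show "\<exists>d>0. cball x d \<subseteq> U \<and>
        uniform_limit (cball x d) G (\<lambda>u. taylor_coeff (F u) 0 k) sequentially"
      by blast
  qed
qed

text \<open>On the circle |z| = r one has cnj z ^ n = r^(2 n) / z^n, and the parametrisation has
  derivative 2 pi i z. The integral is therefore Cauchy's formula for the n-th derivative up to a
  constant factor.\<close>

lemma has_integral_circle_coeff:
  assumes hol: "f holomorphic_on ball 0 1" and r: "0 < r" "r < 1"
  shows "((\<lambda>t. f (circlepath 0 r t) * cnj (circlepath 0 r t) ^ n) has_integral
    taylor_coeff f 0 n * of_real r ^ (2 * n)) {0..1}"
proof -
  let ?\<gamma> = "circlepath 0 r"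
  have "((\<lambda>u. f u / (u - 0) ^ Suc n) has_contour_integral
      (2 * pi * \<i>) / fact n * (deriv ^^ n) f 0) ?\<gamma>"
    by (rule Cauchy_has_contour_integral_higher_derivative_circlepath)
      (use r in \<open>auto intro!: holomorphic_on_imp_continuous_on holomorphic_on_subset[OF hol]\<close>)
  then have "((\<lambda>t. f (?\<gamma> t) / ?\<gamma> t ^ Suc n * vector_derivative ?\<gamma> (at t)) has_integral
      (2 * pi * \<i>) / fact n * (deriv ^^ n) f 0) {0..1}"
    by (simp add: has_contour_integral)
  then have "((\<lambda>t. (f (?\<gamma> t) / ?\<gamma> t ^ Suc n * vector_derivative ?\<gamma> (at t)) * (of_real r ^ (2 * n) / (2 * pi * \<i>)))
      has_integral (2 * pi * \<i>) / fact n * (deriv ^^ n) f 0 * (of_real r ^ (2 * n) / (2 * pi * \<i>))) {0..1}"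
    by (rule has_integral_mult_left)
  moreover have "(f (?\<gamma> t) / ?\<gamma> t ^ Suc n * vector_derivative ?\<gamma> (at t)) * (of_real r ^ (2 * n) / (2 * pi * \<i>))
      = f (?\<gamma> t) * cnj (?\<gamma> t) ^ n" for t
  proof -
    have vd: "vector_derivative ?\<gamma> (at t) = 2 * pi * \<i> * ?\<gamma> t"
      unfolding vector_derivative_circlepath by (simp add: circlepath)
    have nz: "?\<gamma> t \<noteq> 0" using r by (simp add: circlepath)
    have "?\<gamma> t * cnj (?\<gamma> t) = of_real r ^ 2"
      using r by (simp add: complex_norm_square[symmetric] circlepath norm_mult del: complex_cnj_mult)
    then have "of_real r ^ (2 * n) = ?\<gamma> t ^ n * cnj (?\<gamma> t) ^ n"
      by (simp add: power_mult flip: power_mult_distrib)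
    then show ?thesis
      unfolding vd using nz by (simp add: field_simps)
  qed
  ultimately show ?thesis
    by (simp add: taylor_coeff_def mult_ac)
qed

lemma taylor_coeff_power_0: "taylor_coeff (\<lambda>w. w ^ m) 0 n = (if m = n then 1 else 0)"
proof -
  have "(deriv ^^ n) (\<lambda>w::complex. (w - 0) ^ m) 0 = pochhammer (of_nat (Suc m - n)) n * (0 - 0) ^ (m - n)"
    by (rule higher_deriv_power)
  then have "(deriv ^^ n) (\<lambda>w::complex. w ^ m) 0 = pochhammer (of_nat (Suc m - n)) n * 0 ^ (m - n)"
    by simp
  then show ?thesis
    by (cases m n rule: linorder_cases) (auto simp: taylor_coeff_def pochhammer_fact[symmetric] Suc_diff_le zero_power pochhammer_0_left)
qed

text \<open>With \<open>S\<close> a Taylor polynomial of \<open>b\<close>, only the real part of \<open>(2 * b - S) * cnj S\<close>, which equals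
  \<open>|b|\<^sup>2 - |b - S|\<^sup>2\<close>, is integrated over circles, so every integral is a Cauchy integral.\<close>

lemma bessel_disk:
  fixes b :: "'k \<Rightarrow> complex \<Rightarrow> complex"
  assumes b: "\<And>k. k \<in> K \<Longrightarrow> b k holomorphic_on ball 0 1"
    and P: "P holomorphic_on ball 0 1" and K: "finite K"
    and le: "\<And>z. z \<in> ball 0 1 \<Longrightarrow> (\<Sum>k\<in>K. (cmod (b k z))\<^sup>2) \<le> Re (P z)"
  shows "(\<Sum>k\<in>K. \<Sum>n<N. (cmod (taylor_coeff (b k) 0 n))\<^sup>2) \<le> Re (P 0)"
proof -
  have main: "(\<Sum>k\<in>K. \<Sum>n<N. (cmod (taylor_coeff (b k) 0 n))\<^sup>2 * r ^ (2 * n)) \<le> Re (P 0)"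
    if r: "0 < r" "r < 1" for r
  proof -
    let ?\<gamma> = "circlepath 0 r"
    define c where "c k n = taylor_coeff (b k) 0 n" for k n
    define S where "S k z = (\<Sum>n<N. c k n * z ^ n)" for k and z :: complex
    define T where "T k t = (\<Sum>n<N. cnj (c k n) * ((2 * b k (?\<gamma> t) - S k (?\<gamma> t)) * cnj (?\<gamma> t) ^ n))" for k t
    \<comment> \<open>The factor \<open>cnj z ^ 0\<close> brings \<open>P\<close> under the same
      integral formula; its contribution is \<open>P 0\<close>.\<close>
    have int: "((\<lambda>t. P (?\<gamma> t) * cnj (?\<gamma> t) ^ 0 - (\<Sum>k\<in>K. T k t)) has_integral
      taylor_coeff P 0 0 * of_real r ^ (2 * 0)
        - (\<Sum>k\<in>K. \<Sum>n<N. cnj (c k n) * ((2 * c k n - (\<Sum>m<N. c k m * (if m = n then 1 else 0))) * of_real r ^ (2 * n)))) {0..1}"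
      unfolding T_def
    proof (intro has_integral_diff has_integral_circle_coeff P r has_integral_sum K finite_lessThan has_integral_mult_right)
      fix k n assume "k \<in> K" "n \<in> {..<N}"
      have "((\<lambda>t. 2 * (b k (?\<gamma> t) * cnj (?\<gamma> t) ^ n) - (\<Sum>m<N. c k m * ((?\<gamma> t) ^ m * cnj (?\<gamma> t) ^ n))) has_integral
         2 * (c k n * of_real r ^ (2 * n)) - (\<Sum>m<N. c k m * (taylor_coeff (\<lambda>z. z ^ m) 0 n * of_real r ^ (2 * n)))) {0..1}"
        unfolding c_def
        by (intro has_integral_diff has_integral_sum finite_lessThan has_integral_mult_right
            has_integral_circle_coeff b r \<open>k \<in> K\<close> holomorphic_intros)
      then show "((\<lambda>t. (2 * b k (?\<gamma> t) - S k (?\<gamma> t)) * cnj (?\<gamma> t) ^ n) has_integral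
         (2 * c k n - (\<Sum>m<N. c k m * (if m = n then 1 else 0))) * of_real r ^ (2 * n)) {0..1}"
        by (simp add: taylor_coeff_power_0 S_def algebra_simps sum_distrib_left sum_distrib_right)
    qed
    have nonneg: "0 \<le> Re (P (?\<gamma> t) * cnj (?\<gamma> t) ^ 0 - (\<Sum>k\<in>K. T k t))" for t
    proof -
      have "Re (T k t) \<le> (cmod (b k (?\<gamma> t)))\<^sup>2" for k
      proof -
        have "T k t = (2 * b k (?\<gamma> t) - S k (?\<gamma> t)) * cnj (S k (?\<gamma> t))"
          unfolding T_def S_def[of k "?\<gamma> t", THEN arg_cong[where f = cnj]]
            by (simp add: sum_distrib_left sum_distrib_right mult_ac)
        moreover have "(cmod x)\<^sup>2 - Re ((2 * x - y) * cnj y) = (cmod (x - y))\<^sup>2" for x y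
          by (simp add: cmod_power2) (simp add: algebra_simps power2_eq_square)
        ultimately have "(cmod (b k (?\<gamma> t)))\<^sup>2 - Re (T k t) = (cmod (b k (?\<gamma> t) - S k (?\<gamma> t)))\<^sup>2"
          by metis
        then show ?thesis
          by (smt (verit) zero_le_power2)
      qed
      then have "(\<Sum>k\<in>K. Re (T k t)) \<le> (\<Sum>k\<in>K. (cmod (b k (?\<gamma> t)))\<^sup>2)"
        by (intro sum_mono)
      also have "\<dots> \<le> Re (P (?\<gamma> t))"
        using r by (intro le) (simp add: circlepath norm_mult)
      finally show ?thesis by simp
    qed
    \<comment> \<open>For n < N the sum over m picks out \<open>c k n\<close>, so the bracket is
      \<open>2 * c k n - c k n\<close> and each term becomes |c k n|^2 r^(2 n).\<close>
    have eq: "(\<Sum>k\<in>K. \<Sum>n<N. cnj (c k n) * ((2 * c k n - (\<Sum>m<N. c k m * (if m = n then 1 else 0))) * of_real r ^ (2 * n)))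
        = (\<Sum>k\<in>K. \<Sum>n<N. of_real ((cmod (c k n))\<^sup>2 * r ^ (2 * n)))"
    proof (intro sum.cong refl)
      fix k n assume "n \<in> {..<N}"
      then have "(\<Sum>m<N. c k m * (if m = n then 1 else 0)) = c k n"
        by (simp add: if_distrib cong: if_cong)
      then show "cnj (c k n) * ((2 * c k n - (\<Sum>m<N. c k m * (if m = n then 1 else 0))) * of_real r ^ (2 * n))
          = of_real ((cmod (c k n))\<^sup>2 * r ^ (2 * n))"
        by (simp add: complex_norm_square mult_ac del: of_real_power)
          (simp add: complex_norm_square mult_ac)
    qed
    have "0 \<le> Re (taylor_coeff P 0 0 * of_real r ^ (2 * 0)
        - (\<Sum>k\<in>K. \<Sum>n<N. of_real ((cmod (c k n))\<^sup>2 * r ^ (2 * n))))"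
      by (rule has_integral_nonneg[OF has_integral_Re[OF int[unfolded eq]] nonneg])
    then show ?thesis
      by (simp add: taylor_coeff_def[of P] c_def)
  qed
  have "\<forall>\<^sub>F r in at_left 1. (\<Sum>k\<in>K. \<Sum>n<N. (cmod (taylor_coeff (b k) 0 n))\<^sup>2 * r ^ (2 * n)) \<le> Re (P 0)"
    unfolding eventually_at_left_field using main by (intro exI[of _ 0]) auto
  moreover have "((\<lambda>r. \<Sum>k\<in>K. \<Sum>n<N. (cmod (taylor_coeff (b k) 0 n))\<^sup>2 * r ^ (2 * n)) \<longlongrightarrow>
      (\<Sum>k\<in>K. \<Sum>n<N. (cmod (taylor_coeff (b k) 0 n))\<^sup>2 * 1 ^ (2 * n))) (at_left (1::real))"
    by (intro tendsto_intros)
  ultimately show ?thesis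
    using tendsto_upperbound[of "\<lambda>r. \<Sum>k\<in>K. \<Sum>n<N. (cmod (taylor_coeff (b k) 0 n))\<^sup>2 * r ^ (2 * n)" _ "at_left (1::real)" "Re (P 0)"]
    by simp
qed

section \<open>Finite rank approximation on the Hardy space\<close>

definition hardy2_of :: "(nat \<times> nat \<Rightarrow> complex) \<Rightarrow> hardy2"
  where "hardy2_of a = Abs_hardy2 (bidisk_series a)"

lemma coeff_hardy2_of: "square_summable a \<Longrightarrow> hardy2_coeff (hardy2_of a) = a"
  by (simp add: hardy2_of_def hardy2_coeff_Abs)

lemma fun_hardy2_of: "square_summable a \<Longrightarrow> hardy2_fun (hardy2_of a) = bidisk_series a"
  by (simp add: hardy2_of_def hardy2_fun_Abs)

lemma has_sum_norm_hardy2: "((\<lambda>\<alpha>. (cmod (hardy2_coeff f \<alpha>))\<^sup>2) has_sum (norm f)\<^sup>2) UNIV"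
  unfolding norm_hardy2_square using square_summable_coeff[of f]
  by (intro has_sum_infsum) (simp add: square_summable_def)

lemma square_summableI:
  assumes "\<And>F. finite F \<Longrightarrow> (\<Sum>\<alpha>\<in>F. (cmod (a \<alpha>))\<^sup>2) \<le> M"
  shows "square_summable a"
  unfolding square_summable_def
  by (rule nonneg_bdd_above_summable_on) (use assms in \<open>auto intro!: bdd_aboveI\<close>)

lemma square_summable_finite_support:
  "finite F \<Longrightarrow> square_summable (\<lambda>\<alpha>. if \<alpha> \<in> F then a \<alpha> else 0)"
  unfolding square_summable_def
  by (rule summable_on_cong_neutral[THEN iffD1, OF _ _ _ summable_on_finite[of F "\<lambda>\<alpha>. (cmod (a \<alpha>))\<^sup>2"]]) auto

text \<open>\<open>inner\<close> is only the real part of this form. The complex form, linear in its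
  first argument, is needed for projections that commute with complex scalars.\<close>

definition hardy2_cinner :: "hardy2 \<Rightarrow> hardy2 \<Rightarrow> complex"
  where "hardy2_cinner f g = (\<Sum>\<^sub>\<infinity>\<alpha>. hardy2_coeff f \<alpha> * cnj (hardy2_coeff g \<alpha>))"

lemma Re_hardy2_cinner: "Re (hardy2_cinner f g) = inner f g"
  by (simp add: hardy2_cinner_def inner_hardy2_def)

lemma hardy2_cinner_add_left: "hardy2_cinner (f + g) h = hardy2_cinner f h + hardy2_cinner g h"
  by (simp add: hardy2_cinner_def coeff_add distrib_right infsum_add coeff_prod_summable)

lemma hardy2_cinner_scaleC_left: "hardy2_cinner (c *\<^sub>C f) h = c * hardy2_cinner f h"
  by (simp add: hardy2_cinner_def coeff_scaleC mult.assoc infsum_cmult_right')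

lemma hardy2_cinner_commute: "hardy2_cinner g f = cnj (hardy2_cinner f g)"
  by (simp add: hardy2_cinner_def mult.commute flip: infsum_cnj)

lemma scaleC_minus1: "(-1) *\<^sub>C f = - (f :: hardy2)"
  by (rule hardy2_eqI) (simp add: coeff_scaleC coeff_uminus)

lemma hardy2_cinner_diff_left: "hardy2_cinner (f - g) h = hardy2_cinner f h - hardy2_cinner g h"
  using hardy2_cinner_add_left[of f "(-1) *\<^sub>C g" h] hardy2_cinner_scaleC_left[of "-1" g h]
  by (simp add: scaleC_minus1)

lemma hardy2_cinner_zero_left: "hardy2_cinner 0 h = 0"
  using hardy2_cinner_diff_left[of 0 0 h] by simp

lemma hardy2_cinner_sum_left: "hardy2_cinner (\<Sum>q\<in>Q. f q) h = (\<Sum>q\<in>Q. hardy2_cinner (f q) h)"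
  by (induction Q rule: infinite_finite_induct)
    (auto simp: hardy2_cinner_zero_left hardy2_cinner_add_left)

lemma hardy2_cinner_scaleC_right: "hardy2_cinner f (c *\<^sub>C h) = cnj c * hardy2_cinner f h"
  by (subst (1 2) hardy2_cinner_commute) (simp add: hardy2_cinner_scaleC_left)

lemma hardy2_cinner_sum_right: "hardy2_cinner f (\<Sum>q\<in>Q. h q) = (\<Sum>q\<in>Q. hardy2_cinner f (h q))"
  by (subst (1 2) hardy2_cinner_commute) (simp add: hardy2_cinner_sum_left)

lemma hardy2_cinner_self: "hardy2_cinner f f = of_real ((norm f)\<^sup>2)"
proof -
  have "((\<lambda>\<alpha>. complex_of_real ((cmod (hardy2_coeff f \<alpha>))\<^sup>2)) has_sum of_real ((norm f)\<^sup>2)) UNIV"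
    by (intro has_sum_of_real has_sum_norm_hardy2)
  then show ?thesis
    by (simp only: hardy2_cinner_def complex_norm_square[symmetric] infsumI of_real_power)
qed

text \<open>Rotating \<open>f\<close> by a unimodular constant makes the complex product real and
  nonnegative, where it coincides with \<open>inner\<close>; then the real Cauchy-Schwarz inequality
  applies.\<close>

lemma norm_hardy2_cinner_le: "cmod (hardy2_cinner f g) \<le> norm f * norm g"
proof (cases "hardy2_cinner f g = 0")
  case False
  define c where "c = cnj (sgn (hardy2_cinner f g))"
  have c: "cmod c = 1" using False by (simp add: c_def norm_sgn)
  have "of_real (cmod (hardy2_cinner f g)) = hardy2_cinner (c *\<^sub>C f) g"
    using False by (simp add: hardy2_cinner_scaleC_left c_def sgn_div_norm scaleR_conv_of_real
        complex_norm_square[symmetric] field_simps) (simp add: complex_norm_square power2_eq_square)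
  then have "cmod (hardy2_cinner f g) = inner (c *\<^sub>C f) g"
    by (metis Re_complex_of_real Re_hardy2_cinner)
  also have "\<dots> \<le> norm (c *\<^sub>C f) * norm g"
    by (rule norm_cauchy_schwarz)
  finally show ?thesis by (simp add: norm_scaleC c)
qed simp

definition hardy2_truncate :: "(nat \<times> nat) set \<Rightarrow> hardy2 \<Rightarrow> hardy2"
  where "hardy2_truncate F f = hardy2_of (\<lambda>\<alpha>. if \<alpha> \<in> F then hardy2_coeff f \<alpha> else 0)"

lemma coeff_hardy2_truncate:
  "finite F \<Longrightarrow> hardy2_coeff (hardy2_truncate F f) \<alpha> = (if \<alpha> \<in> F then hardy2_coeff f \<alpha> else 0)"
  by (simp add: hardy2_truncate_def coeff_hardy2_of square_summable_finite_support)

lemma fun_hardy2_truncate: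
  assumes "finite F" "z \<in> bidisk"
  shows "hardy2_fun (hardy2_truncate F f) z = (\<Sum>\<alpha>\<in>F. hardy2_coeff f \<alpha> * monomial2 \<alpha> z)"
proof -
  have "((\<lambda>\<alpha>. (if \<alpha> \<in> F then hardy2_coeff f \<alpha> else 0) * monomial2 \<alpha> z) has_sum
      (\<Sum>\<alpha>\<in>F. hardy2_coeff f \<alpha> * monomial2 \<alpha> z)) UNIV"
    by (rule has_sum_finite_neutralI[OF assms(1)]) auto
  then show ?thesis
    using assms by (simp add: hardy2_truncate_def fun_hardy2_of square_summable_finite_support
        bidisk_series_def infsumI)
qed

text \<open>By Pythagoras the squared error is the squared norm minus a partial sum of the squared
  coefficients.\<close>

lemma tendsto_norm_hardy2_truncate:
  "((\<lambda>F. norm (f - hardy2_truncate F f)) \<longlongrightarrow> 0) (finite_subsets_at_top UNIV)"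
proof -
  let ?a = "\<lambda>\<alpha>. (cmod (hardy2_coeff f \<alpha>))\<^sup>2"
  have "((\<lambda>F. (norm f)\<^sup>2 - sum ?a F) \<longlongrightarrow> (norm f)\<^sup>2 - (norm f)\<^sup>2) (finite_subsets_at_top UNIV)"
    using has_sum_norm_hardy2[of f] unfolding has_sum_def by (intro tendsto_intros)
  then have "((\<lambda>F. sqrt ((norm f)\<^sup>2 - sum ?a F)) \<longlongrightarrow> 0) (finite_subsets_at_top UNIV)"
    using tendsto_real_sqrt by fastforce
  moreover have "sqrt ((norm f)\<^sup>2 - sum ?a F) = norm (f - hardy2_truncate F f)" if F: "finite F" for F
  proof -
    have "((\<lambda>\<alpha>. (cmod (hardy2_coeff (f - hardy2_truncate F f) \<alpha>))\<^sup>2) has_sum ((norm f)\<^sup>2 - sum ?a F)) UNIV"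
    proof -
      have "((\<lambda>\<alpha>. if \<alpha> \<in> F then ?a \<alpha> else 0) has_sum sum ?a F) UNIV"
        by (rule has_sum_finite_neutralI[OF F]) auto
      from has_sum_add[OF has_sum_norm_hardy2[of f] has_sum_uminusI[OF this], unfolded add_uminus_conv_diff] show ?thesis
        by (rule has_sum_cong[THEN iffD1, rotated]) (auto simp: coeff_diff coeff_hardy2_truncate F)
    qed
    then have "(norm f)\<^sup>2 - sum ?a F = (norm (f - hardy2_truncate F f))\<^sup>2"
      using has_sum_norm_hardy2 has_sum_unique by blast
    then show ?thesis by simp
  qed
  ultimately show ?thesis
    by (rule Lim_transform_eventually[OF _ eventually_finite_subsets_at_top_weakI])
qed

section \<open>Riesz representation and orthogonal projections\<close>

definition bounded_functional :: "(hardy2 \<Rightarrow> complex) \<Rightarrow> bool"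
  where "bounded_functional l \<longleftrightarrow> (\<forall>f g. l (f + g) = l f + l g) \<and> (\<forall>c f. l (c *\<^sub>C f) = c * l f) \<and>
    (\<exists>C. \<forall>f. cmod (l f) \<le> C * norm f)"

text \<open>The coefficients of the representing vector are the conjugated values of
  \<open>l\<close> on the monomials. The formula holds on truncations by linearity and passes to all
  \<open>f\<close> by density and boundedness.\<close>

lemma hardy2_riesz:
  assumes "bounded_functional l"
  obtains e where "\<And>f. l f = hardy2_cinner f e"
proof -
  have add: "l (f + g) = l f + l g" and scale: "l (c *\<^sub>C f) = c * l f" for f g c
    using assms by (auto simp: bounded_functional_def)
  obtain C where C: "\<And>f. cmod (l f) \<le> C * norm f"
    using assms by (auto simp: bounded_functional_def)
  have zero: "l 0 = 0"
    using add[of 0 0] by simp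
  define b where "b \<beta> = hardy2_of (\<lambda>\<alpha>. if \<alpha> \<in> {\<beta>} then 1 else 0)" for \<beta>
  have coeff_b: "hardy2_coeff (b \<beta>) \<alpha> = (if \<alpha> = \<beta> then 1 else 0)" for \<alpha> \<beta>
    using coeff_hardy2_of[OF square_summable_finite_support[of "{\<beta>}" "\<lambda>_. 1"]]
    by (simp add: b_def)
  define a where "a \<alpha> = cnj (l (b \<alpha>))" for \<alpha>
  have trunc: "l (hardy2_truncate F f) = (\<Sum>\<alpha>\<in>F. hardy2_coeff f \<alpha> * l (b \<alpha>))" if "finite F" for F f
    using that
  proof (induction F)
    case empty
    have "hardy2_truncate {} f = 0"
      by (rule hardy2_eqI) (simp add: coeff_hardy2_truncate coeff_zero)
    then show ?case by (simp add: zero)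
  next
    case (insert \<beta> F)
    have "hardy2_truncate (insert \<beta> F) f = hardy2_coeff f \<beta> *\<^sub>C b \<beta> + hardy2_truncate F f"
      using insert by (intro hardy2_eqI) (auto simp: coeff_hardy2_truncate coeff_add coeff_scaleC coeff_b)
    then show ?case
      using insert by (simp add: add scale)
  qed
  have a: "square_summable a"
  proof (rule square_summableI[of _ "C\<^sup>2"])
    fix F :: "(nat \<times> nat) set" assume F: "finite F"
    \<comment> \<open>Test vector for square summability: \<open>l g\<close> is the squared norm of
      \<open>g\<close>, so boundedness of \<open>l\<close> gives norm at most \<open>C\<close>
      unless \<open>g\<close> is zero.\<close>
    define g where "g = hardy2_of (\<lambda>\<alpha>. if \<alpha> \<in> F then a \<alpha> else 0)"
    have g: "hardy2_coeff g \<alpha> = (if \<alpha> \<in> F then a \<alpha> else 0)" for \<alpha>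
      by (simp add: g_def coeff_hardy2_of square_summable_finite_support F)
    let ?S = "\<Sum>\<alpha>\<in>F. (cmod (a \<alpha>))\<^sup>2"
    have normg: "(norm g)\<^sup>2 = ?S"
      by (rule has_sum_unique[OF has_sum_norm_hardy2 has_sum_finite_neutralI[OF F]]) (auto simp: g)
    have "l g = of_real ?S"
    proof -
      have "hardy2_truncate F g = g"
        by (rule hardy2_eqI) (simp add: coeff_hardy2_truncate F g)
      then have "l g = (\<Sum>\<alpha>\<in>F. hardy2_coeff g \<alpha> * l (b \<alpha>))"
        using trunc[OF F, of g] by simp
      also have "\<dots> = (\<Sum>\<alpha>\<in>F. a \<alpha> * cnj (a \<alpha>))"
        by (rule sum.cong) (auto simp: g a_def)
      finally show ?thesis
        by (simp add: complex_norm_square[symmetric] del: of_real_power)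
    qed
    then have "cmod (l g) = (norm g)\<^sup>2"
      unfolding normg by (metis norm_of_real abs_of_nonneg normg zero_le_power2)
    then have *: "(norm g)\<^sup>2 \<le> C * norm g"
      using C[of g] by simp
    have "(norm g)\<^sup>2 \<le> C\<^sup>2"
    proof (cases "norm g = 0")
      case False
      then have "norm g \<le> C" using * by (simp add: power2_eq_square)
      then show ?thesis by (intro power_mono) auto
    qed simp
    then show "?S \<le> C\<^sup>2"
      by (simp add: normg)
  qed
  have "l f = hardy2_cinner f (hardy2_of a)" for f
  proof -
    have diff: "l f - l (hardy2_truncate F f) = l (f - hardy2_truncate F f)" for F
      using add[of "f - hardy2_truncate F f" "hardy2_truncate F f"] by simp
    have "((\<lambda>F. C * norm (f - hardy2_truncate F f)) \<longlongrightarrow> 0) (finite_subsets_at_top UNIV)"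
      by (rule tendsto_mult_right_zero[OF tendsto_norm_hardy2_truncate])
    then have "((\<lambda>F. l f - l (hardy2_truncate F f)) \<longlongrightarrow> 0) (finite_subsets_at_top UNIV)"
      by (rule Lim_null_comparison[rotated]) (simp add: diff C)
    then have "((\<lambda>F. l f - (l f - l (hardy2_truncate F f))) \<longlongrightarrow> l f - 0) (finite_subsets_at_top UNIV)"
      by (intro tendsto_intros)
    then have "((\<lambda>F. l (hardy2_truncate F f)) \<longlongrightarrow> l f) (finite_subsets_at_top UNIV)"
      by simp
    then have "((\<lambda>F. \<Sum>\<alpha>\<in>F. hardy2_coeff f \<alpha> * l (b \<alpha>)) \<longlongrightarrow> l f) (finite_subsets_at_top UNIV)"
      by (rule Lim_transform_eventually[OF _ eventually_finite_subsets_at_top_weakI]) (rule trunc)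
    then have "((\<lambda>\<alpha>. hardy2_coeff f \<alpha> * l (b \<alpha>)) has_sum l f) UNIV"
      by (simp add: has_sum_def)
    then show ?thesis
      by (simp add: hardy2_cinner_def coeff_hardy2_of a a_def infsumI)
  qed
  then show thesis by (rule that)
qed

definition orthonormal :: "hardy2 set \<Rightarrow> bool"
  where "orthonormal Q \<longleftrightarrow> (\<forall>p\<in>Q. \<forall>q\<in>Q. hardy2_cinner p q = (if p = q then 1 else 0))"

definition hardy2_proj :: "hardy2 set \<Rightarrow> hardy2 \<Rightarrow> hardy2"
  where "hardy2_proj Q f = (\<Sum>q\<in>Q. hardy2_cinner f q *\<^sub>C q)"

lemma proj_residual_orthogonal:
  assumes "orthonormal Q" "finite Q" "q \<in> Q"
  shows "hardy2_cinner (f - hardy2_proj Q f) q = 0"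
proof -
  have "hardy2_cinner (hardy2_proj Q f) q = (\<Sum>p\<in>Q. hardy2_cinner f p * (if p = q then 1 else 0))"
    unfolding hardy2_proj_def hardy2_cinner_sum_left hardy2_cinner_scaleC_left
    by (rule sum.cong) (use assms in \<open>auto simp: orthonormal_def\<close>)
  then show ?thesis
    using assms by (simp add: hardy2_cinner_diff_left if_distrib cong: if_cong)
qed

lemma proj_residual_orthogonal_fixed:
  assumes "orthonormal Q" "finite Q" "hardy2_proj Q e = e"
  shows "hardy2_cinner (f - hardy2_proj Q f) e = 0"
proof -
  have "hardy2_cinner (f - hardy2_proj Q f) (hardy2_proj Q e) = 0"
    unfolding hardy2_proj_def[of Q e] hardy2_cinner_sum_right hardy2_cinner_scaleC_right
    using proj_residual_orthogonal[OF assms(1,2)] by simp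
  then show ?thesis by (simp add: assms)
qed

lemma norm_proj_residual_le:
  assumes "orthonormal Q" "finite Q"
  shows "norm (f - hardy2_proj Q f) \<le> norm f"
proof -
  let ?p = "hardy2_proj Q f"
  have "hardy2_cinner (f - ?p) ?p = 0"
    unfolding hardy2_proj_def[of Q f, THEN arg_cong[where f = "hardy2_cinner (f - ?p)"]]
      hardy2_cinner_sum_right hardy2_cinner_scaleC_right
    using proj_residual_orthogonal[OF assms] by simp
  then have "inner (f - ?p) ?p = 0"
    by (metis Re_hardy2_cinner zero_complex.sel(1))
  then have "(norm f)\<^sup>2 = (norm (f - ?p))\<^sup>2 + (norm ?p)\<^sup>2"
    by (simp add: power2_norm_eq_inner inner_diff_left inner_diff_right inner_commute)
  then show ?thesis
    by (simp add: power2_le_imp_le)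
qed

text \<open>That \<open>e i\<close> lies in the span of \<open>Q\<close> is expressed as invariance
  under the projection, the form in which it is used. A vector depending on its predecessors adds
  nothing to \<open>Q\<close>, hence the inequality between the cardinalities.\<close>

lemma gram_schmidt:
  assumes "finite I"
  shows "\<exists>Q. finite Q \<and> card Q \<le> card I \<and> orthonormal Q \<and> (\<forall>i\<in>I. hardy2_proj Q (e i) = e i)"
  using assms
proof (induction I)
  case empty
  then show ?case by (intro exI[of _ "{}"]) (auto simp: orthonormal_def)
next
  case (insert j I)
  then obtain Q where Q: "finite Q" "card Q \<le> card I" "orthonormal Q"
    and fix_e: "\<And>i. i \<in> I \<Longrightarrow> hardy2_proj Q (e i) = e i"
    by auto
  define q where "q = e j - hardy2_proj Q (e j)"
  show ?case
  proof (cases "q = 0")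
    case True
    then show ?thesis
      using Q fix_e insert by (intro exI[of _ Q]) (auto simp: q_def)
  next
    case False
    define u where "u = complex_of_real (1 / norm q) *\<^sub>C q"
    have orth: "hardy2_cinner q p = 0" if "p \<in> Q" for p
      unfolding q_def by (rule proj_residual_orthogonal[OF Q(3,1) that])
    have orth': "hardy2_cinner p q = 0" if "p \<in> Q" for p
      using orth[OF that] hardy2_cinner_commute[of p q] by simp
    have uu: "hardy2_cinner u u = 1"
      using False unfolding hardy2_cinner_self by (simp add: u_def norm_scaleC norm_divide)
    have up: "hardy2_cinner u p = 0" "hardy2_cinner p u = 0" if "p \<in> Q" for p
      using orth[OF that] orth'[OF that]
      by (auto simp: u_def hardy2_cinner_scaleC_left hardy2_cinner_scaleC_right)
    have uQ: "u \<notin> Q"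
      using up uu by force
    have proj: "hardy2_proj (insert u Q) f = hardy2_cinner f u *\<^sub>C u + hardy2_proj Q f" for f
      using Q uQ by (simp add: hardy2_proj_def)
    have u_proj: "hardy2_cinner (hardy2_proj Q f) u = 0" for f
      by (simp add: hardy2_proj_def hardy2_cinner_sum_left hardy2_cinner_scaleC_left up)
    have "hardy2_proj (insert u Q) (e i) = e i" if "i \<in> insert j I" for i
    proof (cases "i \<in> I")
      case True
      then have "hardy2_cinner (e i) u = 0"
        using u_proj[of "e i"] fix_e by simp
      then show ?thesis
        using fix_e[OF True] by (simp add: proj complex_vector.scale_zero_left)
    next
      case False
      then have "i = j" using that by simp
      have "hardy2_cinner (e j) u = hardy2_cinner q u"
        by (simp add: q_def hardy2_cinner_diff_left u_proj)
      also have "\<dots> = of_real (norm q)"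
        using \<open>q \<noteq> 0\<close> by (simp add: u_def hardy2_cinner_scaleC_right hardy2_cinner_self power2_eq_square)
      finally have "hardy2_cinner (e j) u *\<^sub>C u = q"
        using \<open>q \<noteq> 0\<close> by (simp add: u_def scaleC_scaleC scaleC_one)
      then show ?thesis
        by (simp add: proj \<open>i = j\<close> q_def)
    qed
    moreover have "orthonormal (insert u Q)"
      using Q(3) uu up uQ by (auto simp: orthonormal_def)
    moreover have "card (insert u Q) \<le> card (insert j I)"
      using Q uQ insert by simp
    ultimately show ?thesis
      using Q by (intro exI[of _ "insert u Q"]) auto
  qed
qed

section \<open>From vanishing conditions to approximation numbers and compactness\<close>

lemma bounded_clinear_sum_scaleC:
  assumes T: "bounded_clinear (T :: hardy2 \<Rightarrow> hardy2)"
  shows "T (hardy2_proj Q f) = (\<Sum>q\<in>Q. hardy2_cinner f q *\<^sub>C T q)"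
proof -
  have "T (\<Sum>q\<in>Q. g q) = (\<Sum>q\<in>Q. T (g q))" for g
    using T linear_sum[of T g Q] bounded_linear.linear by (auto simp: bounded_clinear_def)
  then show ?thesis
    using T by (simp add: hardy2_proj_def bounded_clinear_def)
qed

lemma bounded_clinear_hardy2I:
  fixes T :: "hardy2 \<Rightarrow> hardy2"
  assumes add: "\<And>f g. T (f + g) = T f + T g" and scale: "\<And>c f. T (c *\<^sub>C f) = c *\<^sub>C T f"
    and le: "\<And>f. norm (T f) \<le> C * norm f"
  shows "bounded_clinear T"
  unfolding bounded_clinear_def
proof (intro conjI allI scale)
  show "bounded_linear T"
    by (rule bounded_linear_intro[where K = C])
      (use add scale le in \<open>auto simp: scaleR_scaleC mult.commute\<close>)
qed

text \<open>\<open>f - hardy2_proj Q f\<close> is orthogonal to all representing vectors, so every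
  \<open>l i\<close> vanishes on it and the assumed smallness applies; its norm is at most that of
  \<open>f\<close>.\<close>

lemma finite_rank_approximation:
  fixes T :: "hardy2 \<Rightarrow> hardy2"
  assumes T: "bounded_clinear T" and I: "finite I"
    and l: "\<And>i. i \<in> I \<Longrightarrow> bounded_functional (l i)" and \<delta>: "0 \<le> \<delta>"
    and small: "\<And>f. (\<And>i. i \<in> I \<Longrightarrow> l i f = 0) \<Longrightarrow> norm (T f) \<le> \<delta> * norm f"
  obtains Q where "finite Q" "card Q \<le> card I" "orthonormal Q"
    "\<And>f. norm (T f - T (hardy2_proj Q f)) \<le> \<delta> * norm f"
proof -
  have "\<forall>i\<in>I. \<exists>e. \<forall>f. l i f = hardy2_cinner f e"
    using hardy2_riesz l by metis
  then obtain e where e: "\<And>i f. i \<in> I \<Longrightarrow> l i f = hardy2_cinner f (e i)"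
    by metis
  obtain Q where Q: "finite Q" "card Q \<le> card I" "orthonormal Q"
    and fix_e: "\<And>i. i \<in> I \<Longrightarrow> hardy2_proj Q (e i) = e i"
    using gram_schmidt[OF I, of e] by auto
  have "norm (T f - T (hardy2_proj Q f)) \<le> \<delta> * norm f" for f
  proof -
    have "T f - T (hardy2_proj Q f) = T (f - hardy2_proj Q f)"
      using T by (simp add: bounded_clinear_def bounded_linear.linear linear_diff)
    also have "norm \<dots> \<le> \<delta> * norm (f - hardy2_proj Q f)"
      by (rule small) (simp add: e proj_residual_orthogonal_fixed Q fix_e)
    also have "\<dots> \<le> \<delta> * norm f"
      by (intro mult_left_mono norm_proj_residual_le Q \<delta>)
    finally show ?thesis .
  qed
  with Q show thesis by (rule that)
qed

text \<open>\<open>T\<close> after the projection is a competitor in the infimum, with range spanned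
  by the image of \<open>Q\<close>. The strict bound on \<open>card Q\<close> matches the strict
  bound in \<open>rank_less\<close>.\<close>

lemma approx_number_le:
  fixes T :: "hardy2 \<Rightarrow> hardy2"
  assumes T: "bounded_clinear T" and Q: "finite Q" "card Q < n" and \<delta>: "0 \<le> \<delta>"
    and le: "\<And>f. norm (T f - T (hardy2_proj Q f)) \<le> \<delta> * norm f"
  shows "approx_number T n \<le> \<delta>"
proof -
  define R where "R f = T (hardy2_proj Q f)" for f
  have R_eq: "R f = (\<Sum>q\<in>Q. hardy2_cinner f q *\<^sub>C T q)" for f
    unfolding R_def by (rule bounded_clinear_sum_scaleC[OF T])
  have R: "bounded_clinear R"
  proof (rule bounded_clinear_hardy2I)
    show "R (f + g) = R f + R g" for f g
      by (simp add: R_eq hardy2_cinner_add_left scaleC_add_left sum.distrib)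
    show "R (c *\<^sub>C f) = c *\<^sub>C R f" for c f
      by (simp add: R_eq hardy2_cinner_scaleC_left scaleC_scaleC complex_vector.scale_sum_right)
    show "norm (R f) \<le> (\<Sum>q\<in>Q. norm q * norm (T q)) * norm f" for f
      unfolding R_eq sum_distrib_right
    proof (rule sum_norm_le)
      fix q
      show "norm (hardy2_cinner f q *\<^sub>C T q) \<le> norm q * norm (T q) * norm f"
        using mult_right_mono[OF norm_hardy2_cinner_le[of f q], of "norm (T q)"]
        by (simp add: norm_scaleC mult_ac)
    qed
  qed
  have "rank_less R n"
    unfolding rank_less_def
  proof (intro exI conjI)
    show "finite (T ` Q)" "card (T ` Q) < n"
      using Q card_image_le[of Q T] by auto
    show "range R \<subseteq> complex_vector.span (T ` Q)"
      unfolding R_eq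
      by (intro image_subsetI complex_vector.span_sum complex_vector.span_scale)
        (simp add: complex_vector.span_base)
  qed
  have lin: "bounded_linear (\<lambda>x. T x - S x)" if "bounded_clinear S" for S :: "hardy2 \<Rightarrow> hardy2"
    using T that unfolding bounded_clinear_def by (intro bounded_linear_sub) blast+
  have "approx_number T n \<le> onorm (\<lambda>x. T x - R x)"
    unfolding approx_number_def
  proof (rule cInf_lower)
    show "bdd_below {onorm (\<lambda>x. T x - R x) |R. bounded_clinear R \<and> rank_less R n}"
      by (rule bdd_belowI[of _ 0]) (auto intro: onorm_pos_le lin)
  qed (use R \<open>rank_less R n\<close> in blast)
  also have "\<dots> \<le> \<delta>"
    using le \<delta> by (intro onorm_bound) (auto simp: R_def)
  finally show ?thesis .
qed

lemma compact_finite_combinations: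
  fixes t :: "'q \<Rightarrow> hardy2"
  assumes "finite Q"
  shows "compact {\<Sum>q\<in>Q. c q *\<^sub>C t q | c. \<forall>q\<in>Q. cmod (c q) \<le> M}"
  using assms
proof (induction Q)
  case empty
  then show ?case by simp
next
  case (insert p Q)
  let ?S = "{\<Sum>q\<in>Q. c q *\<^sub>C t q | c. \<forall>q\<in>Q. cmod (c q) \<le> M}"
  have "bounded_linear (\<lambda>c. c *\<^sub>C t p)"
    by (rule bounded_linear_intro[where K = "norm (t p)"])
      (auto simp: scaleC_add_left scaleR_scaleC scaleC_scaleC norm_scaleC scaleR_conv_of_real)
  then have "compact ((\<lambda>c. c *\<^sub>C t p) ` cball 0 M)"
    by (intro compact_continuous_image linear_continuous_on compact_cball)
  then have "compact {x + y | x y. x \<in> (\<lambda>c. c *\<^sub>C t p) ` cball 0 M \<and> y \<in> ?S}"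
    using insert by (intro compact_sums) auto
  moreover have "{x + y | x y. x \<in> (\<lambda>c. c *\<^sub>C t p) ` cball 0 M \<and> y \<in> ?S}
      = {\<Sum>q\<in>insert p Q. c q *\<^sub>C t q | c. \<forall>q\<in>insert p Q. cmod (c q) \<le> M}" (is "?A = ?B")
  proof
    show "?A \<subseteq> ?B"
    proof safe
      fix d c assume "d \<in> cball (0::complex) M" "\<forall>q\<in>Q. cmod (c q) \<le> M"
      moreover have "(\<Sum>q\<in>Q. (c(p := d)) q *\<^sub>C t q) = (\<Sum>q\<in>Q. c q *\<^sub>C t q)"
        using insert by (intro sum.cong) auto
      ultimately show "\<exists>c'. d *\<^sub>C t p + (\<Sum>q\<in>Q. c q *\<^sub>C t q) = (\<Sum>q\<in>insert p Q. c' q *\<^sub>C t q) \<and>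
          (\<forall>q\<in>insert p Q. cmod (c' q) \<le> M)"
        using insert by (intro exI[of _ "c(p := d)"]) auto
    qed
    show "?B \<subseteq> ?A"
      using insert by fastforce
  qed
  ultimately show ?case by simp
qed

text \<open>Total boundedness: up to \<open>e / 4\<close> the image of the unit ball lies in the
  compact set of combinations of the finitely many \<open>T q\<close> with coefficients in the
  closed unit disk, orthonormality of \<open>Q\<close> being what bounds the coefficients.\<close>

lemma compact_operatorI:
  fixes T :: "hardy2 \<Rightarrow> hardy2"
  assumes T: "bounded_clinear T"
    and approx: "\<And>\<epsilon>. 0 < \<epsilon> \<Longrightarrow> \<exists>Q. finite Q \<and> orthonormal Q \<and>
      (\<forall>f. norm (T f - T (hardy2_proj Q f)) \<le> \<epsilon> * norm f)"
  shows "compact_operator T"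
  unfolding compact_operator_def
proof (intro conjI T)
  have "\<exists>k. finite k \<and> closure (T ` cball 0 1) \<subseteq> (\<Union>x\<in>k. ball x e)" if e: "e > 0" for e
  proof -
    obtain Q where Q: "finite Q" "orthonormal Q"
      and le: "\<And>f. norm (T f - T (hardy2_proj Q f)) \<le> e / 4 * norm f"
      using approx[of "e / 4"] e by auto
    define K where "K = {\<Sum>q\<in>Q. c q *\<^sub>C T q | c. \<forall>q\<in>Q. cmod (c q) \<le> 1}"
    have "compact K"
      unfolding K_def by (rule compact_finite_combinations) (rule Q)
    then obtain k where k: "finite k" "K \<subseteq> (\<Union>x\<in>k. ball x (e / 4))"
      using e unfolding compact_eq_totally_bounded by (metis divide_pos_pos zero_less_numeral)
    \<comment> \<open>The finite union of closed balls of radius \<open>e / 2\<close> is closed, so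
      it also contains the closure of the image, and it still fits into the open balls of radius
      \<open>e\<close>.\<close>
    have "T ` cball 0 1 \<subseteq> (\<Union>x\<in>k. cball x (e / 2))"
    proof safe
      fix f :: hardy2 assume f: "f \<in> cball 0 1"
      have "cmod (hardy2_cinner f q) \<le> 1" if "q \<in> Q" for q
      proof -
        have "(norm q)\<^sup>2 = 1"
          using hardy2_cinner_self[of q] Q(2) that
          by (metis of_real_eq_1_iff orthonormal_def)
        then have "norm q = 1"
          by (metis abs_norm_cancel real_sqrt_abs real_sqrt_one)
        then show ?thesis
          using norm_hardy2_cinner_le[of f q] f by simp
      qed
      then have "T (hardy2_proj Q f) \<in> K"
        unfolding K_def bounded_clinear_sum_scaleC[OF T] by blast
      then obtain x where x: "x \<in> k" "dist x (T (hardy2_proj Q f)) < e / 4"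
        using k by auto
      moreover have "dist (T (hardy2_proj Q f)) (T f) \<le> e / 4"
      proof -
        have "norm (T f - T (hardy2_proj Q f)) \<le> e / 4 * norm f" by (rule le)
        also have "\<dots> \<le> e / 4 * 1" using f e by (intro mult_left_mono) auto
        finally show ?thesis by (simp add: dist_norm norm_minus_commute)
      qed
      ultimately have "dist x (T f) \<le> e / 2"
        using dist_triangle[of x "T f" "T (hardy2_proj Q f)"] by simp
      with x show "T f \<in> (\<Union>x\<in>k. cball x (e / 2))" by auto
    qed
    then have "closure (T ` cball 0 1) \<subseteq> (\<Union>x\<in>k. cball x (e / 2))"
      using k by (intro closure_minimal) auto
    also have "\<dots> \<subseteq> (\<Union>x\<in>k. ball x e)"
      using e by (intro UN_mono) auto
    finally show ?thesis using k by blast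
  qed
  then show "compact (closure (T ` cball 0 1))"
    unfolding compact_eq_totally_bounded by (simp add: complete_eq_closed)
qed

section \<open>Point evaluations and membership in the Hardy space\<close>

lemma has_sum_norm_monomial2:
  assumes "z \<in> bidisk"
  shows "((\<lambda>\<alpha>. (cmod (monomial2 \<alpha> z))\<^sup>2) has_sum
    1 / ((1 - (cmod (fst z))\<^sup>2) * (1 - (cmod (snd z))\<^sup>2))) UNIV"
proof -
  define r s where "r = (cmod (fst z))\<^sup>2" and "s = (cmod (snd z))\<^sup>2"
  have r: "0 \<le> r" "r < 1" and s: "0 \<le> s" "s < 1"
    using assms by (auto simp: r_def s_def bidisk_def abs_square_less_1)
  have geo: "((\<lambda>n. q ^ n) has_sum 1 / (1 - q)) (UNIV :: nat set)" if "0 \<le> q" "q < 1" for q :: real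
    using that by (intro norm_summable_imp_has_sum geometric_sums) (auto simp: summable_geometric)
  have mono: "(cmod (monomial2 \<alpha> z))\<^sup>2 = r ^ fst \<alpha> * s ^ snd \<alpha>" for \<alpha>
    by (simp add: monomial2_def r_def s_def norm_mult norm_power power_mult_distrib
        flip: power_mult) (simp add: mult.commute)
  have "((\<lambda>\<alpha>. r ^ fst \<alpha> * s ^ snd \<alpha>) has_sum 1 / (1 - r) * (1 / (1 - s))) (UNIV \<times> UNIV)"
  proof (rule has_sum_SigmaI)
    show "((\<lambda>k. r ^ fst (j, k) * s ^ snd (j, k)) has_sum r ^ j * (1 / (1 - s))) UNIV" for j
      using has_sum_cmult_right[OF geo[OF s], of "r ^ j"] by simp
    show "((\<lambda>j. r ^ j * (1 / (1 - s))) has_sum 1 / (1 - r) * (1 / (1 - s))) UNIV"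
      by (rule has_sum_cmult_left[OF geo[OF r]])
    show "(\<lambda>\<alpha>. r ^ fst \<alpha> * s ^ snd \<alpha>) summable_on UNIV \<times> UNIV"
      using square_summable_monomial2[OF assms] by (simp add: square_summable_def mono)
  qed
  then show ?thesis
    by (simp add: mono flip: r_def s_def)
qed

text \<open>The reproducing kernel at \<open>(a, b)\<close> has the conjugated monomials as
  coefficients, and its squared norm is a product of two geometric series. Passing from squares to
  first powers weakens the bound but suits the later lower bounds on 1 - |u|.\<close>

lemma norm_hardy2_fun_le:
  assumes a: "cmod a < 1" and b: "cmod b < 1"
  shows "cmod (hardy2_fun f (a, b)) \<le> norm f / sqrt ((1 - cmod a) * (1 - cmod b))"
proof -
  let ?z = "(a, b)"
  have z: "?z \<in> bidisk" using a b by (simp add: bidisk_def)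
  define k where "k = hardy2_of (\<lambda>\<alpha>. cnj (monomial2 \<alpha> ?z))"
  have k: "hardy2_coeff k \<alpha> = cnj (monomial2 \<alpha> ?z)" for \<alpha>
    by (simp add: k_def coeff_hardy2_of square_summable_cnj square_summable_monomial2 z)
  have "hardy2_fun f ?z = hardy2_cinner f k"
    using z by (simp add: hardy2_fun_eq bidisk_series_def hardy2_cinner_def k)
  then have le: "cmod (hardy2_fun f ?z) \<le> norm f * norm k"
    using norm_hardy2_cinner_le[of f k] by simp
  have "(norm k)\<^sup>2 = 1 / ((1 - (cmod a)\<^sup>2) * (1 - (cmod b)\<^sup>2))"
    using has_sum_unique[OF has_sum_norm_hardy2[of k]] has_sum_norm_monomial2[OF z] by (simp add: k)
  also have "\<dots> \<le> 1 / ((1 - cmod a) * (1 - cmod b))"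
  proof (rule divide_left_mono)
    show "(1 - cmod a) * (1 - cmod b) \<le> (1 - (cmod a)\<^sup>2) * (1 - (cmod b)\<^sup>2)"
    proof (rule mult_mono)
      show "1 - cmod a \<le> 1 - (cmod a)\<^sup>2" "1 - cmod b \<le> 1 - (cmod b)\<^sup>2"
        using a b by (simp_all add: power2_eq_square mult_left_le)
      show "0 \<le> 1 - (cmod a)\<^sup>2"
        using a by (simp add: abs_square_le_1)
    qed (use b in auto)
    show "0 < (1 - (cmod a)\<^sup>2) * (1 - (cmod b)\<^sup>2) * ((1 - cmod a) * (1 - cmod b))"
      using a b by (simp add: abs_square_less_1)
  qed simp
  finally have "norm k \<le> 1 / sqrt ((1 - cmod a) * (1 - cmod b))"
    using real_le_rsqrt by (fastforce simp: real_sqrt_divide)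
  then have "norm f * norm k \<le> norm f * (1 / sqrt ((1 - cmod a) * (1 - cmod b)))"
    by (intro mult_left_mono) auto
  with le show ?thesis by simp
qed

lemma hardy2_fun_add: "hardy2_fun (f + g) z = hardy2_fun f z + hardy2_fun g z"
  by (simp add: hardy2_fun_eq bidisk_series_add[symmetric] square_summable_coeff coeff_add[abs_def]
      flip: fun_eq_iff)

lemma hardy2_fun_scaleC: "hardy2_fun (c *\<^sub>C f) z = c * hardy2_fun f z"
  by (simp add: hardy2_fun_eq bidisk_series_cmult[symmetric] coeff_scaleC[abs_def])

lemma hardy2_fun_diff: "hardy2_fun (f - g) z = hardy2_fun f z - hardy2_fun g z"
  using hardy2_fun_add[of "f - g" g z] by simp

lemma hardy2_fun_outside: "z \<notin> bidisk \<Longrightarrow> hardy2_fun f z = 0"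
  by (simp add: hardy2_fun_eq bidisk_series_def)

lemma hardy2_fun_eqI:
  assumes "\<And>z. z \<in> bidisk \<Longrightarrow> hardy2_fun f z = hardy2_fun g z"
  shows "f = g"
proof -
  have "hardy2_fun f = hardy2_fun g"
    using assms hardy2_fun_outside by (metis ext)
  then show ?thesis by (simp add: hardy2_fun_inject)
qed

text \<open>A holomorphic curve \<open>(a t, b t)\<close> covers each variable of the shifted
  diagonal and of the symbol. On a compact disk of parameters the product (1 - |a|) (1 - |b|) has a
  positive minimum, so polynomial truncations converge uniformly there.\<close>

lemma holomorphic_on_hardy2_fun:
  assumes S: "open S" and a: "a holomorphic_on S" and b: "b holomorphic_on S"
    and le: "\<And>t. t \<in> S \<Longrightarrow> cmod (a t) < 1 \<and> cmod (b t) < 1"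
  shows "(\<lambda>t. hardy2_fun f (a t, b t)) holomorphic_on S"
proof -
  have "(\<lambda>t. hardy2_fun f (a t, b t)) field_differentiable (at t0)" if "t0 \<in> S" for t0
  proof -
    obtain r where r: "r > 0" "cball t0 r \<subseteq> S"
      using S \<open>t0 \<in> S\<close> open_contains_cball by blast
    have "continuous_on (cball t0 r) (\<lambda>t. (1 - cmod (a t)) * (1 - cmod (b t)))"
      using a b r by (intro continuous_intros; meson holomorphic_on_imp_continuous_on holomorphic_on_subset)
    from continuous_attains_inf[OF compact_cball _ this] obtain t1 where t1: "t1 \<in> cball t0 r"
      and inf: "\<And>t. t \<in> cball t0 r \<Longrightarrow>
        (1 - cmod (a t1)) * (1 - cmod (b t1)) \<le> (1 - cmod (a t)) * (1 - cmod (b t))"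
      using r by auto
    define m where "m = (1 - cmod (a t1)) * (1 - cmod (b t1))"
    have m: "0 < m" using le[of t1] t1 r by (auto simp: m_def)
    have lim: "uniform_limit (cball t0 r) (\<lambda>F t. hardy2_fun (hardy2_truncate F f) (a t, b t))
        (\<lambda>t. hardy2_fun f (a t, b t)) (finite_subsets_at_top UNIV)"
    proof (rule uniform_limitI)
      fix e :: real assume e: "e > 0"
      have "((\<lambda>F. norm (f - hardy2_truncate F f) / sqrt m) \<longlongrightarrow> 0) (finite_subsets_at_top UNIV)"
        by (rule tendsto_divide_zero[OF tendsto_norm_hardy2_truncate])
      then have "\<forall>\<^sub>F F in finite_subsets_at_top UNIV. norm (f - hardy2_truncate F f) / sqrt m < e"
        using e by (rule order_tendstoD)
      then show "\<forall>\<^sub>F F in finite_subsets_at_top UNIV. \<forall>t\<in>cball t0 r.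
          dist (hardy2_fun (hardy2_truncate F f) (a t, b t)) (hardy2_fun f (a t, b t)) < e"
      proof (rule eventually_mono, intro ballI)
        fix F t assume F: "norm (f - hardy2_truncate F f) / sqrt m < e" and t: "t \<in> cball t0 r"
        have "dist (hardy2_fun (hardy2_truncate F f) (a t, b t)) (hardy2_fun f (a t, b t))
            = cmod (hardy2_fun (f - hardy2_truncate F f) (a t, b t))"
          by (simp add: dist_norm hardy2_fun_diff norm_minus_commute)
        also have "\<dots> \<le> norm (f - hardy2_truncate F f) / sqrt ((1 - cmod (a t)) * (1 - cmod (b t)))"
          using le t r by (intro norm_hardy2_fun_le) auto
        also have "\<dots> \<le> norm (f - hardy2_truncate F f) / sqrt m"
          using inf[OF t] m order_less_le_trans[OF m inf[OF t, folded m_def]]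
          by (intro divide_left_mono mult_pos_pos) (auto simp: m_def simp del: zero_less_mult_iff)
        also have "\<dots> < e" by (rule F)
        finally show "dist (hardy2_fun (hardy2_truncate F f) (a t, b t)) (hardy2_fun f (a t, b t)) < e" .
      qed
    qed
    have hol: "(\<lambda>t. hardy2_fun (hardy2_truncate F f) (a t, b t)) holomorphic_on cball t0 r"
      if F: "finite F" for F
    proof -
      have "(\<lambda>t. \<Sum>\<alpha>\<in>F. hardy2_coeff f \<alpha> * (a t ^ fst \<alpha> * b t ^ snd \<alpha>)) holomorphic_on cball t0 r"
        using a b r by (intro holomorphic_intros; meson holomorphic_on_subset)
      then show ?thesis
        by (rule holomorphic_transform)
          (use r le in \<open>auto simp: fun_hardy2_truncate F bidisk_def monomial2_def subset_eq\<close>)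
    qed
    have "(\<lambda>t. hardy2_fun f (a t, b t)) holomorphic_on ball t0 r"
    proof (rule holomorphic_uniform_limit[OF _ lim])
      show "\<forall>\<^sub>F F in finite_subsets_at_top UNIV.
          continuous_on (cball t0 r) (\<lambda>t. hardy2_fun (hardy2_truncate F f) (a t, b t)) \<and>
          (\<lambda>t. hardy2_fun (hardy2_truncate F f) (a t, b t)) holomorphic_on ball t0 r"
        by (intro eventually_finite_subsets_at_top_weakI conjI holomorphic_on_imp_continuous_on[OF hol]
            holomorphic_on_subset[OF hol ball_subset_cball])
    qed auto
    then show ?thesis
      using r by (meson centre_in_ball holomorphic_on_imp_differentiable_at open_ball)
  qed
  then show ?thesis
    by (simp add: holomorphic_on_def field_differentiable_at_within)
qed

section \<open>Membership from a harmonic majorant\<close>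

lemma taylor_coeff_has_sum:
  assumes f: "f holomorphic_on ball 0 1" and z: "z \<in> ball 0 1"
  shows "((\<lambda>n. taylor_coeff f 0 n * z ^ n) has_sum f z) UNIV"
proof (rule norm_summable_imp_has_sum)
  show "(\<lambda>n. taylor_coeff f 0 n * z ^ n) sums f z"
    using taylor_coeff_sums[OF f z] by simp
  obtain r where r: "cmod z < r" "r < 1"
    using z dense by auto
  then have "complex_of_real r \<in> ball 0 1"
    using norm_ge_zero[of z] by (simp del: norm_ge_zero)
  then have "summable (\<lambda>n. taylor_coeff f 0 n * complex_of_real r ^ n)"
    using taylor_coeff_sums[OF f] by (fastforce simp: sums_iff)
  then show "summable (\<lambda>n. norm (taylor_coeff f 0 n * z ^ n))"
    by (rule powser_insidea) (use r norm_ge_zero[of z] in \<open>simp del: norm_ge_zero\<close>)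
qed

text \<open>Expand in w with coefficient functions \<open>b k\<close>, then each \<open>b k\<close>
  in z. Bessel's inequality in w bounds the sum of |b k z|^2 by \<open>Re (P z)\<close>, and in z it
  bounds the double sum by \<open>Re (P 0)\<close>. Separate holomorphy suffices, as the double
  series is summed one variable at a time.\<close>

lemma hardy2_criterion:
  assumes h1: "\<And>w. w \<in> ball 0 1 \<Longrightarrow> (\<lambda>z. h (z, w)) holomorphic_on ball 0 1"
    and h2: "\<And>z. z \<in> ball 0 1 \<Longrightarrow> (\<lambda>w. h (z, w)) holomorphic_on ball 0 1"
    and P: "P holomorphic_on ball 0 1"
    and le: "\<And>z w. z \<in> ball 0 1 \<Longrightarrow> w \<in> ball 0 1 \<Longrightarrow> (cmod (h (z, w)))\<^sup>2 \<le> Re (P z)"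
  obtains f where "(norm f)\<^sup>2 \<le> Re (P 0)" "\<And>z. z \<in> bidisk \<Longrightarrow> hardy2_fun f z = h z"
proof -
  define b where "b k z = taylor_coeff (\<lambda>w. h (z, w)) 0 k" for k z
  define a where "a \<alpha> = taylor_coeff (b (snd \<alpha>)) 0 (fst \<alpha>)" for \<alpha>
  have hol_b: "b k holomorphic_on ball 0 1" for k
  proof -
    have "b k field_differentiable (at z0)" if z0: "z0 \<in> ball 0 1" for z0
    proof -
      obtain \<rho> where \<rho>: "cmod z0 < \<rho>" "\<rho> < 1"
        using z0 dense by auto
      have sub: "cball 0 \<rho> \<subseteq> ball (0::complex) 1" using \<rho> by auto
      have "continuous_on (cball 0 \<rho>) (\<lambda>z. Re (P z))"
        using P sub by (intro continuous_intros) (meson holomorphic_on_imp_continuous_on holomorphic_on_subset)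
      then have "bounded ((\<lambda>z. Re (P z)) ` cball 0 \<rho>)"
        by (intro compact_imp_bounded compact_continuous_image compact_cball)
      then obtain M where M: "\<And>z. z \<in> cball 0 \<rho> \<Longrightarrow> \<bar>Re (P z)\<bar> \<le> M"
        unfolding bounded_iff real_norm_def by blast
      \<comment> \<open>The parameter lemma asks for a uniform bound, which the majorant gives on
        each smaller disk.\<close>
      have "(\<lambda>z. taylor_coeff (\<lambda>w. h (z, w)) 0 k) holomorphic_on ball 0 \<rho>"
      proof (rule holomorphic_taylor_coeff_param[where R = 1 and M = "sqrt M"])
        show "(\<lambda>w. h (z, w)) holomorphic_on ball 0 1" if "z \<in> ball 0 \<rho>" for z
          using that \<rho> by (intro h2) auto
        show "(\<lambda>z. h (z, w)) holomorphic_on ball 0 \<rho>" if "w \<in> ball 0 1" for w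
          using h1[OF that] by (rule holomorphic_on_subset) (use \<rho> in auto)
        show "cmod (h (z, w)) \<le> sqrt M" if "z \<in> ball 0 \<rho>" "w \<in> ball 0 1" for z w
        proof (rule real_le_rsqrt)
          have "(cmod (h (z, w)))\<^sup>2 \<le> Re (P z)" using that \<rho> by (intro le) auto
          also have "\<dots> \<le> M" using M[of z] that by auto
          finally show "(cmod (h (z, w)))\<^sup>2 \<le> M" .
        qed
      qed auto
      then have "b k holomorphic_on ball 0 \<rho>"
        by (simp add: b_def[abs_def])
      then show ?thesis
        using \<rho> by (intro holomorphic_on_imp_differentiable_at[of _ "ball 0 \<rho>"]) auto
    qed
    then show ?thesis
      by (simp add: holomorphic_on_def field_differentiable_at_within)
  qed
  \<comment> \<open>Bessel's inequality for a single function of w, with z frozen and the constant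
    \<open>P z\<close> as majorant.\<close>
  have sum_b: "(\<Sum>k<N. (cmod (b k z))\<^sup>2) \<le> Re (P z)" if z: "z \<in> ball 0 1" for z N
    using bessel_disk[of "{()}" "\<lambda>_ w. h (z, w)" "\<lambda>_. P z" N] h2[OF z] le[OF z]
    by (simp add: b_def)
  have sum_a: "(\<Sum>\<alpha>\<in>F. (cmod (a \<alpha>))\<^sup>2) \<le> Re (P 0)" if F: "finite F" for F
  proof -
    obtain N where "fst ` F \<union> snd ` F \<subseteq> {..<N}"
      using finite_nat_iff_bounded[of "fst ` F \<union> snd ` F"] F by auto
    then have "F \<subseteq> {..<N} \<times> {..<N}" by (force simp: subset_eq)
    then have "(\<Sum>\<alpha>\<in>F. (cmod (a \<alpha>))\<^sup>2) \<le> (\<Sum>\<alpha>\<in>{..<N} \<times> {..<N}. (cmod (a \<alpha>))\<^sup>2)"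
      by (intro sum_mono2) auto
    also have "\<dots> = (\<Sum>k<N. \<Sum>n<N. (cmod (taylor_coeff (b k) 0 n))\<^sup>2)"
      by (subst sum.swap) (simp add: a_def sum.cartesian_product case_prod_unfold)
    also have "\<dots> \<le> Re (P 0)"
      by (rule bessel_disk) (use hol_b P sum_b in auto)
    finally show ?thesis .
  qed
  have a: "square_summable a"
    by (rule square_summableI[OF sum_a])
  let ?f = "hardy2_of a"
  have "(norm ?f)\<^sup>2 \<le> Re (P 0)"
    by (rule has_sum_le_finite_sums[OF has_sum_norm_hardy2]) (simp add: coeff_hardy2_of a sum_a)
  moreover have "hardy2_fun ?f (z, w) = h (z, w)" if z: "z \<in> ball 0 1" and w: "w \<in> ball 0 1" for z w
  proof -
    have zw: "(z, w) \<in> bidisk" using z w by (simp add: bidisk_def)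
    have "((\<lambda>\<alpha>. a \<alpha> * monomial2 \<alpha> (z, w)) has_sum hardy2_fun ?f (z, w)) (UNIV \<times> UNIV)"
      using has_sum_infsum[OF bidisk_series_summable[OF a zw]] zw
      by (simp add: fun_hardy2_of a bidisk_series_def)
    then have "((\<lambda>(k, n). a (n, k) * monomial2 (n, k) (z, w)) has_sum hardy2_fun ?f (z, w)) (UNIV \<times> UNIV)"
      by (subst (asm) has_sum_swap)
    moreover have "((\<lambda>n. case (k, n) of (k, n) \<Rightarrow> a (n, k) * monomial2 (n, k) (z, w)) has_sum b k z * w ^ k) UNIV" for k
      using has_sum_cmult_left[OF taylor_coeff_has_sum[OF hol_b[of k] z], of "w ^ k"]
      by (simp add: a_def monomial2_def mult.assoc)
    ultimately have "((\<lambda>k. b k z * w ^ k) has_sum hardy2_fun ?f (z, w)) UNIV"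
      by (rule has_sum_SigmaD)
    moreover have "((\<lambda>k. b k z * w ^ k) has_sum h (z, w)) UNIV"
      using taylor_coeff_has_sum[OF h2[OF z] w] by (simp add: b_def)
    ultimately show ?thesis by (rule has_sum_unique)
  qed
  ultimately show thesis
    by (intro that[of ?f]) (auto simp: bidisk_def)
qed

section \<open>The cusp map\<close>

lemma continuous_on_insert_limit:
  fixes f :: "'a::t1_space \<Rightarrow> 'b::topological_space"
  assumes cont: "continuous_on (S - {p}) f" and lim: "(f \<longlongrightarrow> f p) (at p within S)"
  shows "continuous_on S f"
  unfolding continuous_on_def
proof
  fix x assume x: "x \<in> S"
  show "(f \<longlongrightarrow> f x) (at x within S)"
  proof (cases "x = p")
    case False
    have "at x within S = at x within (S - {p})"
      by (rule at_within_nhd[of _ "- {p}"]) (use False in auto)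
    then show ?thesis
      using cont x False by (simp add: continuous_on_def)
  qed (use lim in simp)
qed

lemma continuous_on_csqrt_upper: "continuous_on {m. 0 \<le> Im m} csqrt"
  unfolding continuous_on_eq_continuous_within
proof
  fix m :: complex assume m: "m \<in> {m. 0 \<le> Im m}"
  consider "m \<notin> \<real>\<^sub>\<le>\<^sub>0" | "m = 0" | "Re m < 0" "Im m = 0"
    using m by (cases "Re m" "0::real" rule: linorder_cases) (auto simp: complex_nonpos_Reals_iff complex_eq_iff)
  then show "continuous (at m within {m. 0 \<le> Im m}) csqrt"
  proof cases
    case 1
    then show ?thesis by (rule continuous_within_csqrt)
  next
    case 2
    have "((\<lambda>x. norm (csqrt x)) \<longlongrightarrow> sqrt (norm (0::complex))) (at 0 within {m. 0 \<le> Im m})"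
      unfolding norm_csqrt by (intro tendsto_intros)
    then have "((\<lambda>x. norm (csqrt x)) \<longlongrightarrow> 0) (at 0 within {m. 0 \<le> Im m})"
      by (simp only: norm_zero real_sqrt_zero)
    then show ?thesis
      unfolding 2 continuous_within csqrt_0 by (rule tendsto_norm_zero_cancel)
  next
    case 3
    \<comment> \<open>Near a negative real the root equals \<i> times the root of - x as long as x
      stays in the closed upper half plane, and - x is then close to the positive axis, away from
      the cut.\<close>
    show ?thesis
    proof (rule continuous_transform_within)
      have "- m \<notin> \<real>\<^sub>\<le>\<^sub>0" using 3 by (simp add: complex_nonpos_Reals_iff)
      then have "isCont (\<lambda>x. csqrt (- x)) m"
        by (intro continuous_within_compose2[where f = uminus and g = csqrt] continuous_intros continuous_within_csqrt)
      then show "continuous (at m within {m. 0 \<le> Im m}) (\<lambda>x. \<i> * csqrt (- x))"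
        by (intro continuous_intros) (rule continuous_at_imp_continuous_at_within)
      show "0 < - Re m" using 3 by simp
      fix x assume x: "x \<in> {m. 0 \<le> Im m}" "dist x m < - Re m"
      have "\<bar>Re (x - m)\<bar> < - Re m"
        using abs_Re_le_cmod[of "x - m"] x by (simp add: dist_norm)
      then have "Im (- x) < 0 \<or> Im (- x) = 0 \<and> 0 \<le> Re (- x)"
        using x by auto
      from csqrt_minus[OF this] show "\<i> * csqrt (- x) = csqrt x" by simp
    qed (use m in auto)
  qed
qed

text \<open>The imaginary part of q^2 is 2 Re q Im q; with the principal choice of sign this forces
  q into the first quadrant.\<close>

lemma csqrt_upper:
  assumes "0 \<le> Im m"
  shows "0 \<le> Re (csqrt m)" "0 \<le> Im (csqrt m)"
    "0 < Im m \<Longrightarrow> 0 < Re (csqrt m)" "0 < Im m \<Longrightarrow> 0 < Im (csqrt m)"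
proof -
  define q where "q = csqrt m"
  have "q\<^sup>2 = m" by (simp add: q_def)
  then have im: "Im m = 2 * Re q * Im q" by (auto simp: power2_eq_square)
  have pr: "0 < Re q \<or> Re q = 0 \<and> 0 \<le> Im q"
    unfolding q_def by (rule csqrt_principal)
  then have q: "0 \<le> Re q" "0 \<le> Im q"
    using im assms by (auto simp: zero_le_mult_iff)
  moreover have "0 < Re q" "0 < Im q" if "0 < Im m"
    using im that q by (auto simp: zero_less_mult_iff)
  ultimately show "0 \<le> Re (csqrt m)" "0 \<le> Im (csqrt m)"
    "0 < Im m \<Longrightarrow> 0 < Re (csqrt m)" "0 < Im m \<Longrightarrow> 0 < Im (csqrt m)"
    by (simp_all only: q_def)
qed

text \<open>This Moebius map takes the first quadrant into the right half of the disk. The last two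
  facts together give |v - \<i>| at most 2 / |q|, needed where the root tends to infinity.\<close>

lemma half_disk_map:
  assumes q: "0 \<le> Re q" "0 \<le> Im q"
  defines "v \<equiv> (q - \<i>) / (- \<i> * q + 1)"
  shows "- \<i> * q + 1 \<noteq> 0" "0 \<le> Re v" "cmod v \<le> 1"
    "0 < Re q \<Longrightarrow> 0 < Re v" "0 < Im q \<Longrightarrow> cmod v < 1"
    "v - \<i> = - 2 * \<i> / (- \<i> * q + 1)" "cmod q \<le> cmod (- \<i> * q + 1)"
proof -
  have d: "(cmod (- \<i> * q + 1))\<^sup>2 = (Re q)\<^sup>2 + (1 + Im q)\<^sup>2"
    unfolding cmod_power2 by simp
  have n: "(cmod (q - \<i>))\<^sup>2 = (Re q)\<^sup>2 + (Im q - 1)\<^sup>2"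
    by (simp add: cmod_power2)
  have "0 < (Re q)\<^sup>2 + (1 + Im q)\<^sup>2"
    using q by (intro add_nonneg_pos) auto
  then show nz: "- \<i> * q + 1 \<noteq> 0"
    using d by force
  have "Re v = 2 * Re q / (cmod (- \<i> * q + 1))\<^sup>2"
    unfolding v_def Re_divide d by (simp add: power2_eq_square algebra_simps)
  moreover have pos: "0 < (cmod (- \<i> * q + 1))\<^sup>2" using nz by simp
  ultimately show "0 \<le> Re v" "0 < Re q \<Longrightarrow> 0 < Re v"
    using q by (simp_all del: zero_less_power_eq_numeral)
  have "cmod (q - \<i>) \<le> cmod (- \<i> * q + 1)"
    by (rule power2_le_imp_le, unfold d n) (use q in \<open>auto simp: power2_eq_square algebra_simps\<close>)
  then show "cmod v \<le> 1"
    using nz by (simp add: v_def norm_divide)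
  show "cmod v < 1" if "0 < Im q"
  proof -
    have "cmod (q - \<i>) < cmod (- \<i> * q + 1)"
      by (rule power2_less_imp_less, unfold d n) (use q that in \<open>auto simp: power2_eq_square algebra_simps\<close>)
    then show ?thesis
      using nz by (simp add: v_def norm_divide)
  qed
  show "v - \<i> = - 2 * \<i> / (- \<i> * q + 1)"
    using nz by (simp add: v_def field_simps)
  show "cmod q \<le> cmod (- \<i> * q + 1)"
    by (rule power2_le_imp_le, unfold d cmod_power2[of q]) (use q in \<open>auto simp: power2_eq_square algebra_simps\<close>)
qed

lemma half_plane_map:
  assumes z: "cmod z \<le> 1" "z \<noteq> - \<i>"
  defines "m \<equiv> (z - \<i>) / (\<i> * z - 1)"
  shows "\<i> * z - 1 \<noteq> 0" "0 \<le> Im m" "cmod z < 1 \<Longrightarrow> 0 < Im m" "cmod m = cmod (z - \<i>) / cmod (z + \<i>)"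
proof -
  have eq: "\<i> * z - 1 = \<i> * (z + \<i>)" by (simp add: algebra_simps)
  show nz: "\<i> * z - 1 \<noteq> 0"
    unfolding eq using z by (simp add: add_eq_0_iff2)
  have "Im m = (1 - (cmod z)\<^sup>2) / (cmod (\<i> * z - 1))\<^sup>2"
    unfolding m_def Im_divide cmod_power2 by (simp add: power2_eq_square algebra_simps)
  moreover have pos: "0 < (cmod (\<i> * z - 1))\<^sup>2" using nz by simp
  ultimately show "0 \<le> Im m" "cmod z < 1 \<Longrightarrow> 0 < Im m"
    using z by (simp_all add: abs_square_le_1 abs_square_less_1 del: zero_less_power_eq_numeral)
  show "cmod m = cmod (z - \<i>) / cmod (z + \<i>)"
    unfolding m_def eq by (simp add: norm_divide norm_mult)
qed

text \<open>The Moebius map inside \<open>cusp_0\<close> has its pole at \<open>- \<i>\<close>. At all other points of the closed disk its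
  value has nonnegative imaginary part, where the principal square root is continuous even across
  the negative real axis.\<close>

definition cusp_0_ext :: "complex \<Rightarrow> complex"
  where "cusp_0_ext z = (if z = - \<i> then \<i> else cusp_0 z)"

text \<open>Zeros are traced back through the chain: the value 0 means that the root is \<i>, that
  the quotient is -1, and that z = 1. The last bound serves continuity at \<open>- \<i>\<close>,
  where the root tends to infinity.\<close>

lemma cusp_0_bounds:
  assumes z: "cmod z \<le> 1" "z \<noteq> - \<i>"
  shows "0 \<le> Re (cusp_0 z)" "cmod (cusp_0 z) \<le> 1" "cusp_0 z = 0 \<longleftrightarrow> z = 1"
    "cmod z < 1 \<Longrightarrow> 0 < Re (cusp_0 z)" "cmod z < 1 \<Longrightarrow> cmod (cusp_0 z) < 1"
    "z \<noteq> \<i> \<Longrightarrow> cmod (cusp_0 z - \<i>) \<le> 2 * sqrt (cmod (z + \<i>) / cmod (z - \<i>))"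
proof -
  define m where "m = (z - \<i>) / (\<i> * z - 1)"
  define q where "q = csqrt m"
  note hp = half_plane_map[OF z, folded m_def]
  note cs = csqrt_upper[OF hp(2), folded q_def]
  note hd = half_disk_map[OF cs(1,2)]
  have c0: "cusp_0 z = (q - \<i>) / (- \<i> * q + 1)"
    by (simp add: cusp_0_def q_def m_def)
  show "0 \<le> Re (cusp_0 z)" "cmod (cusp_0 z) \<le> 1"
    "cmod z < 1 \<Longrightarrow> 0 < Re (cusp_0 z)" "cmod z < 1 \<Longrightarrow> cmod (cusp_0 z) < 1"
    using hd hp cs by (auto simp: c0)
  have "cusp_0 z = 0 \<longleftrightarrow> q = \<i>"
    using hd(1) by (simp add: c0)
  also have "\<dots> \<longleftrightarrow> m = - 1"
  proof
    assume "q = \<i>"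
    then have "q\<^sup>2 = - 1" by simp
    then show "m = - 1" by (simp add: q_def)
  qed (simp add: q_def)
  also have "\<dots> \<longleftrightarrow> z - \<i> = 1 - \<i> * z"
    using hp(1) by (auto simp: m_def divide_eq_eq)
  also have "\<dots> \<longleftrightarrow> (1 + \<i>) * (z - 1) = 0"
    by (auto simp: algebra_simps)
  also have "\<dots> \<longleftrightarrow> z = 1"
    by (auto simp: complex_eq_iff)
  finally show "cusp_0 z = 0 \<longleftrightarrow> z = 1" .
  show "cmod (cusp_0 z - \<i>) \<le> 2 * sqrt (cmod (z + \<i>) / cmod (z - \<i>))" if "z \<noteq> \<i>"
  proof -
    have q0: "q \<noteq> 0"
      using that hp(1) by (simp add: q_def m_def)
    have "cmod (cusp_0 z - \<i>) = 2 / cmod (- \<i> * q + 1)"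
      unfolding c0 hd(6) by (simp add: norm_divide norm_mult)
    also have "\<dots> \<le> 2 / cmod q"
      using hd(1,7) q0 by (intro divide_left_mono mult_pos_pos) (auto simp del: minus_mult_left)
    also have "cmod q = sqrt (cmod (z - \<i>) / cmod (z + \<i>))"
      by (simp add: q_def hp(4))
    finally show ?thesis by (simp add: real_sqrt_divide)
  qed
qed

lemma continuous_on_cusp_0_ext: "continuous_on (cball 0 1) cusp_0_ext"
proof (rule continuous_on_insert_limit[of _ "- \<i>"])
  have "continuous_on (cball 0 1 - {- \<i>}) cusp_0"
  proof -
    have "continuous_on (cball 0 1 - {- \<i>}) (\<lambda>z. csqrt ((z - \<i>) / (\<i> * z - 1)))"
      by (rule continuous_on_compose2[OF continuous_on_csqrt_upper])
        (use half_plane_map in \<open>auto intro!: continuous_intros\<close>)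
    moreover have "- \<i> * csqrt ((z - \<i>) / (\<i> * z - 1)) + 1 \<noteq> 0" if "z \<in> cball 0 1 - {- \<i>}" for z
      using that by (intro half_disk_map(1) csqrt_upper(1,2) half_plane_map(2)) auto
    ultimately show ?thesis
      unfolding cusp_0_def by (intro continuous_intros) blast+
  qed
  then show "continuous_on (cball 0 1 - {- \<i>}) cusp_0_ext"
    by (rule continuous_on_eq) (simp add: cusp_0_ext_def)
  have "((\<lambda>z. 2 * sqrt (cmod (z + \<i>) / cmod (z - \<i>))) \<longlongrightarrow>
      2 * sqrt (cmod (- \<i> + \<i>) / cmod (- \<i> - \<i>))) (at (- \<i>) within cball 0 1)"
    by (intro tendsto_intros) auto
  then have lim: "((\<lambda>z. 2 * sqrt (cmod (z + \<i>) / cmod (z - \<i>))) \<longlongrightarrow> 0) (at (- \<i>) within cball 0 1)"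
    by simp
  have "((\<lambda>z. cusp_0_ext z - \<i>) \<longlongrightarrow> 0) (at (- \<i>) within cball 0 1)"
  proof (rule Lim_null_comparison[OF _ lim])
    show "\<forall>\<^sub>F z in at (- \<i>) within cball 0 1. cmod (cusp_0_ext z - \<i>) \<le> 2 * sqrt (cmod (z + \<i>) / cmod (z - \<i>))"
      unfolding eventually_at
    proof (intro exI[of _ 1] conjI ballI impI)
      fix z assume z: "z \<in> cball 0 1" "z \<noteq> - \<i> \<and> dist z (- \<i>) < 1"
      have "dist \<i> (- \<i>) = 2" by (simp add: dist_norm)
      then have "z \<noteq> \<i>" using z by auto
      then show "cmod (cusp_0_ext z - \<i>) \<le> 2 * sqrt (cmod (z + \<i>) / cmod (z - \<i>))"
        using z cusp_0_bounds(6)[of z] by (simp add: cusp_0_ext_def)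
    qed simp
  qed
  moreover have "cusp_0_ext (- \<i>) = \<i>" by (simp add: cusp_0_ext_def)
  ultimately show "(cusp_0_ext \<longlongrightarrow> cusp_0_ext (- \<i>)) (at (- \<i>) within cball 0 1)"
    by (simp only: LIM_zero_cancel)
qed

lemma cusp_0_ext_bounds:
  assumes z: "cmod z \<le> 1"
  shows "0 \<le> Re (cusp_0_ext z)" "cmod (cusp_0_ext z) \<le> 1" "cusp_0_ext z = 0 \<longleftrightarrow> z = 1"
  using cusp_0_bounds[OF z] by (auto simp: cusp_0_ext_def complex_eq_iff)

definition cusp_2_ext :: "complex \<Rightarrow> complex"
  where "cusp_2_ext z = - (2 / of_real pi) * Ln (cusp_0_ext z) + 1"

lemma Re_cusp_2_ext:
  assumes "cmod z \<le> 1" "z \<noteq> 1"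
  shows "Re (cusp_2_ext z) = 1 - 2 / pi * ln (cmod (cusp_0_ext z))" "1 \<le> Re (cusp_2_ext z)"
proof -
  have nz: "cusp_0_ext z \<noteq> 0" using cusp_0_ext_bounds(3)[of z] assms by simp
  have eq: "cusp_2_ext z = 1 - of_real (2 / pi) * Ln (cusp_0_ext z)"
    by (simp add: cusp_2_ext_def)
  show re: "Re (cusp_2_ext z) = 1 - 2 / pi * ln (cmod (cusp_0_ext z))"
    unfolding eq using nz by (simp del: of_real_divide)
  have "ln (cmod (cusp_0_ext z)) \<le> 0"
    using nz cusp_0_ext_bounds(2)[OF assms(1)] by simp
  then show "1 \<le> Re (cusp_2_ext z)"
    unfolding re by (simp add: divide_nonpos_pos mult_nonneg_nonpos)
qed

definition cusp_ext :: "complex \<Rightarrow> complex"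
  where "cusp_ext z = (if z = 1 then 1 else 1 - 1 / cusp_2_ext z)"

text \<open>At 1 the modulus of \<open>cusp_0_ext\<close> tends to 0, so the real part of
  \<open>cusp_2_ext\<close> tends to infinity like a multiple of minus its logarithm, and |cusp_ext
  z - 1| is at most the reciprocal of that real part.\<close>

lemma continuous_on_cusp_ext: "continuous_on (cball 0 1) cusp_ext"
proof (rule continuous_on_insert_limit[of _ 1])
  have "continuous_on (cball 0 1 - {1}) (\<lambda>z. 1 - 1 / cusp_2_ext z)"
  proof -
    have "cusp_0_ext z \<notin> \<real>\<^sub>\<le>\<^sub>0" if "z \<in> cball 0 1 - {1}" for z
      using cusp_0_ext_bounds[of z] that by (auto simp: complex_nonpos_Reals_iff complex_eq_iff)
    moreover have "cusp_2_ext z \<noteq> 0" if "z \<in> cball 0 1 - {1}" for z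
      using Re_cusp_2_ext(2)[of z] that by force
    moreover have "continuous_on (cball 0 1 - {1}) cusp_0_ext"
      by (rule continuous_on_subset[OF continuous_on_cusp_0_ext]) auto
    ultimately show ?thesis
      by (intro continuous_intros) (auto simp: cusp_2_ext_def[abs_def] intro!: continuous_intros)
  qed
  then show "continuous_on (cball 0 1 - {1}) cusp_ext"
    by (rule continuous_on_eq) (simp add: cusp_ext_def)
  have "(cusp_0_ext \<longlongrightarrow> cusp_0_ext 1) (at 1 within cball 0 1)"
    using continuous_on_cusp_0_ext by (simp add: continuous_on_def)
  then have "((\<lambda>z. cmod (cusp_0_ext z)) \<longlongrightarrow> 0) (at 1 within cball 0 1)"
    using cusp_0_ext_bounds(3)[of 1] by (simp add: tendsto_norm_zero)
  then have "filterlim (\<lambda>z. cmod (cusp_0_ext z)) (at_right 0) (at 1 within cball 0 1)"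
    by (rule tendsto_imp_filterlim_at_right)
      (use cusp_0_ext_bounds(3) in \<open>auto simp: eventually_at_filter\<close>)
  moreover have "((\<lambda>x. 1 / (1 - 2 / pi * ln x)) \<longlongrightarrow> 0) (at_right (0::real))"
    by real_asymp
  ultimately have lim: "((\<lambda>z. 1 / (1 - 2 / pi * ln (cmod (cusp_0_ext z)))) \<longlongrightarrow> 0) (at 1 within cball 0 1)"
    by (rule filterlim_compose[rotated])
  have "((\<lambda>z. cusp_ext z - 1) \<longlongrightarrow> 0) (at 1 within cball 0 1)"
  proof (rule Lim_null_comparison[OF _ lim])
    have "cmod (cusp_ext z - 1) \<le> 1 / (1 - 2 / pi * ln (cmod (cusp_0_ext z)))" if "z \<noteq> 1" "cmod z \<le> 1" for z
    proof -
      note re = Re_cusp_2_ext[OF that(2,1)]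
      have "cmod (cusp_ext z - 1) = 1 / cmod (cusp_2_ext z)"
        using that by (simp add: cusp_ext_def norm_divide)
      also have "\<dots> \<le> 1 / Re (cusp_2_ext z)"
        using re(2) complex_Re_le_cmod[of "cusp_2_ext z"] by (intro divide_left_mono mult_pos_pos) linarith+
      finally show ?thesis by (simp add: re(1))
    qed
    then show "\<forall>\<^sub>F z in at 1 within cball 0 1. cmod (cusp_ext z - 1) \<le> 1 / (1 - 2 / pi * ln (cmod (cusp_0_ext z)))"
      by (auto simp: eventually_at_filter)
  qed
  moreover have "cusp_ext 1 = 1" by (simp add: cusp_ext_def)
  ultimately show "(cusp_ext \<longlongrightarrow> cusp_ext 1) (at 1 within cball 0 1)"
    by (simp only: LIM_zero_cancel)
qed

section \<open>Estimates for the cusp map and for \<open>phi\<close> near the boundary point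
  1\<close>

lemma cusp_2_strip:
  assumes z: "z \<in> ball 0 1"
  shows "1 < Re (cusp_2 z)" "\<bar>Im (cusp_2 z)\<bar> < 1"
proof -
  have zi: "cmod z \<le> 1" "z \<noteq> - \<i>" "cmod z < 1" using z by auto
  note b = cusp_0_bounds[OF zi(1,2)]
  have nz: "cusp_0 z \<noteq> 0" using b(3) z by auto
  have eq: "cusp_2 z = 1 - of_real (2 / pi) * Ln (cusp_0 z)"
    by (simp add: cusp_2_def cusp_1_def)
  \<comment> \<open>\<open>cusp_0\<close> takes values in the right half disk, so its logarithm has
    negative real part and imaginary part of modulus below pi / 2; the factor 2 / pi normalises the
    strip.\<close>
  have "ln (cmod (cusp_0 z)) < 0"
    using nz b(5)[OF zi(3)] by simp
  then show "1 < Re (cusp_2 z)"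
    unfolding eq using nz by (simp add: divide_neg_pos del: of_real_divide)
  have "\<bar>Im (Ln (cusp_0 z))\<bar> < pi / 2"
    using b(4)[OF zi(3)] by (rule Re_Ln_pos_lt_imp)
  then show "\<bar>Im (cusp_2 z)\<bar> < 1"
    unfolding eq by (simp add: abs_mult field_simps del: of_real_divide)
qed

lemma holomorphic_cusp_2: "cusp_2 holomorphic_on ball 0 1"
proof -
  have bd: "cmod z \<le> 1" "z \<noteq> - \<i>" "cmod z < 1" if "z \<in> ball 0 1" for z using that by auto
  have m: "(\<lambda>z. (z - \<i>) / (\<i> * z - 1)) holomorphic_on ball 0 1"
    using half_plane_map(1) bd by (intro holomorphic_intros) blast
  have q: "(\<lambda>z. csqrt ((z - \<i>) / (\<i> * z - 1))) holomorphic_on ball 0 1"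
  proof (rule holomorphic_on_csqrt'[OF m])
    fix z :: complex assume "z \<in> ball 0 1"
    then show "(z - \<i>) / (\<i> * z - 1) \<notin> \<real>\<^sub>\<le>\<^sub>0"
      using half_plane_map(3) bd by (force simp: complex_nonpos_Reals_iff)
  qed
  have c0: "cusp_0 holomorphic_on ball 0 1"
    unfolding cusp_0_def[abs_def]
    by (intro holomorphic_intros q half_disk_map(1) csqrt_upper(1,2) half_plane_map(2) bd)
  show ?thesis
    unfolding cusp_2_def[abs_def] cusp_1_def[abs_def]
  proof (intro holomorphic_intros c0)
    fix z :: complex assume "z \<in> ball 0 1"
    then show "cusp_0 z \<notin> \<real>\<^sub>\<le>\<^sub>0"
      using cusp_0_bounds(4)[of z] bd[of z] by (auto simp: complex_nonpos_Reals_iff)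
  qed
qed

lemma cusp_map_ball:
  assumes "z \<in> ball 0 1"
  shows "cusp_map z = 1 - 1 / cusp_2 z"
  using assms by (simp add: cusp_map_def cusp_3_def)

lemma cusp_map_eq_ext:
  assumes z: "z \<in> cball 0 1"
  shows "cusp_map z = cusp_ext z"
proof -
  have ball: "1 - cusp_3 w = cusp_ext w" if "w \<in> ball 0 1" for w
  proof -
    have "w \<noteq> 1" "w \<noteq> - \<i>" using that by auto
    then show ?thesis
      by (simp add: cusp_ext_def cusp_2_ext_def cusp_0_ext_def cusp_3_def cusp_2_def cusp_1_def)
  qed
  show ?thesis
  proof (cases "z \<in> ball 0 1")
    case True
    then show ?thesis using ball by (simp add: cusp_map_def)
  next
    case False
    have "(cusp_ext \<longlongrightarrow> cusp_ext z) (at z within cball 0 1)"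
      using continuous_on_cusp_ext z by (simp add: continuous_on_def)
    then have "(cusp_ext \<longlongrightarrow> cusp_ext z) (at z within ball 0 1)"
      by (rule tendsto_within_subset) auto
    then have "((\<lambda>w. 1 - cusp_3 w) \<longlongrightarrow> cusp_ext z) (at z within ball 0 1)"
      by (rule Lim_transform_eventually) (auto simp: eventually_at_filter ball[symmetric])
    \<comment> \<open>\<open>Lim\<close> is a definite description, and nontriviality of the filter
      makes the limit just found its unique value.\<close>
    moreover have "\<not> trivial_limit (at z within ball 0 1)"
      using z by (simp add: trivial_limit_within islimpt_ball)
    ultimately show ?thesis
      using False by (simp add: cusp_map_def tendsto_Lim)
  qed
qed

lemma continuous_on_cusp_map: "continuous_on (cball 0 1) cusp_map"
  using continuous_on_cusp_ext by (rule continuous_on_eq) (simp add: cusp_map_eq_ext)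

lemma cusp_map_1: "cusp_map 1 = 1"
  by (simp add: cusp_map_eq_ext cusp_ext_def)

lemma holomorphic_cusp_map: "cusp_map holomorphic_on ball 0 1"
proof -
  have "(\<lambda>z. 1 - 1 / cusp_2 z) holomorphic_on ball 0 1"
    by (intro holomorphic_intros holomorphic_cusp_2) (use cusp_2_strip in force)
  then show ?thesis
    by (rule holomorphic_transform) (simp add: cusp_map_ball)
qed

text \<open>With w = \<open>cusp_2 z\<close> and x = Re w one has 1 - |1 - 1/w|^2 = (2 x - 1) /
  |w|^2. As |w|^2 is at most x^2 + 1 in the strip, the distance to the circle shrinks no faster than
  1 / x.\<close>

lemma cusp_map_modulus:
  assumes z: "z \<in> ball 0 1"
  shows "1 / (4 * Re (cusp_2 z)) \<le> 1 - cmod (cusp_map z)" "cmod (cusp_map z) < 1"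
    "cmod (1 - cusp_map z) = 1 / cmod (cusp_2 z)"
proof -
  define w where "w = cusp_2 z"
  define x where "x = Re w"
  have x: "1 < x" and y: "\<bar>Im w\<bar> < 1" using cusp_2_strip[OF z] by (auto simp: x_def w_def)
  have nz: "w \<noteq> 0" using x by (auto simp: x_def)
  let ?u = "cusp_map z"
  have "?u = (w - 1) / w"
    using nz by (simp add: cusp_map_ball[OF z] w_def field_simps)
  then have u: "(cmod ?u)\<^sup>2 = (cmod (w - 1))\<^sup>2 / (cmod w)\<^sup>2"
    by (simp only: norm_divide power_divide)
  have w2: "(cmod w)\<^sup>2 \<le> x\<^sup>2 + 1"
    using y by (simp add: cmod_power2 x_def abs_square_le_1)
  have pos: "0 < (cmod w)\<^sup>2" using nz by simp
  have "1 - (cmod ?u)\<^sup>2 = ((cmod w)\<^sup>2 - (cmod (w - 1))\<^sup>2) / (cmod w)\<^sup>2"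
    using nz by (simp add: u diff_divide_distrib)
  also have "(cmod w)\<^sup>2 - (cmod (w - 1))\<^sup>2 = 2 * x - 1"
    unfolding cmod_power2 x_def by (simp add: power2_eq_square algebra_simps)
  finally have "1 - (cmod ?u)\<^sup>2 = (2 * x - 1) / (cmod w)\<^sup>2" .
  moreover have "1 / (2 * x) \<le> (2 * x - 1) / (x\<^sup>2 + 1)"
  proof -
    \<comment> \<open>The product is 2 x (2 x - 1) - (x^2 + 1).\<close>
    have "0 \<le> (3 * x + 1) * (x - 1)" using x by simp
    then have "x\<^sup>2 + 1 \<le> (2 * x - 1) * (2 * x)" by (simp add: power2_eq_square algebra_simps)
    then show ?thesis
      using x by (simp add: divide_le_eq pos_le_divide_eq add_pos_nonneg)
  qed
  moreover have "(2 * x - 1) / (x\<^sup>2 + 1) \<le> (2 * x - 1) / (cmod w)\<^sup>2"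
    using x w2 pos by (intro divide_left_mono mult_pos_pos add_nonneg_pos) auto
  ultimately have a: "1 / (2 * x) \<le> 1 - (cmod ?u)\<^sup>2" by linarith
  have "0 < 1 / (2 * x)" using x by simp
  then have "(cmod ?u)\<^sup>2 < 1" using a by linarith
  then show lt: "cmod ?u < 1" by (simp add: abs_square_less_1)
  have "1 - (cmod ?u)\<^sup>2 = (1 + cmod ?u) * (1 - cmod ?u)"
    by (simp add: power2_eq_square algebra_simps)
  also have "\<dots> \<le> 2 * (1 - cmod ?u)"
    using lt by (intro mult_right_mono) auto
  finally have "1 / (2 * x) \<le> 2 * (1 - cmod ?u)"
    by (rule order_trans[OF a])
  from mult_left_mono[OF this, of "1 / 2"] have "1 / (4 * x) \<le> 1 - cmod ?u"
    by simp
  then show "1 / (4 * Re (cusp_2 z)) \<le> 1 - cmod ?u"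
    by (simp add: x_def w_def)
  show "cmod (1 - ?u) = 1 / cmod (cusp_2 z)"
    by (simp add: cusp_map_ball[OF z] norm_divide)
qed

lemma cusp_map_cball: "z \<in> cball 0 1 \<Longrightarrow> cmod (cusp_map z) \<le> 1"
  by (rule continuous_on_closure_norm_le[of "ball 0 1" cusp_map])
    (use continuous_on_cusp_map cusp_map_modulus(2) in \<open>auto simp: less_imp_le\<close>)

text \<open>1 - u has nonnegative real part, hence argument at most pi / 2 in modulus, and its power
  - \<theta> has argument at most \<theta> pi / 2. The cosine of that angle is positive by
  \<open>cos_half_pi_pos\<close>.\<close>

lemma norm_phi_le:
  assumes \<theta>: "0 < \<theta>" "\<theta> < 1" and u: "cmod u \<le> 1" "u \<noteq> 1"
  shows "cmod (phi \<theta> u) \<le> exp (- (cos (\<theta> * pi / 2) * cmod (1 - u) powr (- \<theta>)))"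
proof -
  define v where "v = 1 - u"
  have v: "v \<noteq> 0" "0 \<le> Re v"
    using u complex_Re_le_cmod[of u] by (auto simp: v_def)
  have Im: "\<bar>Im (Ln v)\<bar> \<le> pi / 2"
    using v Re_Ln_pos_le by blast
  have "Re (v powr (- of_real \<theta>)) = cmod v powr (- \<theta>) * cos (\<theta> * Im (Ln v))"
    using v by (simp add: powr_def Re_exp)
  moreover have "cos (\<theta> * pi / 2) \<le> cos (\<theta> * Im (Ln v))"
  proof -
    have "cos (\<theta> * pi / 2) \<le> cos (\<theta> * \<bar>Im (Ln v)\<bar>)"
    proof (rule cos_monotone_0_pi_le)
      show "\<theta> * \<bar>Im (Ln v)\<bar> \<le> \<theta> * pi / 2"
        using mult_left_mono[OF Im, of \<theta>] \<theta> by simp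
      have "\<theta> * pi \<le> 1 * pi" using \<theta> by (intro mult_right_mono) auto
      then show "\<theta> * pi / 2 \<le> pi" by (simp add: pi_ge_zero)
    qed (use \<theta> in auto)
    then show ?thesis
      by (cases "Im (Ln v) \<ge> 0") auto
  qed
  ultimately have "cos (\<theta> * pi / 2) * cmod v powr (- \<theta>) \<le> Re (v powr (- of_real \<theta>))"
    by (simp add: mult.commute mult_left_mono)
  then show ?thesis
    using u by (simp add: phi_def flip: v_def)
qed

lemma cos_half_pi_pos:
  assumes \<theta>: "0 < \<theta>" "\<theta> < 1"
  shows "0 < cos (\<theta> * pi / 2)"
proof (rule cos_gt_zero)
  have "\<theta> * pi < 1 * pi" using \<theta> by (intro mult_strict_right_mono) auto
  then show "\<theta> * pi / 2 < pi / 2" by simp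
qed (use \<theta> in auto)

lemma continuous_on_phi:
  assumes \<theta>: "0 < \<theta>" "\<theta> < 1"
  shows "continuous_on (cball 0 1) (phi \<theta>)"
proof (rule continuous_on_insert_limit[of _ 1])
  have nr: "1 - u \<notin> \<real>\<^sub>\<le>\<^sub>0" if "u \<in> cball 0 1 - {1}" for u :: complex
  proof
    assume "1 - u \<in> \<real>\<^sub>\<le>\<^sub>0"
    then have "Re (1 - u) \<le> 0" "Im (1 - u) = 0" by (auto simp: complex_nonpos_Reals_iff)
    moreover have "Re u \<le> 1" using that complex_Re_le_cmod[of u] by simp
    ultimately have "u = 1" by (simp add: complex_eq_iff)
    then show False using that by simp
  qed
  have "continuous_on (cball 0 1 - {1}) (\<lambda>z::complex. exp (- ((1 - z) powr (- of_real \<theta>))))"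
    by (intro continuous_intros continuous_on_powr_complex) (use nr in \<open>auto simp: complex_nonpos_Reals_iff\<close>)
  then show "continuous_on (cball 0 1 - {1}) (phi \<theta>)"
    by (rule continuous_on_eq) (simp add: phi_def)
  have "((\<lambda>u. cmod (1 - u)) \<longlongrightarrow> cmod (1 - 1)) (at 1 within cball 0 1)"
    by (intro tendsto_intros)
  then have "((\<lambda>u. cmod (1 - u)) \<longlongrightarrow> 0) (at 1 within cball 0 1)"
    by simp
  then have "filterlim (\<lambda>u. cmod (1 - u)) (at_right 0) (at 1 within cball 0 1)"
    by (rule tendsto_imp_filterlim_at_right) (auto simp: eventually_at_filter)
  moreover have "((\<lambda>x. exp (- (cos (\<theta> * pi / 2) * x powr (- \<theta>)))) \<longlongrightarrow> 0) (at_right (0::real))"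
    using cos_half_pi_pos[OF \<theta>] \<theta> by real_asymp
  ultimately have lim: "((\<lambda>u. exp (- (cos (\<theta> * pi / 2) * cmod (1 - u) powr (- \<theta>)))) \<longlongrightarrow> 0) (at 1 within cball 0 1)"
    by (rule filterlim_compose[rotated])
  have "(phi \<theta> \<longlongrightarrow> 0) (at 1 within cball 0 1)"
    by (rule Lim_null_comparison[OF _ lim])
      (use norm_phi_le[OF \<theta>] in \<open>auto simp: eventually_at_filter\<close>)
  then show "(phi \<theta> \<longlongrightarrow> phi \<theta> 1) (at 1 within cball 0 1)"
    by (simp add: phi_def)
qed

lemma holomorphic_phi: "phi \<theta> holomorphic_on ball 0 1"
proof -
  have "1 - u \<notin> \<real>\<^sub>\<le>\<^sub>0" if "u \<in> ball 0 1" for u :: complex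
    using that complex_Re_le_cmod[of u] by (auto simp: complex_nonpos_Reals_iff)
  then have "(\<lambda>z. exp (- ((1 - z) powr (- of_real \<theta>)))) holomorphic_on ball 0 1"
    by (intro holomorphic_intros) auto
  then show ?thesis
    by (rule holomorphic_transform) (auto simp: phi_def)
qed

section \<open>Taylor coefficients along the diagonal\<close>

lemma norm_sums_split_le:
  fixes a :: "nat \<Rightarrow> complex"
  assumes sums: "a sums s" and head: "\<And>k. k < n \<Longrightarrow> cmod (a k) \<le> \<epsilon>"
    and tail: "\<And>k. n \<le> k \<Longrightarrow> cmod (a k) \<le> M * t ^ k" and t: "0 \<le> t" "t < 1"
  shows "cmod s \<le> real n * \<epsilon> + M * t ^ n / (1 - t)"
proof -
  have fin: "(\<lambda>k. if k \<in> {..<n} then a k else 0) sums (\<Sum>k<n. a k)"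
    by (rule sums_If_finite_set) simp
  have "cmod (s - (\<Sum>k<n. a k)) \<le> M * t ^ n / (1 - t)"
    by (rule norm_suminf_geometric_tail[OF sums_diff[OF sums fin] _ _ t]) (use tail in auto)
  moreover have "cmod (\<Sum>k<n. a k) \<le> real n * \<epsilon>"
    using sum_norm_le[of "{..<n}" a "\<lambda>_. \<epsilon>"] head by simp
  moreover have "cmod s \<le> cmod (\<Sum>k<n. a k) + cmod (s - (\<Sum>k<n. a k))"
    using norm_triangle_ineq[of "\<Sum>k<n. a k" "s - (\<Sum>k<n. a k)"] by simp
  ultimately show ?thesis by linarith
qed

text \<open>Up to the factor k! this is the k-th derivative of \<open>f\<close> in the second
  variable at the diagonal point (u, u).\<close>

definition diag_coeff :: "hardy2 \<Rightarrow> nat \<Rightarrow> complex \<Rightarrow> complex"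
  where "diag_coeff f k u = taylor_coeff (\<lambda>\<zeta>. hardy2_fun f (u, u + \<zeta>)) 0 k"

lemma holomorphic_diag_shift:
  assumes "cmod u < 1" "cmod u + r \<le> 1"
  shows "(\<lambda>\<zeta>. hardy2_fun f (u, u + \<zeta>)) holomorphic_on ball 0 r"
proof (rule holomorphic_on_hardy2_fun)
  fix t :: complex assume "t \<in> ball 0 r"
  then show "cmod u < 1 \<and> cmod (u + t) < 1"
    using assms norm_triangle_ineq[of u t] by auto
qed (auto intro!: holomorphic_intros)

lemma norm_hardy2_fun_diag_le:
  assumes b: "0 < b" and u: "cmod u + b \<le> 1" and v: "cmod v + b \<le> 1"
  shows "cmod (hardy2_fun f (u, v)) \<le> norm f / b"
proof -
  have "cmod (hardy2_fun f (u, v)) \<le> norm f / sqrt ((1 - cmod u) * (1 - cmod v))"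
    using assms by (intro norm_hardy2_fun_le) auto
  also have "\<dots> \<le> norm f / b"
  proof (rule divide_left_mono)
    have "b * b \<le> (1 - cmod u) * (1 - cmod v)"
      using assms by (intro mult_mono) auto
    then show "b \<le> sqrt ((1 - cmod u) * (1 - cmod v))"
      by (intro real_le_rsqrt) (simp add: power2_eq_square)
    then show "0 < sqrt ((1 - cmod u) * (1 - cmod v)) * b"
      using b by (intro mult_pos_pos) linarith+
  qed simp
  finally show ?thesis .
qed

text \<open>The distance to the circle is shared: \<open>r\<close> is the radius for Cauchy's
  estimate, \<open>b\<close> the reserve for point evaluations on that disk.\<close>

lemma norm_diag_coeff_le:
  assumes b: "0 < b" and r: "0 < r" and u: "cmod u + r + b \<le> 1"
  shows "cmod (diag_coeff f k u) * r ^ k \<le> norm f / b"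
  unfolding diag_coeff_def
proof (rule norm_taylor_coeff_le)
  show "(\<lambda>\<zeta>. hardy2_fun f (u, u + \<zeta>)) holomorphic_on ball 0 r"
    using assms by (intro holomorphic_diag_shift) auto
  fix w :: complex assume "w \<in> ball 0 r"
  then show "cmod (hardy2_fun f (u, u + w)) \<le> norm f / b"
    using assms norm_triangle_ineq[of u w] by (intro norm_hardy2_fun_diag_le b) auto
qed (rule r)

lemma holomorphic_diag_coeff: "diag_coeff f k holomorphic_on ball 0 1"
proof -
  have "diag_coeff f k field_differentiable (at u0)" if "u0 \<in> ball 0 1" for u0
  proof -
    define b where "b = (1 - cmod u0) / 3"
    have b: "0 < b" "cmod u0 = 1 - 3 * b" using that by (simp_all add: b_def field_simps)
    have near: "cmod u + 2 * b \<le> 1" if "u \<in> ball u0 b" for u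
      using that norm_triangle_ineq2[of u u0] b by (simp add: dist_norm norm_minus_commute)
    have "(\<lambda>u. taylor_coeff (\<lambda>\<zeta>. hardy2_fun f (u, u + \<zeta>)) 0 k) holomorphic_on ball u0 b"
    proof (rule holomorphic_taylor_coeff_param[where R = b and M = "norm f / b"])
      show "(\<lambda>\<zeta>. hardy2_fun f (u, u + \<zeta>)) holomorphic_on ball 0 b" if "u \<in> ball u0 b" for u
        using near[OF that] b by (intro holomorphic_diag_shift) auto
      have "cmod u < 1 \<and> cmod (u + \<zeta>) < 1" if "\<zeta> \<in> ball 0 b" "u \<in> ball u0 b" for u \<zeta>
        using near[OF that(2)] b that norm_triangle_ineq[of u \<zeta>] by auto
      then show "(\<lambda>u. hardy2_fun f (u, u + \<zeta>)) holomorphic_on ball u0 b" if "\<zeta> \<in> ball 0 b" for \<zeta>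
        using that by (intro holomorphic_on_hardy2_fun) (auto intro!: holomorphic_intros)
      show "cmod (hardy2_fun f (u, u + \<zeta>)) \<le> norm f / b" if "u \<in> ball u0 b" "\<zeta> \<in> ball 0 b" for u \<zeta>
        using near[OF that(1)] b that norm_triangle_ineq[of u \<zeta>]
        by (intro norm_hardy2_fun_diag_le) auto
    qed (use b in auto)
    then have "diag_coeff f k holomorphic_on ball u0 b"
      by (simp add: diag_coeff_def[abs_def])
    then show ?thesis
      using b by (intro holomorphic_on_imp_differentiable_at[of _ "ball u0 b"]) auto
  qed
  then show ?thesis
    by (simp add: holomorphic_on_def field_differentiable_at_within)
qed

text \<open>Two nested Cauchy estimates and a point evaluation, each taking one third of 1 - |u|.
  Linearity goes through \<open>taylor_coeff_cong\<close>, because the identities between the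
  functions \<open>diag_coeff\<close> are established on the open disk.\<close>

lemma bounded_functional_diag_coeff:
  assumes u: "cmod u < 1"
  shows "bounded_functional (\<lambda>f. taylor_coeff (diag_coeff f k) u i)"
  unfolding bounded_functional_def
proof (intro conjI allI)
  have hol: "(\<lambda>\<zeta>. hardy2_fun f (v, v + \<zeta>)) holomorphic_on ball 0 (1 - cmod v)" if "v \<in> ball 0 1" for f v
    using that by (intro holomorphic_diag_shift) auto
  have u': "u \<in> ball 0 1" using u by simp
  fix f g
  have "diag_coeff (f + g) k v = diag_coeff f k v + diag_coeff g k v" if v: "v \<in> ball 0 1" for v
    unfolding diag_coeff_def hardy2_fun_add
    by (rule taylor_coeff_add[OF hol[OF v] hol[OF v]]) (use v in auto)
  then have "taylor_coeff (diag_coeff (f + g) k) u i = taylor_coeff (\<lambda>v. diag_coeff f k v + diag_coeff g k v) u i"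
    by (rule taylor_coeff_cong[OF _ open_ball u'])
  then show "taylor_coeff (diag_coeff (f + g) k) u i = taylor_coeff (diag_coeff f k) u i + taylor_coeff (diag_coeff g k) u i"
    using taylor_coeff_add[OF holomorphic_diag_coeff holomorphic_diag_coeff open_ball u'] by simp
  fix c
  have "diag_coeff (c *\<^sub>C f) k v = c * diag_coeff f k v" if v: "v \<in> ball 0 1" for v
    unfolding diag_coeff_def hardy2_fun_scaleC
    by (rule taylor_coeff_cmult[OF hol[OF v]]) (use v in auto)
  then have "taylor_coeff (diag_coeff (c *\<^sub>C f) k) u i = taylor_coeff (\<lambda>v. c * diag_coeff f k v) u i"
    by (rule taylor_coeff_cong[OF _ open_ball u'])
  then show "taylor_coeff (diag_coeff (c *\<^sub>C f) k) u i = c * taylor_coeff (diag_coeff f k) u i"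
    using taylor_coeff_cmult[OF holomorphic_diag_coeff open_ball u'] by simp
next
  define b where "b = (1 - cmod u) / 3"
  have b: "0 < b" "cmod u = 1 - 3 * b" using u by (simp_all add: b_def field_simps)
  have "cmod (taylor_coeff (diag_coeff f k) u i) \<le> 1 / (b * b ^ k * b ^ i) * norm f" for f
  proof -
    have "cmod (taylor_coeff (diag_coeff f k) u i) * b ^ i \<le> norm f / b / b ^ k"
    proof (rule norm_taylor_coeff_le)
      have near: "cmod v + 2 * b \<le> 1" if "v \<in> ball u b" for v
        using that norm_triangle_ineq2[of v u] b by (simp add: dist_norm norm_minus_commute)
      then have "ball u b \<subseteq> ball 0 1" using b by force
      then show "diag_coeff f k holomorphic_on ball u b"
        by (rule holomorphic_on_subset[OF holomorphic_diag_coeff])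
      show "cmod (diag_coeff f k v) \<le> norm f / b / b ^ k" if "v \<in> ball u b" for v
        using norm_diag_coeff_le[of b b v f k] near[OF that] b by (simp add: field_simps)
    qed (rule b)
    then show ?thesis
      using b by (simp add: field_simps)
  qed
  then show "\<exists>C. \<forall>f. cmod (taylor_coeff (diag_coeff f k) u i) \<le> C * norm f"
    by blast
qed

section \<open>Growth estimates and the choice of the cutoff\<close>

lemma power_div_fact_le_exp: "0 \<le> x \<Longrightarrow> x ^ m / fact m \<le> exp (x::real)"
  using sum_le_suminf[OF summable_exp_generic[of x], of "{m}"]
  by (simp add: exp_def divide_inverse mult.commute)

text \<open>Some integer power of \<open>x powr \<theta>\<close> is at least x, and a single term of
  the exponential series dominates that power. The factor 8 anticipates Cauchy radii 1 / (8
  x).\<close>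

lemma exp_powr_dominates_linear:
  assumes \<theta>: "0 < \<theta>" and \<kappa>: "0 < (\<kappa>::real)"
  obtains B where "1 \<le> B" "\<And>x. 1 \<le> x \<Longrightarrow> 8 * x \<le> B * exp (\<kappa> * x powr \<theta>)"
proof -
  define m where "m = nat \<lceil>1 / \<theta>\<rceil>"
  have m: "1 \<le> \<theta> * real m"
  proof -
    have "1 / \<theta> \<le> real m" unfolding m_def by linarith
    then show ?thesis using \<theta> by (simp add: divide_le_eq mult.commute)
  qed
  define B where "B = max 1 (8 * fact m / \<kappa> ^ m)"
  have "8 * x \<le> B * exp (\<kappa> * x powr \<theta>)" if x: "1 \<le> x" for x
  proof -
    have "x powr 1 \<le> x powr (\<theta> * real m)"
      using x m by (intro powr_mono) auto
    also have "\<dots> = (x powr \<theta>) ^ m"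
      using x by (simp add: powr_powr[symmetric] powr_realpow)
    finally have "x \<le> (x powr \<theta>) ^ m" using x by simp
    then have "\<kappa> ^ m * x \<le> (\<kappa> * x powr \<theta>) ^ m"
      using \<kappa> by (simp add: power_mult_distrib)
    also have "\<dots> \<le> fact m * exp (\<kappa> * x powr \<theta>)"
    proof -
      have "(\<kappa> * x powr \<theta>) ^ m / fact m \<le> exp (\<kappa> * x powr \<theta>)"
        using \<kappa> by (intro power_div_fact_le_exp) simp
      then show ?thesis by (simp add: divide_le_eq mult.commute)
    qed
    finally have "8 * x \<le> 8 * fact m / \<kappa> ^ m * exp (\<kappa> * x powr \<theta>)"
      using \<kappa> by (simp add: field_simps)
    also have "\<dots> \<le> B * exp (\<kappa> * x powr \<theta>)"
      by (intro mult_right_mono) (auto simp: B_def)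
    finally show ?thesis .
  qed
  moreover have "1 \<le> B" by (simp add: B_def)
  ultimately show thesis by (rule that[rotated])
qed

lemma sum_inverse_sqrt_le: "(\<Sum>k<Suc n. if k = 0 then 0 else 1 / sqrt (real k)) \<le> 2 * sqrt (real n)"
proof (induction n)
  case (Suc n)
  have "1 / sqrt (real (Suc n)) \<le> 2 * (sqrt (real (Suc n)) - sqrt (real n))"
  proof -
    define a b where "a = sqrt (real (Suc n))" and "b = sqrt (real n)"
    have ab: "0 < a" "0 \<le> b" "b \<le> a" "a * a - b * b = 1" by (auto simp: a_def b_def)
    have "0 \<le> (a - b) * (a - b)" by simp
    then have "1 \<le> 2 * (a - b) * a" using ab(4) by (simp add: algebra_simps)
    then have "1 / a \<le> 2 * (a - b)" using ab(1) by (simp add: divide_le_eq)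
    then show ?thesis by (simp only: a_def b_def)
  qed
  then show ?case using Suc by simp
qed simp

text \<open>Half of the exponent pays for the factor \<open>8 * x\<close>; the other half provides
  the decay in \<open>n\<close>.\<close>

lemma decay_cutoff:
  assumes \<theta>: "0 < \<theta>" and \<kappa>: "0 < (\<kappa>::real)"
  obtains L where "0 < L" "\<And>n k x. 0 < k \<Longrightarrow> k \<le> n \<Longrightarrow> 3 ^ nat \<lceil>L * sqrt (real n / real k)\<rceil> \<le> x \<Longrightarrow>
    (8 * x * exp (- (\<kappa> * x powr \<theta>))) ^ k \<le> (1 / 4) ^ n"
proof -
  obtain B where B: "1 \<le> B" and lin: "\<And>x. 1 \<le> x \<Longrightarrow> 8 * x \<le> B * exp (\<kappa> / 2 * x powr \<theta>)"
    using exp_powr_dominates_linear[OF \<theta>, of "\<kappa> / 2"] \<kappa> by auto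
  define b where "b = ln B"
  have b: "0 \<le> b" "B = exp b" using B by (auto simp: b_def)
  \<comment> \<open>Chosen to make the second half of the exponent at least (b + 2) n / k. After
    taking k-th powers, b compensates B^k because k is at most n, and 2 leaves exp (- 2 n), which is
    below 4^-n.\<close>
  define L where "L = sqrt (4 * (b + 2) / (\<kappa> * \<theta>\<^sup>2))"
  have L2: "\<kappa> * \<theta>\<^sup>2 * L\<^sup>2 / 4 = b + 2"
    using \<theta> \<kappa> b by (simp add: L_def field_simps)
  have L: "0 < L" using \<theta> \<kappa> b by (simp add: L_def)
  have "(8 * x * exp (- (\<kappa> * x powr \<theta>))) ^ k \<le> (1 / 4) ^ n"
    if k: "0 < k" "k \<le> n" and x: "3 ^ nat \<lceil>L * sqrt (real n / real k)\<rceil> \<le> x" for n k x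
  proof -
    define J where "J = nat \<lceil>L * sqrt (real n / real k)\<rceil>"
    have "L * sqrt (real n / real k) \<le> real J" unfolding J_def by linarith
    then have "(L * sqrt (real n / real k))\<^sup>2 \<le> (real J)\<^sup>2"
      using L by (intro power_mono) auto
    then have J: "L\<^sup>2 * (real n / real k) \<le> (real J)\<^sup>2"
      using k by (simp add: power_mult_distrib)
    have x1: "1 \<le> x" using x order_trans[OF one_le_power[of "3::real"]] by auto
    \<comment> \<open>Only quadratic growth is extracted from the power of 3, whence the square root
      in the cutoff.\<close>
    have "(real J * \<theta>)\<^sup>2 / 2 \<le> exp (real J * \<theta>)"
    proof -
      have "0 \<le> real J * \<theta>" using \<theta> by simp
      from exp_lower_Taylor_quadratic[OF this] this show ?thesis by linarith
    qed
    also have "\<dots> \<le> exp (real J * \<theta> * ln 3)"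
    proof -
      have "1 \<le> ln (3::real)"
        using exp_le ln_mono[of "exp 1" "3::real"] by simp
      then have "real J * \<theta> * 1 \<le> real J * \<theta> * ln 3" using \<theta> by (intro mult_left_mono) auto
      then show ?thesis by simp
    qed
    also have "\<dots> = (3 ^ J) powr \<theta>"
      by (simp add: powr_def ln_realpow mult_ac)
    also have "\<dots> \<le> x powr \<theta>"
      using x \<theta> by (intro powr_mono2) (auto simp: J_def)
    finally have "\<kappa> / 2 * ((real J * \<theta>)\<^sup>2 / 2) \<le> \<kappa> / 2 * x powr \<theta>"
      using \<kappa> by (intro mult_left_mono) auto
    moreover have "(b + 2) * (real n / real k) \<le> \<kappa> / 2 * ((real J * \<theta>)\<^sup>2 / 2)"
    proof -
      have "(b + 2) * (real n / real k) = \<kappa> * \<theta>\<^sup>2 / 4 * (L\<^sup>2 * (real n / real k))"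
        unfolding L2[symmetric] by simp
      also have "\<dots> \<le> \<kappa> * \<theta>\<^sup>2 / 4 * (real J)\<^sup>2"
        using \<kappa> by (intro mult_left_mono J) auto
      finally show ?thesis by (simp add: power_mult_distrib mult_ac)
    qed
    ultimately have low: "(b + 2) * (real n / real k) \<le> \<kappa> / 2 * x powr \<theta>" by linarith
    have "8 * x * exp (- (\<kappa> * x powr \<theta>)) \<le> B * exp (\<kappa> / 2 * x powr \<theta>) * exp (- (\<kappa> * x powr \<theta>))"
      by (intro mult_right_mono lin x1) auto
    also have "\<dots> = exp (b - \<kappa> / 2 * x powr \<theta>)"
      by (simp add: b(2) flip: exp_add)
    also have "\<dots> \<le> exp (b - (b + 2) * (real n / real k))"
      using low by simp
    finally have "(8 * x * exp (- (\<kappa> * x powr \<theta>))) ^ k \<le> exp (b - (b + 2) * (real n / real k)) ^ k"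
      using x1 by (intro power_mono) auto
    also have "\<dots> = exp (real k * b - (b + 2) * real n)"
    proof -
      have "real k * (b - (b + 2) * (real n / real k)) = real k * b - (b + 2) * real n"
        using k by (simp add: right_diff_distrib)
      then show ?thesis by (simp only: exp_of_nat_mult[symmetric])
    qed
    also have "\<dots> \<le> exp (- 2 * real n)"
      using k b mult_right_mono[of "real k" "real n" b] by (simp add: algebra_simps)
    also have "\<dots> = exp (- 2) ^ n"
      by (simp add: exp_of_nat_mult[symmetric] mult.commute)
    also have "\<dots> \<le> (1 / 4) ^ n"
    proof (rule power_mono)
      have "(4::real) \<le> exp 2" using exp_lower_Taylor_quadratic[of 2] by simp
      then show "exp (- 2) \<le> (1 / 4 :: real)" by (simp add: exp_minus field_simps)
    qed simp
    finally show ?thesis .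
  qed
  with L show thesis by (rule that)
qed

lemma norm_phi_cusp_le:
  assumes \<theta>: "0 < \<theta>" "\<theta> < 1" and z: "z \<in> ball 0 1"
  shows "cmod (phi \<theta> (cusp_map z)) \<le> exp (- (cos (\<theta> * pi / 2) * Re (cusp_2 z) powr \<theta>))"
proof -
  note str = cusp_2_strip[OF z] and m = cusp_map_modulus[OF z]
  have "cmod (phi \<theta> (cusp_map z)) \<le> exp (- (cos (\<theta> * pi / 2) * cmod (1 - cusp_map z) powr (- \<theta>)))"
    using m(2) by (intro norm_phi_le \<theta>) auto
  also have "cmod (1 - cusp_map z) powr (- \<theta>) = cmod (cusp_2 z) powr \<theta>"
    unfolding m(3) using str by (simp add: powr_minus powr_divide)
  also have "exp (- (cos (\<theta> * pi / 2) * cmod (cusp_2 z) powr \<theta>))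
      \<le> exp (- (cos (\<theta> * pi / 2) * Re (cusp_2 z) powr \<theta>))"
    using cos_half_pi_pos[OF \<theta>] \<theta> str complex_Re_le_cmod[of "cusp_2 z"]
    by (simp add: powr_mono2)
  finally show ?thesis .
qed

text \<open>As 1 - |u| is at least 1 / (4 x), it is enough that 8 c x stays below the exponential
  controlling 1 / |phi|, and c * B < 1 ensures this.\<close>

lemma admissible_constant_exists:
  assumes \<theta>: "0 < \<theta>" "\<theta> < 1"
  shows "\<exists>c. admissible_constant \<theta> c"
proof -
  obtain B where B: "1 \<le> B" "\<And>x. 1 \<le> x \<Longrightarrow> 8 * x \<le> B * exp (cos (\<theta> * pi / 2) * x powr \<theta>)"
    using exp_powr_dominates_linear[OF \<theta>(1) cos_half_pi_pos[OF \<theta>]] by auto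
  define c where "c = 1 / (B + 1)"
  have c: "0 < c" "c < 1" "c * B < 1" using B(1) by (auto simp: c_def field_simps)
  have "cmod (cusp_map z) + 2 * c * cmod (phi \<theta> (cusp_map z)) < 1" if z: "z \<in> ball 0 1" for z
  proof -
    define x where "x = Re (cusp_2 z)"
    define E where "E = exp (cos (\<theta> * pi / 2) * x powr \<theta>)"
    have x: "1 < x" using cusp_2_strip[OF z] by (simp add: x_def)
    have E: "0 < E" "8 * x \<le> B * E" using B(2)[of x] x by (auto simp: E_def)
    have "cmod (phi \<theta> (cusp_map z)) \<le> 1 / E"
      using norm_phi_cusp_le[OF \<theta> z] by (simp add: E_def x_def exp_minus inverse_eq_divide)
    then have "2 * c * cmod (phi \<theta> (cusp_map z)) \<le> 2 * c * (1 / E)"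
      using c by (intro mult_left_mono) auto
    also have "\<dots> < 1 / (4 * x)"
    proof -
      have "c * (8 * x) \<le> c * (B * E)" using c E by (intro mult_left_mono) auto
      also have "\<dots> < 1 * E" using c E by (simp only: mult.assoc[symmetric] mult_strict_right_mono)
      finally show ?thesis using E x by (simp add: field_simps)
    qed
    finally show ?thesis
      using cusp_map_modulus(1)[OF z] by (simp add: x_def)
  qed
  with c show ?thesis by (auto simp: admissible_constant_def)
qed

section \<open>The composition operator\<close>

locale cusp_composition =
  fixes \<theta> c :: real and g :: "complex \<Rightarrow> complex"
  assumes \<theta>: "0 < \<theta>" "\<theta> < 1"
    and admissible: "admissible_constant \<theta> c"
    and g: "g \<in> disk_algebra"
    and g_le: "\<And>z. z \<in> cball 0 1 \<Longrightarrow> cmod (g z) \<le> 1"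
begin

abbreviation "\<Phi> \<equiv> cusp_symbol \<theta> c g"

definition amplitude :: "complex \<Rightarrow> complex"
  where "amplitude z = of_real c * phi \<theta> (cusp_map z)"

lemma symbol_eq: "\<Phi> (z, w) = (cusp_map z, cusp_map z + amplitude z * g w)"
  by (simp add: cusp_symbol_def amplitude_def)

lemma c_bounds: "0 < c" "c < 1"
  using admissible by (auto simp: admissible_constant_def)

lemma holomorphic_g: "g holomorphic_on ball 0 1" and continuous_g: "continuous_on (cball 0 1) g"
  using g by (auto simp: disk_algebra_def)

lemma holomorphic_amplitude: "amplitude holomorphic_on ball 0 1"
proof -
  have "(phi \<theta> \<circ> cusp_map) holomorphic_on ball 0 1"
    by (rule holomorphic_on_compose_gen[OF holomorphic_cusp_map holomorphic_phi])
      (use cusp_map_modulus(2) in auto)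
  then show ?thesis
    unfolding amplitude_def[abs_def] o_def by (intro holomorphic_intros)
qed

lemma continuous_amplitude: "continuous_on (cball 0 1) amplitude"
proof -
  have "continuous_on (cball 0 1) (\<lambda>z. phi \<theta> (cusp_map z))"
    by (rule continuous_on_compose2[OF continuous_on_phi[OF \<theta>] continuous_on_cusp_map])
      (use cusp_map_cball in auto)
  then show ?thesis
    unfolding amplitude_def[abs_def] by (intro continuous_intros)
qed

lemma norm_amplitude_le:
  assumes "z \<in> ball 0 1"
  shows "2 * cmod (amplitude z) \<le> 1 - cmod (cusp_map z)"
    "cmod (amplitude z) \<le> exp (- (cos (\<theta> * pi / 2) * Re (cusp_2 z) powr \<theta>))"
proof -
  have "cmod (amplitude z) = c * cmod (phi \<theta> (cusp_map z))"
    using c_bounds by (simp add: amplitude_def norm_mult)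
  then show "2 * cmod (amplitude z) \<le> 1 - cmod (cusp_map z)"
    using admissible assms by (auto simp: admissible_constant_def mult.assoc less_imp_le dest!: bspec)
  have "c * cmod (phi \<theta> (cusp_map z)) \<le> 1 * cmod (phi \<theta> (cusp_map z))"
    using c_bounds by (intro mult_right_mono) auto
  then show "cmod (amplitude z) \<le> exp (- (cos (\<theta> * pi / 2) * Re (cusp_2 z) powr \<theta>))"
    using norm_phi_cusp_le[OF \<theta> assms] \<open>cmod (amplitude z) = _\<close> by simp
qed

lemma norm_sg_le:
  assumes "z \<in> ball 0 1" "w \<in> ball 0 1"
  shows "2 * cmod (amplitude z * g w) \<le> 1 - cmod (cusp_map z)"
proof -
  have "cmod (amplitude z * g w) \<le> cmod (amplitude z) * 1"
    unfolding norm_mult using assms by (intro mult_left_mono g_le) auto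
  then show ?thesis using norm_amplitude_le(1)[OF assms(1)] by linarith
qed

lemma symbol_bidisk:
  assumes z: "z \<in> ball 0 1" and w: "w \<in> ball 0 1"
  shows "cmod (cusp_map z) < 1" "cmod (cusp_map z + amplitude z * g w) < 1"
proof -
  show "cmod (cusp_map z) < 1" by (rule cusp_map_modulus(2)[OF z])
  then show "cmod (cusp_map z + amplitude z * g w) < 1"
    using norm_sg_le[OF z w] norm_triangle_ineq[of "cusp_map z" "amplitude z * g w"] by linarith
qed

lemma symbol_image: "\<Phi> ` bidisk \<subseteq> bidisk"
  using symbol_bidisk by (auto simp: bidisk_def symbol_eq)

lemma composition_series:
  assumes z: "z \<in> ball 0 1" and w: "w \<in> ball 0 1"
  shows "(\<lambda>k. diag_coeff f k (cusp_map z) * (amplitude z * g w) ^ k) sums hardy2_fun f (\<Phi> (z, w))"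
proof -
  let ?u = "cusp_map z"
  have u: "cmod ?u < 1" by (rule cusp_map_modulus(2)[OF z])
  have "cmod (amplitude z * g w) < 1 - cmod ?u"
    using norm_sg_le[OF z w] u norm_ge_zero[of "amplitude z * g w"] by linarith
  then have "amplitude z * g w \<in> ball 0 (1 - cmod ?u)" by simp
  from taylor_coeff_sums[OF holomorphic_diag_shift[of ?u "1 - cmod ?u" f] this] u
  show ?thesis by (simp add: symbol_eq diag_coeff_def)
qed

text \<open>The imaginary part of \<open>cusp_2\<close> is smaller than 1, hence the fourth power of the weight is dominated
  by the real part of a holomorphic function, which is what the membership criterion for the
  Hardy space asks for.\<close>

definition weight :: "complex \<Rightarrow> real"
  where "weight z = exp (pi / 16 * (Re (cusp_2 z) - 1))"

text \<open>The linear bound is kept in two versions: the one with the first power leaves a spare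
  factor \<open>weight z\<close> for the term k = 0.\<close>

lemma weight_bounds:
  assumes z: "z \<in> ball 0 1"
  shows "1 \<le> weight z" "Re (cusp_2 z) \<le> 6 * weight z" "Re (cusp_2 z) \<le> 6 * (weight z)\<^sup>2"
    "(weight z) ^ 4 \<le> 2 * Re (exp (of_real (pi / 4) * (cusp_2 z - 1)))"
proof -
  define x where "x = Re (cusp_2 z)"
  have x: "1 < x" and y: "\<bar>Im (cusp_2 z)\<bar> < 1" using cusp_2_strip[OF z] by (auto simp: x_def)
  show w1: "1 \<le> weight z" using x by (simp add: weight_def x_def)
  have "x \<le> 6 * (1 + pi / 16 * (x - 1))"
  proof -
    have "3 * (x - 1) \<le> pi * (x - 1)" using x pi_gt3 by (intro mult_right_mono) auto
    then show ?thesis using x by simp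
  qed
  also have "\<dots> \<le> 6 * weight z"
    unfolding weight_def x_def by (intro mult_left_mono exp_ge_add_one_self) auto
  finally show le: "Re (cusp_2 z) \<le> 6 * weight z" by (simp add: x_def)
  have "weight z * 1 \<le> weight z * weight z" using w1 by (intro mult_left_mono) auto
  then show "Re (cusp_2 z) \<le> 6 * (weight z)\<^sup>2" using le by (simp add: power2_eq_square)
  \<comment> \<open>The angle is at most pi / 4, hence below pi / 3; the cosine 1/2 is the source of
    the factor 2 in the majorant.\<close>
  have "1 / 2 \<le> cos (pi / 4 * Im (cusp_2 z))"
  proof -
    have "cos (pi / 3) \<le> cos \<bar>pi / 4 * Im (cusp_2 z)\<bar>"
    proof (rule cos_monotone_0_pi_le)
      have "pi * \<bar>Im (cusp_2 z)\<bar> \<le> pi * 1" using y by (intro mult_left_mono) auto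
      then show "\<bar>pi / 4 * Im (cusp_2 z)\<bar> \<le> pi / 3" by (simp add: abs_mult)
    qed auto
    then show ?thesis by (simp only: cos_60 cos_abs_real)
  qed
  moreover have "Re (exp (of_real (pi / 4) * (cusp_2 z - 1))) = exp (pi / 4 * (x - 1)) * cos (pi / 4 * Im (cusp_2 z))"
    by (simp add: Re_exp x_def del: of_real_divide)
  ultimately have "exp (pi / 4 * (x - 1)) * (1 / 2) \<le> Re (exp (of_real (pi / 4) * (cusp_2 z - 1)))"
    by (simp del: of_real_divide)
  moreover have "(weight z) ^ 4 = exp (pi / 4 * (x - 1))"
    by (simp add: weight_def x_def exp_of_nat_mult[symmetric])
  ultimately show "(weight z) ^ 4 \<le> 2 * Re (exp (of_real (pi / 4) * (cusp_2 z - 1)))"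
    by simp
qed

lemma term_bound_geometric:
  assumes z: "z \<in> ball 0 1"
  shows "cmod (diag_coeff f k (cusp_map z) * amplitude z ^ k) \<le> 100 * (weight z)\<^sup>2 * norm f * (2 / 3) ^ k"
proof -
  define x where "x = Re (cusp_2 z)"
  define \<delta> where "\<delta> = 1 - cmod (cusp_map z)"
  have x: "1 < x" using cusp_2_strip[OF z] by (simp add: x_def)
  have \<delta>: "1 / (4 * x) \<le> \<delta>" using cusp_map_modulus(1)[OF z] by (simp add: x_def \<delta>_def)
  then have \<delta>0: "0 < \<delta>" using x by (smt (verit) divide_pos_pos)
  have inv: "1 / \<delta> \<le> 4 * x" using \<delta> \<delta>0 x by (simp add: field_simps)
  \<comment> \<open>The amplitude is at most \<delta> / 2, which is 2/3 of the Cauchy radius 3/4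
    \<delta>; the remaining quarter of \<delta> is the reserve for point evaluations.\<close>
  have "cmod (diag_coeff f k (cusp_map z) * amplitude z ^ k) \<le> cmod (diag_coeff f k (cusp_map z)) * (2 / 3 * (3 / 4 * \<delta>)) ^ k"
    unfolding norm_mult norm_power using norm_amplitude_le(1)[OF z]
    by (intro mult_left_mono power_mono) (auto simp: \<delta>_def)
  also have "\<dots> = cmod (diag_coeff f k (cusp_map z)) * (3 / 4 * \<delta>) ^ k * (2 / 3) ^ k"
    unfolding power_mult_distrib[of "2 / 3"] by (simp only: mult_ac)
  also have "\<dots> \<le> norm f / (1 / 4 * \<delta>) * (2 / 3) ^ k"
    by (intro mult_right_mono norm_diag_coeff_le) (use \<delta>0 in \<open>simp_all add: \<delta>_def field_simps\<close>)
  also have "norm f / (1 / 4 * \<delta>) = 4 * norm f * (1 / \<delta>)" by simp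
  also have "\<dots> \<le> 4 * norm f * (24 * (weight z)\<^sup>2)"
    using inv weight_bounds(3)[OF z] by (intro mult_left_mono) (auto simp: x_def)
  also have "\<dots> \<le> 100 * (weight z)\<^sup>2 * norm f"
    using mult_right_mono[of 96 100 "norm f * (weight z)\<^sup>2"] by (simp add: mult_ac)
  finally show ?thesis by (simp add: mult_right_mono)
qed

text \<open>Put \<open>X = 3 ^ j\<close>. The points \<open>u = cusp_map z\<close> with \<open>X \<le> Re (cusp_2 z) \<le> 3 * X\<close> satisfy
  \<open>|u - (1 - 1 / X)| \<le> (4 / 5) * R\<close> with \<open>R = 9 / (10 * X)\<close>, and the disk of radius \<open>R\<close> around
  \<open>1 - 1 / X\<close> stays at distance \<open>1 / (10 * X)\<close> from the unit circle. The exponent 17 is chosen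
  such that \<open>(4 / 5) ^ 17\<close> times the loss 10 in the Cauchy estimate is at most \<open>1 / 4\<close>.\<close>

lemma term_bound_schwarz:
  assumes z: "z \<in> ball 0 1" and k: "k \<le> n"
    and j: "3 ^ j \<le> Re (cusp_2 z)" "Re (cusp_2 z) \<le> 3 * 3 ^ j"
    and vanish: "\<And>i. i < 17 * n \<Longrightarrow> taylor_coeff (diag_coeff f k) (1 - 1 / 3 ^ j) i = 0"
  shows "cmod (diag_coeff f k (cusp_map z) * amplitude z ^ k) \<le> 600 * (weight z)\<^sup>2 * norm f * (1 / 4) ^ n"
proof -
  define w where "w = cusp_2 z"
  define x where "x = Re w"
  define X :: real where "X = 3 ^ j"
  have x: "1 < x" and y: "\<bar>Im w\<bar> < 1" using cusp_2_strip[OF z] by (auto simp: x_def w_def)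
  have X: "1 \<le> X" "X \<le> x" "x \<le> 3 * X" using j by (auto simp: X_def x_def w_def)
  have nz: "w \<noteq> 0" using x by (auto simp: x_def)
  have xw: "x \<le> cmod w" using complex_Re_le_cmod[of w] by (simp add: x_def)
  let ?u = "cusp_map z" and ?a = "1 - 1 / complex_of_real X"
  \<comment> \<open>The bracket of x between X and 3 X enters as (x - X) (3 X - x) >= 0, and X >= 1
    absorbs the imaginary part. The constant 18/25 used next is slightly above 1 / sqrt 2 and equals
    4/5 * 9/10.\<close>
  have "2 * (cmod (w - of_real X))\<^sup>2 \<le> (cmod w)\<^sup>2"
  proof -
    have "0 \<le> (x - X) * (3 * X - x)" using X by (intro mult_nonneg_nonneg) auto
    moreover have "(Im w)\<^sup>2 \<le> 1" using y by (simp add: abs_square_le_1)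
    moreover have "1 \<le> X * X" using X mult_mono[of 1 X 1 X] by simp
    ultimately have "2 * ((x - X)\<^sup>2 + (Im w)\<^sup>2) \<le> x\<^sup>2 + (Im w)\<^sup>2"
      by (simp add: power2_eq_square algebra_simps)
    then show ?thesis
      by (simp add: cmod_power2 x_def)
  qed
  also have "\<dots> \<le> 2 * (18 / 25 * cmod w)\<^sup>2"
    by (simp add: power_mult_distrib power_divide)
  finally have "(cmod (w - of_real X))\<^sup>2 \<le> (18 / 25 * cmod w)\<^sup>2"
    by simp
  then have dist: "cmod (w - of_real X) \<le> 18 / 25 * cmod w"
    by (rule power2_le_imp_le) simp
  have "?u - ?a = (w - of_real X) / (w * of_real X)"
    using nz X by (simp add: cusp_map_ball[OF z] w_def field_simps)
  then have "cmod (?u - ?a) = cmod (w - of_real X) / (cmod w * X)"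
    using X by (simp add: norm_divide norm_mult)
  also have "\<dots> \<le> (18 / 25 * cmod w) / (cmod w * X)"
    using X by (intro divide_right_mono dist) auto
  finally have ua: "cmod (?u - ?a) \<le> 4 / 5 * (9 / (10 * X))"
    using nz by simp
  have R: "0 < 9 / (10 * X)" using X by simp
  \<comment> \<open>The remaining distance 1 / (10 X) is split evenly between the Cauchy radius and
    the reserve for point evaluations.\<close>
  have near: "cmod v + 1 / (20 * X) + 1 / (20 * X) \<le> 1" if "v \<in> ball ?a (9 / (10 * X))" for v
  proof -
    have "?a = of_real (1 - 1 / X)" by simp
    then have "cmod ?a = 1 - 1 / X" using X by (simp only: norm_of_real) simp
    then have "cmod v \<le> 1 - 1 / X + 9 / (10 * X)"
      using that norm_triangle_ineq2[of v ?a] by (simp add: dist_norm norm_minus_commute)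
    moreover have "9 / (10 * X) = 9 / 10 * (1 / X)" "1 / (20 * X) = 1 / 20 * (1 / X)" by simp_all
    ultimately show ?thesis by linarith
  qed
  have "cmod (diag_coeff f k ?u) \<le> norm f * (20 * X) * (20 * X) ^ k * (4 / 5) ^ (17 * n) / (1 - 4 / 5)"
  proof (rule holomorphic_vanishing_bound[OF _ R _ _ ua])
    have "cmod v < 1" if "v \<in> ball ?a (9 / (10 * X))" for v
    proof -
      have "0 < 1 / (20 * X)" using X by simp
      then show ?thesis using near[OF that] by linarith
    qed
    then show "diag_coeff f k holomorphic_on ball ?a (9 / (10 * X))"
      by (intro holomorphic_on_subset[OF holomorphic_diag_coeff]) auto
    show "cmod (diag_coeff f k v) \<le> norm f * (20 * X) * (20 * X) ^ k" if "v \<in> ball ?a (9 / (10 * X))" for v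
    proof -
      have "cmod (diag_coeff f k v) * (1 / (20 * X)) ^ k \<le> norm f / (1 / (20 * X))"
        by (rule norm_diag_coeff_le) (use X near[OF that] in auto)
      then show ?thesis using X by (simp add: power_divide divide_le_eq)
    qed
    show "taylor_coeff (diag_coeff f k) ?a i = 0" if "i < 17 * n" for i
      using vanish[OF that] by (simp add: X_def)
  qed auto
  then have d: "cmod (diag_coeff f k ?u) \<le> 100 * X * norm f * (20 * X) ^ k * (4 / 5) ^ (17 * n)"
    by (simp add: mult_ac)
  \<comment> \<open>On this piece the amplitude is at most 1 / (2 X), which reduces the Cauchy loss
    (20 X)^k to 10^k.\<close>
  have "2 * cmod (amplitude z) \<le> cmod (1 - ?u)"
    using norm_amplitude_le(1)[OF z] norm_triangle_ineq2[of 1 ?u] by simp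
  also have "\<dots> \<le> 1 / X"
    unfolding cusp_map_modulus(3)[OF z] using X xw nz by (intro divide_left_mono mult_pos_pos) (auto simp: w_def)
  finally have "10 * X * (2 * cmod (amplitude z)) \<le> 10 * X * (1 / X)"
    using X by (intro mult_left_mono) auto
  then have "20 * X * cmod (amplitude z) \<le> 10"
    using X by simp
  then have "(20 * X * cmod (amplitude z)) ^ k \<le> 10 ^ k"
    using X by (intro power_mono) auto
  then have sk: "(20 * X) ^ k * cmod (amplitude z) ^ k \<le> 10 ^ k"
    by (simp only: power_mult_distrib)
  have "cmod (diag_coeff f k ?u * amplitude z ^ k) \<le> 100 * X * norm f * (20 * X) ^ k * (4 / 5) ^ (17 * n) * cmod (amplitude z) ^ k"
    unfolding norm_mult norm_power by (intro mult_right_mono d) auto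
  also have "\<dots> = 100 * X * norm f * ((4 / 5) ^ 17) ^ n * ((20 * X) ^ k * cmod (amplitude z) ^ k)"
    unfolding power_mult by (simp only: mult_ac)
  also have "\<dots> \<le> 100 * X * norm f * (1 / 40) ^ n * 10 ^ n"
  proof (intro mult_mono order_trans[OF sk] power_increasing)
    show "((4 / 5) ^ 17) ^ n \<le> (1 / 40 :: real) ^ n"
      by (intro power_mono) (simp_all add: power_divide)
  qed (use X k in auto)
  also have "\<dots> = 100 * X * norm f * (1 / 4) ^ n"
    by (simp add: mult.assoc flip: power_mult_distrib)
  also have "\<dots> \<le> 100 * (6 * (weight z)\<^sup>2) * norm f * (1 / 4) ^ n"
    using weight_bounds(3)[OF z] X by (intro mult_right_mono mult_left_mono) (auto simp: x_def w_def)
  finally show ?thesis by simp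
qed

text \<open>The guaranteed distance 1 / (4 x) to the circle is halved between the Cauchy radius and
  the reserve. The constant 600 is larger than this case requires, so that it can be shared with the
  Schwarz case.\<close>

lemma term_bound_decay:
  assumes z: "z \<in> ball 0 1"
    and decay: "(8 * Re (cusp_2 z) * exp (- (cos (\<theta> * pi / 2) * Re (cusp_2 z) powr \<theta>))) ^ k \<le> (1 / 4) ^ n"
  shows "cmod (diag_coeff f k (cusp_map z) * amplitude z ^ k) \<le> 600 * (weight z)\<^sup>2 * norm f * (1 / 4) ^ n"
proof -
  define x where "x = Re (cusp_2 z)"
  have x: "1 < x" using cusp_2_strip[OF z] by (simp add: x_def)
  define E where "E = exp (- (cos (\<theta> * pi / 2) * x powr \<theta>))"
  have r: "cmod (cusp_map z) + 1 / (8 * x) + 1 / (8 * x) \<le> 1"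
    using cusp_map_modulus(1)[OF z] by (simp add: x_def)
  have "cmod (diag_coeff f k (cusp_map z)) * (1 / (8 * x)) ^ k \<le> norm f / (1 / (8 * x))"
    by (rule norm_diag_coeff_le) (use x r in auto)
  then have d: "cmod (diag_coeff f k (cusp_map z)) \<le> 8 * x * norm f * (8 * x) ^ k"
    using x by (simp add: power_divide divide_le_eq mult_ac)
  have "cmod (diag_coeff f k (cusp_map z) * amplitude z ^ k) \<le> 8 * x * norm f * (8 * x) ^ k * E ^ k"
    unfolding norm_mult norm_power
    by (intro mult_mono d power_mono) (use norm_amplitude_le(2)[OF z] x in \<open>auto simp: E_def x_def\<close>)
  also have "\<dots> = 8 * x * norm f * (8 * x * E) ^ k" by (simp add: power_mult_distrib)
  also have "\<dots> \<le> 8 * x * norm f * (1 / 4) ^ n"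
    using x decay by (intro mult_left_mono) (auto simp: E_def x_def)
  also have "\<dots> \<le> 100 * (6 * (weight z)\<^sup>2) * norm f * (1 / 4) ^ n"
    using weight_bounds(3)[OF z] x by (intro mult_right_mono mult_mono) (auto simp: x_def)
  finally show ?thesis by simp
qed

text \<open>The point evaluation is bounded by a multiple of \<open>weight z\<close>, while the
  target contains its square; at this depth the spare factor \<open>weight z\<close> is at least 4^n
  / 2.\<close>

lemma term_bound_weight:
  assumes z: "z \<in> ball 0 1" and far: "3 ^ (8 * n) \<le> Re (cusp_2 z)"
  shows "cmod (diag_coeff f 0 (cusp_map z) * amplitude z ^ 0) \<le> 600 * (weight z)\<^sup>2 * norm f * (1 / 4) ^ n"
proof -
  define x where "x = Re (cusp_2 z)"
  have x: "1 < x" using cusp_2_strip[OF z] by (simp add: x_def)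
  have r: "cmod (cusp_map z) + 1 / (8 * x) + 1 / (8 * x) \<le> 1"
    using cusp_map_modulus(1)[OF z] by (simp add: x_def)
  have "cmod (diag_coeff f 0 (cusp_map z)) * (1 / (8 * x)) ^ 0 \<le> norm f / (1 / (8 * x))"
    by (rule norm_diag_coeff_le) (use x r in auto)
  then have "cmod (diag_coeff f 0 (cusp_map z) * amplitude z ^ 0) \<le> 8 * x * norm f"
    by (simp add: mult_ac)
  also have "\<dots> \<le> 8 * (6 * weight z) * norm f"
    using weight_bounds(2)[OF z] by (intro mult_right_mono mult_left_mono) (auto simp: x_def)
  also have "\<dots> \<le> 8 * (6 * (2 * (weight z)\<^sup>2 * (1 / 4) ^ n)) * norm f"
  proof (intro mult_right_mono mult_left_mono)
    \<comment> \<open>This is very wasteful, but 8 n nodes for the single index k = 0 still cost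
      only O(n^2) conditions.\<close>
    have "real (8 * n) \<le> 3 ^ (8 * n)"
    proof -
      have "8 * n < 3 ^ (8 * n)" by (rule less_exp[THEN less_le_trans]) (simp add: power_mono)
      then show ?thesis by (metis less_imp_le of_nat_le_iff of_nat_numeral of_nat_power)
    qed
    then have n: "8 * real n \<le> x" using far by (simp add: x_def)
    \<comment> \<open>From pi > 3 and x at least 8 n; then exp (3 / 2) exceeds 4, and the shift from
      x to x - 1 in the weight costs at most exp (1 / 2), below 2.\<close>
    have "3 / 2 * real n \<le> pi / 16 * x"
    proof -
      have "3 * x \<le> pi * x" using x pi_gt3 by (intro mult_right_mono) auto
      then show ?thesis using n by linarith
    qed
    moreover have "pi / 16 \<le> 1 / 2" using pi_less_4 by simp
    ultimately have "exp (3 / 2 * real n) \<le> exp (1 / 2 + pi / 16 * (x - 1))"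
      by (simp only: exp_le_cancel_iff right_diff_distrib)
    also have "\<dots> = exp (1 / 2) * weight z"
      by (simp add: weight_def x_def exp_add)
    also have "\<dots> \<le> 2 * weight z"
    proof -
      have "exp (1 / 2 :: real) \<le> 2"
        using exp_bound_half[of "1/2::real"] by simp
      then show ?thesis using weight_bounds(1)[OF z] by (intro mult_right_mono) auto
    qed
    finally have "exp (3 / 2 * real n) \<le> 2 * weight z" .
    moreover have "4 ^ n \<le> exp (3 / 2 * real n)"
    proof -
      have "(4::real) \<le> exp (3 / 2)"
      proof -
        have "(4::real) \<le> (1 + (1/2) + (1/2)\<^sup>2 / 2) ^ 3" by (simp add: power2_eq_square power3_eq_cube)
        also have "\<dots> \<le> exp (1 / 2) ^ 3"
          using exp_lower_Taylor_quadratic[of "1/2::real"] by (intro power_mono) auto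
        also have "\<dots> = exp (3 / 2)" by (simp add: exp_of_nat_mult[symmetric])
        finally show ?thesis .
      qed
      then have "(4::real) ^ n \<le> exp (3 / 2) ^ n" by (intro power_mono) auto
      then show ?thesis by (simp add: exp_of_nat_mult[symmetric] mult.commute)
    qed
    ultimately have "4 ^ n * weight z \<le> 2 * weight z * weight z"
      using weight_bounds(1)[OF z] by (intro mult_right_mono) auto
    then show "weight z \<le> 2 * (weight z)\<^sup>2 * (1 / 4) ^ n"
      by (simp add: power2_eq_square power_divide field_simps)
  qed auto
  also have "\<dots> = 96 * ((weight z)\<^sup>2 * norm f * (1 / 4) ^ n)" by simp
  also have "\<dots> \<le> 600 * ((weight z)\<^sup>2 * norm f * (1 / 4) ^ n)"
    by (intro mult_right_mono) auto
  finally show ?thesis by (simp add: mult.assoc)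
qed

text \<open>Beyond \<open>3 ^ cutoff L n k\<close> the \<open>k\<close>-th term is small without any vanishing condition: for \<open>k > 0\<close>
  because of the factor \<open>amplitude z ^ k\<close>, for \<open>k = 0\<close> because the weight is large there.\<close>

definition cutoff :: "real \<Rightarrow> nat \<Rightarrow> nat \<Rightarrow> nat"
  where "cutoff L n k = (if k = 0 then 8 * n else nat \<lceil>L * sqrt (real n / real k)\<rceil>)"

definition node_set :: "real \<Rightarrow> nat \<Rightarrow> (nat \<times> nat \<times> nat) set"
  where "node_set L n = (SIGMA k:{..<n}. {..<cutoff L n k} \<times> {..<17 * n})"

definition node_functional :: "nat \<times> nat \<times> nat \<Rightarrow> hardy2 \<Rightarrow> complex"
  where "node_functional = (\<lambda>(k, j, i) f. taylor_coeff (diag_coeff f k) (1 - 1 / 3 ^ j) i)"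

lemma finite_node_set: "finite (node_set L n)"
  by (auto simp: node_set_def)

text \<open>Each node carries 17 n conditions. The cutoffs add up to at most 8 n from k = 0, n from
  rounding up, and 2 L n from the sum of the inverse square roots.\<close>

lemma card_node_set:
  assumes L: "0 < L"
  shows "real (card (node_set L n)) \<le> 17 * (9 + 2 * L) * (real n)\<^sup>2"
proof -
  have cut: "real (cutoff L n k) \<le> (if k = 0 then 8 * real n else 0) + (1 + L * sqrt (real n) * (if k = 0 then 0 else 1 / sqrt (real k)))" for k
  proof (cases "k = 0")
    case False
    have "0 \<le> L * sqrt (real n / real k)" using L by simp
    then have "real (nat \<lceil>L * sqrt (real n / real k)\<rceil>) \<le> L * sqrt (real n / real k) + 1"
      by linarith
    then show ?thesis using False by (simp add: cutoff_def real_sqrt_divide)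
  qed (simp add: cutoff_def)
  have "(\<Sum>k<n. real (cutoff L n k)) \<le> (\<Sum>k<n. (if k = 0 then 8 * real n else 0) + (1 + L * sqrt (real n) * (if k = 0 then 0 else 1 / sqrt (real k))))"
    by (intro sum_mono cut)
  also have "\<dots> = (\<Sum>k<n. if k = 0 then 8 * real n else 0) + (real n + L * sqrt (real n) * (\<Sum>k<n. if k = 0 then 0 else 1 / sqrt (real k)))"
    by (simp only: sum.distrib sum_distrib_left) simp
  also have "\<dots> \<le> 8 * real n + (real n + L * sqrt (real n) * (2 * sqrt (real n)))"
  proof (intro add_mono mult_left_mono order_refl)
    show "(\<Sum>k<n. if k = 0 then 8 * real n else 0) \<le> 8 * real n"
      by (simp add: sum.delta)
    have "(\<Sum>k<n. if k = 0 then 0 else 1 / sqrt (real k)) \<le> (\<Sum>k<Suc n. if k = 0 then 0 else 1 / sqrt (real k))"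
      by (intro sum_mono2) auto
    also have "\<dots> \<le> 2 * sqrt (real n)" by (rule sum_inverse_sqrt_le)
    finally show "(\<Sum>k<n. if k = 0 then 0 else 1 / sqrt (real k)) \<le> 2 * sqrt (real n)" .
  qed (use L in auto)
  also have "\<dots> = (9 + 2 * L) * real n" by (simp add: algebra_simps)
  finally have sum: "(\<Sum>k<n. real (cutoff L n k)) \<le> (9 + 2 * L) * real n" .
  have "real (card (node_set L n)) = (\<Sum>k<n. real (cutoff L n k)) * (17 * real n)"
    by (simp add: node_set_def card_SigmaI sum_distrib_right)
  also have "\<dots> \<le> (9 + 2 * L) * real n * (17 * real n)"
    by (intro mult_right_mono sum) auto
  finally show ?thesis by (simp add: power2_eq_square mult_ac)
qed

lemma power3_bracket:
  assumes "1 \<le> (x::real)"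
  obtains j where "3 ^ j \<le> x" "x \<le> 3 * 3 ^ j"
proof -
  obtain m where m: "x < 3 ^ m" using real_arch_pow[of 3 x] by auto
  define N where "N = (LEAST m. x < 3 ^ m)"
  have N: "x < 3 ^ N" unfolding N_def by (rule LeastI) (rule m)
  have "N \<noteq> 0" using N assms by (cases "N = 0") auto
  then obtain j where j: "N = Suc j" by (cases N) auto
  have "\<not> x < 3 ^ j" using not_less_Least[of j "\<lambda>m. x < 3 ^ m"] j by (simp add: N_def)
  then show thesis using N j by (intro that[of j]) auto
qed

text \<open>Take the power 3^j with x between 3^j and 3^(j+1). Below the cutoff the conditions at
  that node apply; otherwise x is beyond 3 to the cutoff and one of the two unconditional bounds
  does.\<close>

lemma term_bound:
  assumes L: "\<And>n k x. 0 < k \<Longrightarrow> k \<le> n \<Longrightarrow> 3 ^ nat \<lceil>L * sqrt (real n / real k)\<rceil> \<le> x \<Longrightarrow>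
      (8 * x * exp (- (cos (\<theta> * pi / 2) * x powr \<theta>))) ^ k \<le> (1 / 4) ^ n"
    and vanish: "\<And>\<nu>. \<nu> \<in> node_set L n \<Longrightarrow> node_functional \<nu> f = 0"
    and z: "z \<in> ball 0 1" and k: "k < n"
  shows "cmod (diag_coeff f k (cusp_map z) * amplitude z ^ k) \<le> 600 * (weight z)\<^sup>2 * norm f * (1 / 4) ^ n"
proof -
  let ?x = "Re (cusp_2 z)"
  obtain j where j: "3 ^ j \<le> ?x" "?x \<le> 3 * 3 ^ j"
    using power3_bracket[of ?x] cusp_2_strip(1)[OF z] by auto
  show ?thesis
  proof (cases "j < cutoff L n k")
    case True
    have "taylor_coeff (diag_coeff f k) (1 - 1 / 3 ^ j) i = 0" if "i < 17 * n" for i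
      using vanish[of "(k, j, i)"] that True k by (simp add: node_set_def node_functional_def)
    then show ?thesis
      using k by (intro term_bound_schwarz[OF z _ j]) auto
  next
    case False
    then have "(3::real) ^ cutoff L n k \<le> 3 ^ j"
      by (intro power_increasing) auto
    then have far: "3 ^ cutoff L n k \<le> ?x"
      using j(1) by linarith
    show ?thesis
    proof (cases "k = 0")
      case True
      then show ?thesis
        using term_bound_weight[OF z, of n f] far by (simp add: cutoff_def)
    next
      case False
      then show ?thesis
        using far k by (intro term_bound_decay[OF z] L) (auto simp: cutoff_def)
    qed
  qed
qed

text \<open>The head gives 600 n 4^-n, at most 600 (2/3)^n, and the geometric tail from
  \<open>n\<close> on gives 300 (2/3)^n.\<close>

lemma composition_bound:
  assumes L: "\<And>n k x. 0 < k \<Longrightarrow> k \<le> n \<Longrightarrow> 3 ^ nat \<lceil>L * sqrt (real n / real k)\<rceil> \<le> x \<Longrightarrow>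
      (8 * x * exp (- (cos (\<theta> * pi / 2) * x powr \<theta>))) ^ k \<le> (1 / 4) ^ n"
    and vanish: "\<And>\<nu>. \<nu> \<in> node_set L n \<Longrightarrow> node_functional \<nu> f = 0"
    and z: "z \<in> ball 0 1" and w: "w \<in> ball 0 1"
  shows "cmod (hardy2_fun f (\<Phi> (z, w))) \<le> 900 * (2 / 3) ^ n * (weight z)\<^sup>2 * norm f"
proof -
  define W where "W = (weight z)\<^sup>2 * norm f"
  have W: "0 \<le> W" by (simp add: W_def)
  have gk: "cmod (diag_coeff f k (cusp_map z) * (amplitude z * g w) ^ k) \<le> cmod (diag_coeff f k (cusp_map z) * amplitude z ^ k)" for k
  proof -
    have "cmod (g w) \<le> 1" using w by (intro g_le) auto
    then have "cmod (g w) ^ k \<le> 1" by (intro power_le_one) auto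
    then show ?thesis
      by (simp add: norm_mult norm_power power_mult_distrib mult_left_le flip: mult.assoc)
  qed
  have "cmod (hardy2_fun f (\<Phi> (z, w))) \<le> real n * (600 * W * (1 / 4) ^ n) + 100 * W * (2 / 3) ^ n / (1 - 2 / 3)"
  proof (rule norm_sums_split_le[OF composition_series[OF z w]])
    show "cmod (diag_coeff f k (cusp_map z) * (amplitude z * g w) ^ k) \<le> 600 * W * (1 / 4) ^ n" if "k < n" for k
      using order_trans[OF gk term_bound[OF L vanish z that]] by (simp add: W_def mult.assoc)
    show "cmod (diag_coeff f k (cusp_map z) * (amplitude z * g w) ^ k) \<le> 100 * W * (2 / 3) ^ k" for k
      using order_trans[OF gk term_bound_geometric[OF z]] by (simp add: W_def mult.assoc)
  qed auto
  also have "\<dots> = 600 * W * (real n * (1 / 4) ^ n) + 300 * W * (2 / 3) ^ n" by simp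
  also have "\<dots> \<le> 600 * W * (2 / 3) ^ n + 300 * W * (2 / 3) ^ n"
  proof (intro add_right_mono mult_left_mono)
    have "real n * (1 / 4) ^ n \<le> 2 ^ n * (1 / 4) ^ n"
      by (intro mult_right_mono) (use less_exp[of n] in \<open>auto simp: less_imp_le of_nat_less_two_power\<close>)
    also have "\<dots> = (1 / 2) ^ n" by (simp flip: power_mult_distrib)
    also have "\<dots> \<le> (2 / 3) ^ n" by (intro power_mono) auto
    finally show "real n * (1 / 4) ^ n \<le> (2 / 3) ^ n" .
  qed (use W in auto)
  finally show ?thesis by (simp add: W_def algebra_simps)
qed

section \<open>Boundedness, compactness and decay of approximation numbers\<close>

definition norm_const :: real
  where "norm_const = 900 * sqrt (2 * Re (exp (of_real (pi / 4) * (cusp_2 0 - 1))))"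

lemma norm_const_pos: "0 < norm_const"
proof -
  have "0 < weight 0 ^ 4" using weight_bounds(1)[of 0] by (intro zero_less_power) auto
  then have "0 < 2 * Re (exp (of_real (pi / 4) * (cusp_2 0 - 1)))"
    using weight_bounds(4)[of 0] by (rule less_le_trans) simp
  then show ?thesis
    unfolding norm_const_def by (intro mult_pos_pos real_sqrt_gt_zero) auto
qed

text \<open>Squaring the bound produces the fourth power of the weight, for which a majorant is
  known; \<open>norm_const\<close> is 900 times the square root of that majorant at 0.\<close>

lemma composition_in_hardy2:
  assumes bound: "\<And>z w. z \<in> ball 0 1 \<Longrightarrow> w \<in> ball 0 1 \<Longrightarrow>
    cmod (hardy2_fun f (\<Phi> (z, w))) \<le> 900 * \<eta> * (weight z)\<^sup>2 * norm f" and \<eta>: "0 \<le> \<eta>"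
  obtains h where "norm h \<le> norm_const * \<eta> * norm f" "\<And>z. z \<in> bidisk \<Longrightarrow> hardy2_fun h z = hardy2_fun f (\<Phi> z)"
proof -
  define M where "M = (900 * \<eta> * norm f)\<^sup>2"
  define P where "P z = of_real (2 * M) * exp (of_real (pi / 4) * (cusp_2 z - 1))" for z
  have hol1: "(\<lambda>z. hardy2_fun f (\<Phi> (z, w))) holomorphic_on ball 0 1" if "w \<in> ball 0 1" for w
    unfolding symbol_eq
    by (intro holomorphic_on_hardy2_fun holomorphic_intros holomorphic_cusp_map holomorphic_amplitude)
      (use symbol_bidisk that in auto)
  have hol2: "(\<lambda>w. hardy2_fun f (\<Phi> (z, w))) holomorphic_on ball 0 1" if "z \<in> ball 0 1" for z
    unfolding symbol_eq
    by (intro holomorphic_on_hardy2_fun holomorphic_intros holomorphic_g)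
      (use symbol_bidisk that in auto)
  have P: "P holomorphic_on ball 0 1"
    unfolding P_def[abs_def] by (intro holomorphic_intros holomorphic_cusp_2)
  have le: "(cmod (hardy2_fun f (\<Phi> (z, w))))\<^sup>2 \<le> Re (P z)" if "z \<in> ball 0 1" "w \<in> ball 0 1" for z w
  proof -
    have "(cmod (hardy2_fun f (\<Phi> (z, w))))\<^sup>2 \<le> (900 * \<eta> * (weight z)\<^sup>2 * norm f)\<^sup>2"
      by (intro power_mono bound that) auto
    also have "\<dots> = M * weight z ^ 4"
      by (simp add: M_def power_mult_distrib mult_ac flip: power_mult)
    also have "\<dots> \<le> M * (2 * Re (exp (of_real (pi / 4) * (cusp_2 z - 1))))"
      by (intro mult_left_mono weight_bounds(4) that) (simp add: M_def)
    also have "\<dots> = Re (P z)"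
      by (simp only: P_def Re_complex_of_real times_complex.sel Im_complex_of_real mult_zero_left diff_zero mult.assoc mult.left_commute)
    finally show ?thesis .
  qed
  obtain h where h: "(norm h)\<^sup>2 \<le> Re (P 0)" "\<And>z. z \<in> bidisk \<Longrightarrow> hardy2_fun h z = hardy2_fun f (\<Phi> z)"
  proof (rule hardy2_criterion[OF hol1 hol2 P le])
    fix h assume "(norm h)\<^sup>2 \<le> Re (P 0)" "\<And>z. z \<in> bidisk \<Longrightarrow> hardy2_fun h z = hardy2_fun f (\<Phi> z)"
    then show thesis by (rule that)
  qed
  have "Re (P 0) = (norm_const * \<eta> * norm f)\<^sup>2"
  proof -
    have "0 \<le> 2 * Re (exp (of_real (pi / 4) * (cusp_2 0 - 1)))"
      using weight_bounds(4)[of 0] by (rule order_trans[rotated]) auto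
    then have "(norm_const)\<^sup>2 = 900\<^sup>2 * (2 * Re (exp (of_real (pi / 4) * (cusp_2 0 - 1))))"
      by (simp only: norm_const_def power_mult_distrib real_sqrt_pow2)
    moreover have "Re (P 0) = 2 * M * Re (exp (of_real (pi / 4) * (cusp_2 0 - 1)))"
      by (simp only: P_def Re_complex_of_real times_complex.sel Im_complex_of_real mult_zero_left diff_zero mult.assoc mult.left_commute)
    ultimately show ?thesis
      by (simp only: M_def power_mult_distrib mult_ac)
  qed
  with h(1) have "(norm h)\<^sup>2 \<le> (norm_const * \<eta> * norm f)\<^sup>2"
    by simp
  then have "norm h \<le> norm_const * \<eta> * norm f"
    by (rule power2_le_imp_le) (use norm_const_pos \<eta> in simp)
  with h(2) show thesis by (intro that)
qed

lemma cutoff_exists: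
  obtains L where "0 < L" "\<And>n k x. 0 < k \<Longrightarrow> k \<le> n \<Longrightarrow> 3 ^ nat \<lceil>L * sqrt (real n / real k)\<rceil> \<le> x \<Longrightarrow>
      (8 * x * exp (- (cos (\<theta> * pi / 2) * x powr \<theta>))) ^ k \<le> (1 / 4) ^ n"
  using decay_cutoff[OF \<theta>(1) cos_half_pi_pos[OF \<theta>]] by metis

abbreviation "C\<^sub>\<Phi> \<equiv> composition_operator \<Phi>"

lemma composition_operator_eqI:
  assumes "\<And>z. z \<in> bidisk \<Longrightarrow> hardy2_fun h z = hardy2_fun f (\<Phi> z)"
  shows "C\<^sub>\<Phi> f = h"
  unfolding composition_operator_def
  by (rule the_equality) (use assms in \<open>auto intro!: hardy2_fun_eqI\<close>)

lemma hardy2_fun_composition_operator: "z \<in> bidisk \<Longrightarrow> hardy2_fun (C\<^sub>\<Phi> f) z = hardy2_fun f (\<Phi> z)"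
  and norm_composition_operator: "norm (C\<^sub>\<Phi> f) \<le> norm_const * norm f"
proof -
  obtain L where L: "0 < L" "\<And>n k x. 0 < k \<Longrightarrow> k \<le> n \<Longrightarrow> 3 ^ nat \<lceil>L * sqrt (real n / real k)\<rceil> \<le> x \<Longrightarrow>
      (8 * x * exp (- (cos (\<theta> * pi / 2) * x powr \<theta>))) ^ k \<le> (1 / 4) ^ n"
    using cutoff_exists by metis
  \<comment> \<open>For n = 0 the set of vanishing conditions is empty, so the estimate holds for
    every \<open>f\<close>; this is the boundedness of the operator.\<close>
  obtain h where h: "norm h \<le> norm_const * 1 * norm f" "\<And>z. z \<in> bidisk \<Longrightarrow> hardy2_fun h z = hardy2_fun f (\<Phi> z)"
    by (rule composition_in_hardy2[of f 1])
      (use composition_bound[where n = 0 and f = f, OF L(2)] in \<open>auto simp: node_set_def\<close>)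
  then show "z \<in> bidisk \<Longrightarrow> hardy2_fun (C\<^sub>\<Phi> f) z = hardy2_fun f (\<Phi> z)" "norm (C\<^sub>\<Phi> f) \<le> norm_const * norm f"
    using composition_operator_eqI[OF h(2)] by auto
qed

lemma bounded_clinear_composition_operator: "bounded_clinear C\<^sub>\<Phi>"
proof (rule bounded_clinear_hardy2I[OF _ _ norm_composition_operator])
  show "C\<^sub>\<Phi> (f + h) = C\<^sub>\<Phi> f + C\<^sub>\<Phi> h" for f h
    by (rule composition_operator_eqI) (simp add: hardy2_fun_add hardy2_fun_composition_operator)
  show "C\<^sub>\<Phi> (a *\<^sub>C f) = a *\<^sub>C C\<^sub>\<Phi> f" for a f
    by (rule composition_operator_eqI) (simp add: hardy2_fun_scaleC hardy2_fun_composition_operator)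
qed

lemma composition_operator_finite_rank:
  obtains D where "0 < D" "\<And>n. \<exists>Q. finite Q \<and> orthonormal Q \<and> real (card Q) \<le> D * (real n)\<^sup>2 \<and>
    (\<forall>f. norm (C\<^sub>\<Phi> f - C\<^sub>\<Phi> (hardy2_proj Q f)) \<le> norm_const * (2 / 3) ^ n * norm f)"
proof -
  obtain L where L: "0 < L" "\<And>n k x. 0 < k \<Longrightarrow> k \<le> n \<Longrightarrow> 3 ^ nat \<lceil>L * sqrt (real n / real k)\<rceil> \<le> x \<Longrightarrow>
      (8 * x * exp (- (cos (\<theta> * pi / 2) * x powr \<theta>))) ^ k \<le> (1 / 4) ^ n"
    using cutoff_exists by metis
  have "\<exists>Q. finite Q \<and> orthonormal Q \<and> real (card Q) \<le> 17 * (9 + 2 * L) * (real n)\<^sup>2 \<and>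
    (\<forall>f. norm (C\<^sub>\<Phi> f - C\<^sub>\<Phi> (hardy2_proj Q f)) \<le> norm_const * (2 / 3) ^ n * norm f)" for n
  proof -
    have bf: "bounded_functional (node_functional \<nu>)" if "\<nu> \<in> node_set L n" for \<nu>
    proof -
      obtain k j i where \<nu>: "\<nu> = (k, j, i)" by (cases \<nu>)
      have "1 - 1 / 3 ^ j = complex_of_real (1 - 1 / 3 ^ j)" by simp
      then have "cmod (1 - 1 / 3 ^ j) = \<bar>1 - 1 / 3 ^ j\<bar>" by (simp only: norm_of_real)
      also have "\<dots> < 1" by simp
      finally show ?thesis
        unfolding \<nu> node_functional_def prod.case by (rule bounded_functional_diag_coeff)
    qed
    have small: "norm (C\<^sub>\<Phi> f) \<le> norm_const * (2 / 3) ^ n * norm f"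
      if vanish: "\<And>\<nu>. \<nu> \<in> node_set L n \<Longrightarrow> node_functional \<nu> f = 0" for f
    proof -
      obtain h where h: "norm h \<le> norm_const * (2 / 3) ^ n * norm f"
        "\<And>z. z \<in> bidisk \<Longrightarrow> hardy2_fun h z = hardy2_fun f (\<Phi> z)"
        by (rule composition_in_hardy2[of f "(2 / 3) ^ n"])
          (use composition_bound[OF L(2) vanish] in auto)
      then show ?thesis using composition_operator_eqI[OF h(2)] by simp
    qed
    obtain Q where "finite Q" "card Q \<le> card (node_set L n)" "orthonormal Q"
      "\<And>f. norm (C\<^sub>\<Phi> f - C\<^sub>\<Phi> (hardy2_proj Q f)) \<le> norm_const * (2 / 3) ^ n * norm f"
      by (rule finite_rank_approximation[OF bounded_clinear_composition_operator finite_node_set bf _ small])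
        (use norm_const_pos in auto)
    moreover from this have "real (card Q) \<le> 17 * (9 + 2 * L) * (real n)\<^sup>2"
      using card_node_set[OF L(1), of n] by linarith
    ultimately show ?thesis by blast
  qed
  then show thesis
    using L(1) by (intro that[of "17 * (9 + 2 * L)"]) auto
qed

lemma compact_composition_operator: "compact_operator C\<^sub>\<Phi>"
proof (rule compact_operatorI[OF bounded_clinear_composition_operator])
  fix \<epsilon> :: real assume \<epsilon>: "0 < \<epsilon>"
  obtain n where n: "(2 / 3) ^ n < \<epsilon> / norm_const"
    using real_arch_pow_inv[of "\<epsilon> / norm_const" "2 / 3"] \<epsilon> norm_const_pos by auto
  then have le: "norm_const * (2 / 3) ^ n \<le> \<epsilon>"
    using norm_const_pos by (simp add: field_simps)
  obtain Q where "finite Q" "orthonormal Q"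
    "\<And>f. norm (C\<^sub>\<Phi> f - C\<^sub>\<Phi> (hardy2_proj Q f)) \<le> norm_const * (2 / 3) ^ n * norm f"
    using composition_operator_finite_rank by metis
  moreover have "norm_const * (2 / 3) ^ n * norm f \<le> \<epsilon> * norm f" for f :: hardy2
    by (intro mult_right_mono le) auto
  ultimately show "\<exists>Q. finite Q \<and> orthonormal Q \<and>
      (\<forall>f. norm (C\<^sub>\<Phi> f - C\<^sub>\<Phi> (hardy2_proj Q f)) \<le> \<epsilon> * norm f)"
    by (meson order_trans)
qed

lemma approx_number_decay:
  obtains C \<tau> where "0 < C" "0 < \<tau>" "\<And>m. 1 \<le> m \<Longrightarrow> approx_number C\<^sub>\<Phi> (m\<^sup>2) \<le> C * exp (- \<tau> * real m)"
proof -
  obtain D where D: "0 < D" "\<And>n. \<exists>Q. finite Q \<and> orthonormal Q \<and> real (card Q) \<le> D * (real n)\<^sup>2 \<and>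
    (\<forall>f. norm (C\<^sub>\<Phi> f - C\<^sub>\<Phi> (hardy2_proj Q f)) \<le> norm_const * (2 / 3) ^ n * norm f)"
    using composition_operator_finite_rank by metis
  define q where "q = nat \<lceil>D\<rceil> + 1"
  have q: "1 \<le> q" "D < real q" using D(1) by (auto simp: q_def) linarith
  define \<mu> where "\<mu> = ln (3 / 2 :: real)"
  have \<mu>: "0 < \<mu>" by (simp add: \<mu>_def)
  have "approx_number C\<^sub>\<Phi> (m\<^sup>2) \<le> norm_const * exp \<mu> * exp (- (\<mu> / real q) * real m)" if m: "1 \<le> m" for m
  proof -
    \<comment> \<open>With q > D the D n^2 conditions stay strictly below m^2; for n = 0 there are
      none. Rounding down loses at most one step, which the factor exp \<mu> repays.\<close>
    define n where "n = m div q"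
    obtain Q where Q: "finite Q" "real (card Q) \<le> D * (real n)\<^sup>2"
      "\<And>f. norm (C\<^sub>\<Phi> f - C\<^sub>\<Phi> (hardy2_proj Q f)) \<le> norm_const * (2 / 3) ^ n * norm f"
      using D(2)[of n] by blast
    have "real (card Q) < real (m\<^sup>2)"
    proof (cases "n = 0")
      case True
      then show ?thesis using Q(2) m by simp
    next
      case False
      have "D * (real n)\<^sup>2 < real q * (real n)\<^sup>2"
        using q False by (intro mult_strict_right_mono) auto
      also have "\<dots> \<le> (real q)\<^sup>2 * (real n)\<^sup>2"
        using q by (intro mult_right_mono) (auto simp: power2_eq_square)
      also have "\<dots> = (real (n * q))\<^sup>2" by (simp add: power_mult_distrib mult.commute)
      also have "\<dots> \<le> (real m)\<^sup>2"
        by (intro power_mono) (auto simp: n_def simp flip: of_nat_mult)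
      finally show ?thesis using Q(2) unfolding of_nat_power by linarith
    qed
    then have "approx_number C\<^sub>\<Phi> (m\<^sup>2) \<le> norm_const * (2 / 3) ^ n"
      using norm_const_pos
      by (intro approx_number_le[OF bounded_clinear_composition_operator Q(1) _ _ Q(3)]) auto
    also have "(2 / 3 :: real) ^ n = exp (- \<mu> * real n)"
    proof -
      have "exp (- \<mu>) = (2 / 3 :: real)" by (simp add: \<mu>_def exp_minus)
      then show ?thesis by (metis exp_of_nat_mult mult.commute)
    qed
    also have "norm_const * exp (- \<mu> * real n) \<le> norm_const * exp (\<mu> + - (\<mu> / real q) * real m)"
    proof (rule mult_left_mono)
      have "m < (n + 1) * q"
        using dividend_less_div_times[of q m] q by (simp add: n_def)
      then have "real m < (real n + 1) * real q"
        by (metis of_nat_1 of_nat_add of_nat_less_iff of_nat_mult)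
      then have "real m / real q \<le> real n + 1"
        using q by (simp add: divide_le_eq)
      then have "\<mu> * (real m / real q) \<le> \<mu> * (real n + 1)"
        using \<mu> by (intro mult_left_mono) auto
      then show "exp (- \<mu> * real n) \<le> exp (\<mu> + - (\<mu> / real q) * real m)"
        by (simp add: algebra_simps)
    qed (use norm_const_pos in simp)
    finally show ?thesis
      by (simp only: exp_add mult.assoc)
  qed
  then show thesis
    using norm_const_pos \<mu> q by (intro that[of "norm_const * exp \<mu>" "\<mu> / real q"]) auto
qed

end

text \<open>The n-th root of \<open>C\<close> tends to 1, so only exp (- \<tau>) survives in the
  limit superior.\<close>

lemma beta2_plus_less_1:
  assumes C: "0 < C" and \<tau>: "0 < \<tau>"
    and le: "\<And>n. 1 \<le> n \<Longrightarrow> approx_number T (n\<^sup>2) \<le> C * exp (- \<tau> * real n)"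
  shows "beta2_plus T < 1"
proof -
  have "beta2_plus T \<le> limsup (\<lambda>n. ereal (root n C * exp (- \<tau>)))"
    unfolding beta2_plus_def
  proof (rule Limsup_mono)
    have "root n (approx_number T (n\<^sup>2)) \<le> root n C * exp (- \<tau>)" if n: "1 \<le> n" for n
    proof -
      have "root n (approx_number T (n\<^sup>2)) \<le> root n (C * exp (- \<tau> * real n))"
        using n by (intro real_root_le_mono le) auto
      also have "exp (- \<tau> * real n) = exp (- \<tau>) ^ n"
        by (simp add: exp_of_nat_mult[symmetric] mult.commute)
      also have "root n (C * exp (- \<tau>) ^ n) = root n C * exp (- \<tau>)"
        using n by (simp add: real_root_mult real_root_power_cancel)
      finally show ?thesis .
    qed
    then show "\<forall>\<^sub>F n in sequentially. ereal (root n (approx_number T (n\<^sup>2))) \<le> ereal (root n C * exp (- \<tau>))"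
      by (auto simp: eventually_sequentially)
  qed
  also have "limsup (\<lambda>n. ereal (root n C * exp (- \<tau>))) = ereal (1 * exp (- \<tau>))"
    by (intro lim_imp_Limsup tendsto_ereal tendsto_mult LIMSEQ_root_const C tendsto_const) simp
  also have "\<dots> < 1" using \<tau> by simp
  finally show ?thesis .
qed

section \<open>Regularity, non-degeneracy and boundary contact of the symbol\<close>

lemma deriv_nonzero_exists:
  assumes hol: "f holomorphic_on ball 0 1" and cont: "continuous_on (cball 0 1) f"
    and nc: "\<not> f constant_on cball 0 1"
  shows "\<exists>z\<in>ball 0 1. deriv f z \<noteq> 0"
proof (rule ccontr)
  assume "\<not> ?thesis"
  then have "(f has_field_derivative 0) (at z within ball 0 1)" if "z \<in> ball 0 1" for z
    using holomorphic_derivI[OF hol open_ball that] that by auto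
  then obtain a where a: "\<And>z. z \<in> ball 0 1 \<Longrightarrow> f z = a"
    using has_field_derivative_zero_constant[of "ball 0 1" f] by (metis convex_ball)
  have "f z = a" if "z \<in> cball 0 1" for z
    by (rule continuous_constant_on_closure[of "ball 0 1"]) (use cont a that in auto)
  then show False using nc by (auto simp: constant_on_def)
qed

lemma holomorphic2_on_bidiskI:
  assumes p: "p holomorphic_on ball 0 1" and q: "q holomorphic_on ball 0 1"
    and r: "r holomorphic_on ball 0 1"
  shows "(\<lambda>z. p (fst z) + q (fst z) * r (snd z)) holomorphic2_on bidisk"
  unfolding holomorphic2_on_def
proof
  fix z assume z: "z \<in> bidisk"
  have der: "(f has_derivative (\<lambda>h. deriv f a * h)) (at a)" if "f holomorphic_on ball 0 1" "a \<in> ball 0 1" for f a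
    using holomorphic_derivI[OF that(1) open_ball that(2)] by (simp add: has_field_derivative_def)
  have z1: "fst z \<in> ball 0 1" and z2: "snd z \<in> ball 0 1" using z by (auto simp: bidisk_def)
  have fst: "((\<lambda>z. f (fst z)) has_derivative (\<lambda>h. deriv f (fst z) * fst h)) (at z within bidisk)"
    if "f holomorphic_on ball 0 1" for f :: "complex \<Rightarrow> complex"
    by (rule has_derivative_compose[OF has_derivative_fst[OF has_derivative_ident] der[OF that z1]])
  have snd: "((\<lambda>z. r (snd z)) has_derivative (\<lambda>h. deriv r (snd z) * snd h)) (at z within bidisk)"
    by (rule has_derivative_compose[OF has_derivative_snd[OF has_derivative_ident] der[OF r z2]])
  have "((\<lambda>z. p (fst z) + q (fst z) * r (snd z)) has_derivative
      (\<lambda>h. deriv p (fst z) * fst h + (q (fst z) * (deriv r (snd z) * snd h) + deriv q (fst z) * fst h * r (snd z))))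
      (at z within bidisk)"
    by (intro has_derivative_add has_derivative_mult fst snd p q)
  then have "((\<lambda>z. p (fst z) + q (fst z) * r (snd z)) has_derivative
      (\<lambda>h. (deriv p (fst z) + deriv q (fst z) * r (snd z)) * fst h + (q (fst z) * deriv r (snd z)) * snd h))
      (at z within bidisk)"
    by (simp add: algebra_simps)
  then show "\<exists>a b. ((\<lambda>z. p (fst z) + q (fst z) * r (snd z)) has_derivative (\<lambda>h. a * fst h + b * snd h)) (at z within bidisk)"
    by blast
qed

context cusp_composition
begin

text \<open>The term \<open>0 * g (snd z)\<close> gives the first component the shape that
  \<open>holomorphic2_on_bidiskI\<close> handles.\<close>

lemma fst_symbol: "fst \<circ> \<Phi> = (\<lambda>z. cusp_map (fst z) + 0 * g (snd z))"
  and snd_symbol: "snd \<circ> \<Phi> = (\<lambda>z. cusp_map (fst z) + amplitude (fst z) * g (snd z))"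
  by (auto simp: fun_eq_iff symbol_eq)

lemma symbol_bidisk_algebra: "fst \<circ> \<Phi> \<in> bidisk_algebra" "snd \<circ> \<Phi> \<in> bidisk_algebra"
proof -
  have c: "continuous_on closed_bidisk (\<lambda>z. f (fst z))" "continuous_on closed_bidisk (\<lambda>z. f (snd z))"
    if "continuous_on (cball 0 1) f" for f :: "complex \<Rightarrow> complex"
    by (rule continuous_on_compose2[OF that]; auto simp: closed_bidisk_def intro!: continuous_intros)+
  show "fst \<circ> \<Phi> \<in> bidisk_algebra"
    unfolding bidisk_algebra_def fst_symbol mem_Collect_eq
    by (intro conjI holomorphic2_on_bidiskI[of cusp_map "\<lambda>_. 0"] holomorphic_on_const holomorphic_cusp_map
        holomorphic_g continuous_intros c continuous_on_cusp_map continuous_g)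
  show "snd \<circ> \<Phi> \<in> bidisk_algebra"
    unfolding bidisk_algebra_def snd_symbol
    by (auto intro!: holomorphic2_on_bidiskI holomorphic_amplitude holomorphic_cusp_map holomorphic_g
        continuous_intros c continuous_on_cusp_map continuous_amplitude continuous_g)
qed

text \<open>The first component is independent of the second variable, so the Jacobian is a product
  of diagonal entries. The amplitude is a nonzero multiple of an exponential, and neither
  \<open>cusp_map\<close> nor \<open>g\<close> is constant.\<close>

lemma symbol_nondegenerate:
  assumes nc: "\<not> g constant_on cball 0 1"
  shows "nondegenerate \<Phi>"
proof -
  obtain w where w: "w \<in> ball 0 1" "deriv g w \<noteq> 0"
    using deriv_nonzero_exists[OF holomorphic_g continuous_g nc] by blast
  have "\<not> cusp_map constant_on cball 0 1"
  proof
    assume "cusp_map constant_on cball 0 1"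
    then obtain a where a: "\<And>z. z \<in> cball 0 1 \<Longrightarrow> cusp_map z = a"
      by (auto simp: constant_on_def)
    have "cusp_map 0 = cusp_map 1" using a[of 0] a[of 1] by simp
    then show False
      using cusp_map_modulus(2)[of 0] by (simp add: cusp_map_1)
  qed
  then obtain z where z: "z \<in> ball 0 1" "deriv cusp_map z \<noteq> 0"
    using deriv_nonzero_exists[OF holomorphic_cusp_map continuous_on_cusp_map] by blast
  have "cusp_map z \<noteq> 1" using cusp_map_modulus(2)[OF z(1)] by auto
  then have s: "amplitude z \<noteq> 0" using c_bounds by (simp add: amplitude_def phi_def)
  have "((\<lambda>w. cusp_map z + amplitude z * g w) has_field_derivative amplitude z * deriv g w) (at w)"
    by (auto intro!: derivative_eq_intros holomorphic_derivI[OF holomorphic_g open_ball w(1)])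
  then have "jacobian2 \<Phi> (z, w) = deriv cusp_map z * (amplitude z * deriv g w)"
    by (simp add: jacobian2_def symbol_eq DERIV_imp_deriv)
  then have "jacobian2 \<Phi> (z, w) \<noteq> 0" using z w s by simp
  moreover have "(z, w) \<in> bidisk" using z w by (simp add: bidisk_def)
  ultimately show ?thesis
    using symbol_bidisk_algebra symbol_image by (auto simp: nondegenerate_def bidisk_algebra_def)
qed

text \<open>The point (1, 1) is fixed, because \<open>phi\<close> vanishes at
  \<open>cusp_map 1\<close>, which is 1.\<close>

lemma symbol_torus: "\<Phi> ` torus2 \<inter> torus2 \<noteq> {}"
proof -
  have "\<Phi> (1, 1) = (1, 1)" by (simp add: symbol_eq cusp_map_1 amplitude_def phi_def)
  moreover have "(1, 1) \<in> torus2" by (simp add: torus2_def)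
  ultimately show ?thesis by force
qed

end

theorem theorem6p1:
  fixes \<theta> :: real
  assumes "0 < \<theta>" and "\<theta> < 1"
  shows "(\<exists>c. admissible_constant \<theta> c) \<and>
    (\<forall>c g. admissible_constant \<theta> c \<and> g \<in> disk_algebra \<and> \<not> g constant_on cball 0 1 \<and>
        (\<forall>z\<in>cball 0 1. cmod (g z) \<le> 1) \<longrightarrow>
      (let \<Phi> = cusp_symbol \<theta> c g; C\<^sub>\<Phi> = composition_operator \<Phi> in
        (\<Phi> ` bidisk \<subseteq> bidisk \<and>
         (\<forall>f. \<forall>z\<in>bidisk. hardy2_fun (C\<^sub>\<Phi> f) z = hardy2_fun f (\<Phi> z)) \<and>
         bounded_clinear C\<^sub>\<Phi> \<and> compact_operator C\<^sub>\<Phi>) \<and>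
        (nondegenerate \<Phi> \<and> fst \<circ> \<Phi> \<in> bidisk_algebra \<and> snd \<circ> \<Phi> \<in> bidisk_algebra) \<and>
        (\<Phi> ` torus2 \<inter> torus2 = \<Phi> ` torus2 \<inter> distinguished_boundary \<and>
         \<Phi> ` torus2 \<inter> distinguished_boundary \<noteq> {}) \<and>
        ((\<exists>C>0. \<exists>\<tau>>0. \<forall>n\<ge>1. approx_number C\<^sub>\<Phi> (n\<^sup>2) \<le> C * exp (- \<tau> * real n)) \<and>
         beta2_plus C\<^sub>\<Phi> < 1)))"
proof (intro conjI allI impI)
  show "\<exists>c. admissible_constant \<theta> c"
    using assms by (rule admissible_constant_exists)
  fix c g
  assume hyp: "admissible_constant \<theta> c \<and> g \<in> disk_algebra \<and> \<not> g constant_on cball 0 1 \<and>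
    (\<forall>z\<in>cball 0 1. cmod (g z) \<le> 1)"
  interpret cusp_composition \<theta> c g
    using assms hyp by unfold_locales auto
  obtain C \<tau> where C: "0 < C" "0 < \<tau>"
    "\<And>n. 1 \<le> n \<Longrightarrow> approx_number C\<^sub>\<Phi> (n\<^sup>2) \<le> C * exp (- \<tau> * real n)"
    using approx_number_decay by metis
  have nondeg: "nondegenerate \<Phi>"
    using hyp by (intro symbol_nondegenerate) blast
  have "beta2_plus C\<^sub>\<Phi> < 1"
    by (rule beta2_plus_less_1[OF C])
  moreover have "\<exists>C>0. \<exists>\<tau>>0. \<forall>n\<ge>1. approx_number C\<^sub>\<Phi> (n\<^sup>2) \<le> C * exp (- \<tau> * real n)"
    using C by blast
  ultimately show "let \<Phi> = cusp_symbol \<theta> c g; C\<^sub>\<Phi> = composition_operator \<Phi> in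
        (\<Phi> ` bidisk \<subseteq> bidisk \<and>
         (\<forall>f. \<forall>z\<in>bidisk. hardy2_fun (C\<^sub>\<Phi> f) z = hardy2_fun f (\<Phi> z)) \<and>
         bounded_clinear C\<^sub>\<Phi> \<and> compact_operator C\<^sub>\<Phi>) \<and>
        (nondegenerate \<Phi> \<and> fst \<circ> \<Phi> \<in> bidisk_algebra \<and> snd \<circ> \<Phi> \<in> bidisk_algebra) \<and>
        (\<Phi> ` torus2 \<inter> torus2 = \<Phi> ` torus2 \<inter> distinguished_boundary \<and>
         \<Phi> ` torus2 \<inter> distinguished_boundary \<noteq> {}) \<and>
        ((\<exists>C>0. \<exists>\<tau>>0. \<forall>n\<ge>1. approx_number C\<^sub>\<Phi> (n\<^sup>2) \<le> C * exp (- \<tau> * real n)) \<and>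
         beta2_plus C\<^sub>\<Phi> < 1)"
    unfolding Let_def distinguished_boundary_def
    by (intro conjI allI ballI refl symbol_image hardy2_fun_composition_operator
        bounded_clinear_composition_operator compact_composition_operator nondeg
        symbol_bidisk_algebra symbol_torus)
qed

end
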